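(* Let $\mathrm{SCI}$ denote the Self-Crossing Index of oriented knot diagrams, $\mathrm{SCI}(D)=\sum_{c}\mathrm{sgn}(c)\,\mathrm{ind}(c)$, the sum being over all crossings $c$ of $D$. Then $\mathrm{SCI}$ increases by $1$ under every forward $\Omega 3$ move, and it does not change under $\Omega 1\mathrm{F}$ moves or under $\Omega 2$ moves.
   Context: Knot diagrams are oriented diagrams in the plane $\mathbb{R}^2$ (generic immersed closed curves with over/under information at each crossing). $\mathrm{sgn}(c)\in\{+1,-1\}$ is the usual sign of a crossing. Indices. For an oriented closed plane curve $C$ given by $\gamma:S^1\to\mathbb{R}^2$ and a point $p\notin\gamma(S^1)$, $\mathrm{ind}_C(p)$ is the degree of $t\mapsto(\gamma(t)-p)/\|\gamma(t)-p\|$ (winding number of $C$ around $p$). It is constant on each region (connected component of $\mathbb{R}^2\setminus C$), giving the index of the region. The index $\mathrm{ind}(c)$ of a crossing $c$ is the average of the indices of the four regions adjacent to $c$ (counted with multiplicity). For a knot diagram, indices are taken with respect to its underlying oriented curve. Moves. $\Omega 2$ and $\Omega 3$ are the usual Reidemeister moves of type II (all orientations) and type III. An $\Omega 1\mathrm{F}$ move is the framed version of the type I move: it creates (or, reversed, removes), on a single strand, two consecutive small kinks lying on the same side of the strand, whose crossings have opposite signs. Forward $\Omega 3$ moves. In an $\Omega 3$ move three strands are involved: the bottom, the middle and the top one. The vanishing triangle is the triangle formed by the three edges joining the three crossings of the move (before the move, resp. after it); each of its sides lies on one of the three strands and inherits the orientation of the diagram. Orient the boundary of the triangle by the cyclic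 order bottom $\to$ middle $\to$ top of its sides, and let $m$ be the number of sides whose orientation inherited from the diagram agrees with this orientation. The move is forward if $m$ is odd before the move and even after it, and backward if the reverse occurs. *)

theory Defs
  imports "HOL-Complex_Analysis.Complex_Analysis"
begin

section \<open>Oriented knot diagrams\<close>

text \<open>
  The plane is the type of complex numbers. An oriented closed plane curve is given by a
  map from the reals of period 1, so that its restriction to the unit interval is a loop in the
  sense of the library. The boolean \<open>over t\<close> says whether the curve runs along the upper
  strand at parameter \<open>t\<close>; it is meaningful only if \<open>curve t\<close> is a crossing.
\<close>

record diagram =
  curve :: "real \<Rightarrow> complex"
  over :: "real \<Rightarrow> bool"

definition tangent :: "diagram \<Rightarrow> real \<Rightarrow> complex" where
  "tangent D t = vector_derivative (curve D) (at t)"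

definition det2 :: "complex \<Rightarrow> complex \<Rightarrow> real" where
  "det2 u v = Re u * Im v - Im u * Re v"

text \<open>Every crossing occurs twice below, as \<open>(s, t)\<close> and as \<open>(t, s)\<close>.\<close>

definition double_points :: "diagram \<Rightarrow> (real \<times> real) set" where
  "double_points D =
     {(s, t). s \<in> {0..<1} \<and> t \<in> {0..<1} \<and> s \<noteq> t \<and> curve D s = curve D t}"

definition knot_diagram :: "diagram \<Rightarrow> bool" where
  "knot_diagram D \<longleftrightarrow>
     (\<forall>t. curve D (t + 1) = curve D t) \<and>
     (\<forall>t. over D (t + 1) = over D t) \<and>
     curve D C1_differentiable_on UNIV \<and>
     (\<forall>t. tangent D t \<noteq> 0) \<and>
     finite (double_points D) \<and>
     (\<forall>r s t. (r, s) \<in> double_points D \<and> (r, t) \<in> double_points D \<longrightarrow> s = t) \<and>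
     (\<forall>(s, t)\<in>double_points D.
        det2 (tangent D s) (tangent D t) \<noteq> 0 \<and> (over D s \<longleftrightarrow> \<not> over D t))"

text \<open>The crossings, each given once: upper parameter first, lower parameter second.\<close>

definition crossings :: "diagram \<Rightarrow> (real \<times> real) set" where
  "crossings D = {(s, t) \<in> double_points D. over D s}"

text \<open>
  A crossing is positive if the tangents of the upper and of the lower strand, in this order,
  form a positively oriented frame. The value is symmetric in \<open>s\<close> and \<open>t\<close>.
\<close>

definition crossing_sign :: "diagram \<Rightarrow> real \<Rightarrow> real \<Rightarrow> real" where
  "crossing_sign D s t =
     (if over D s then sgn (det2 (tangent D s) (tangent D t))
      else sgn (det2 (tangent D t) (tangent D s)))"


section \<open>Indices and the self-crossing index\<close>

definition regions :: "diagram \<Rightarrow> complex set set" where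
  "regions D = components (- path_image (curve D))"

definition region_index :: "diagram \<Rightarrow> complex set \<Rightarrow> int" where
  "region_index D R = (THE k. \<forall>p\<in>R. winding_number (curve D) p = of_int k)"

text \<open>
  The two tangent lines at a crossing cut a small disc around it into four sectors. The sector
  containing the direction \<open>a u + b v\<close> (\<open>u\<close>, \<open>v\<close> the tangents, \<open>a\<close>, \<open>b\<close> signs) determines
  one of the four adjacent regions; the same region may occur for several sectors.
\<close>

definition corner_region :: "diagram \<Rightarrow> real \<Rightarrow> real \<Rightarrow> real \<Rightarrow> real \<Rightarrow> complex set" where
  "corner_region D s t a b =
     (THE R. R \<in> regions D \<and>
        (\<forall>\<^sub>F e in at_right 0.
           curve D s + e *\<^sub>R (a *\<^sub>R tangent D s + b *\<^sub>R tangent D t) \<in> R))"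

definition crossing_index :: "diagram \<Rightarrow> real \<Rightarrow> real \<Rightarrow> real" where
  "crossing_index D s t =
     (\<Sum>a\<in>{-1, 1}. \<Sum>b\<in>{-1, 1}. real_of_int (region_index D (corner_region D s t a b))) / 4"

definition SCI :: "diagram \<Rightarrow> real" where
  "SCI D = (\<Sum>(s, t)\<in>crossings D. crossing_sign D s t * crossing_index D s t)"


section \<open>Local moves\<close>

text \<open>
  A diagram is an oriented curve rather than a parametrization, so the moves are
  stated up to orientation preserving reparametrization. This includes a change of the base
  point; hence the strands of a move may be taken to avoid the parameter \<open>0\<close>.
\<close>

definition reparam :: "diagram \<Rightarrow> diagram \<Rightarrow> bool" where
  "reparam D E \<longleftrightarrow>
     (\<exists>r. r C1_differentiable_on UNIV \<and> (\<forall>t. deriv r t > 0) \<and> (\<forall>t. r (t + 1) = r t + 1) \<and>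
          curve E = curve D \<circ> r \<and>
          (\<forall>(s, t)\<in>double_points E. over E s = over D (r s)))"

definition up_to_reparam ::
    "(diagram \<Rightarrow> diagram \<Rightarrow> bool) \<Rightarrow> diagram \<Rightarrow> diagram \<Rightarrow> bool" where
  "up_to_reparam M D E \<longleftrightarrow>
     knot_diagram D \<and> knot_diagram E \<and> (\<exists>D' E'. reparam D D' \<and> reparam E E' \<and> M D' E')"

text \<open>
  \<open>D\<close> and \<open>E\<close> coincide outside the closed topological disc \<open>B\<close>. In \<open>B\<close>, each of them consists
  of the strands with parameters in \<open>S\<close>, a union of disjoint compact intervals; the strands
  meet the boundary of \<open>B\<close> in their end points only.
\<close>

definition local_change :: "complex set \<Rightarrow> real set \<Rightarrow> diagram \<Rightarrow> diagram \<Rightarrow> bool" where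
  "local_change B S D E \<longleftrightarrow>
     knot_diagram D \<and> knot_diagram E \<and>
     B homeomorphic cball (0 :: complex) 1 \<and> S \<subseteq> {0<..<1} \<and>
     (\<forall>t\<in>interior S. curve D t \<in> interior B \<and> curve E t \<in> interior B) \<and>
     (\<forall>t\<in>{0..1} - interior S. curve E t = curve D t) \<and>
     (\<forall>t\<in>{0..1} - S. curve D t \<notin> B) \<and>
     (\<forall>(s, t)\<in>double_points D. s \<notin> S \<longrightarrow> over E s = over D s)"

text \<open>
  Each move is described by the tangles that the two diagrams form in the disc. By the
  Schoenflies theorem, the crossing pattern given determines such a tangle up to a homeomorphism
  of the disc, so that these are exactly the tangles of the usual pictures.
\<close>

definition double_points_in :: "real set \<Rightarrow> diagram \<Rightarrow> (real \<times> real) set" where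
  "double_points_in S D = double_points D \<inter> S \<times> S"


subsection \<open>Second move\<close>

text \<open>
  No order is imposed on \<open>t1\<close> and \<open>t2\<close>: the two strands may run in the same or in opposite
  directions. Either strand may be the upper one.
\<close>

definition Omega2_create :: "diagram \<Rightarrow> diagram \<Rightarrow> bool" where
  "Omega2_create D E \<longleftrightarrow>
     (\<exists>B a1 b1 a2 b2 s1 s2 t1 t2.
        a1 < b1 \<and> b1 < a2 \<and> a2 < b2 \<and>
        local_change B ({a1..b1} \<union> {a2..b2}) D E \<and>
        double_points_in ({a1..b1} \<union> {a2..b2}) D = {} \<and>
        {s1, s2} \<subseteq> {a1<..<b1} \<and> {t1, t2} \<subseteq> {a2<..<b2} \<and> s1 \<noteq> s2 \<and> t1 \<noteq> t2 \<and>
        double_points_in ({a1..b1} \<union> {a2..b2}) E = {(s1, t1), (t1, s1), (s2, t2), (t2, s2)} \<and>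
        (over E s1 \<longleftrightarrow> over E s2))"

definition Omega2 :: "diagram \<Rightarrow> diagram \<Rightarrow> bool" where
  "Omega2 = up_to_reparam (\<lambda>D E. Omega2_create D E \<or> Omega2_create E D)"


subsection \<open>Framed first move\<close>

text \<open>
  Consider a kink formed by the parameters between \<open>s\<close> and \<open>t\<close>, where \<open>s < t\<close>, and let \<open>u\<close>, \<open>v\<close>
  be the tangents at \<open>s\<close> and \<open>t\<close>. With the kink cut off, the strand arrives at the crossing in
  direction \<open>u\<close> and leaves it in direction \<open>v\<close>, whereas the kink starts straight on in direction
  \<open>u\<close>. So the kink lies on the left of the strand (value \<open>1\<close>) if the strand turns right, that is, if
  \<open>det2 u v < 0\<close>, and on its right (value \<open>-1\<close>) if \<open>det2 u v > 0\<close>.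
\<close>

definition kink_side :: "diagram \<Rightarrow> real \<Rightarrow> real \<Rightarrow> real" where
  "kink_side D s t = - sgn (det2 (tangent D s) (tangent D t))"

definition Omega1F_create :: "diagram \<Rightarrow> diagram \<Rightarrow> bool" where
  "Omega1F_create D E \<longleftrightarrow>
     (\<exists>B a b s1 t1 s2 t2.
        local_change B {a..b} D E \<and>
        double_points_in {a..b} D = {} \<and>
        a < s1 \<and> s1 < t1 \<and> t1 < s2 \<and> s2 < t2 \<and> t2 < b \<and>
        double_points_in {a..b} E = {(s1, t1), (t1, s1), (s2, t2), (t2, s2)} \<and>
        kink_side E s1 t1 = kink_side E s2 t2 \<and>
        crossing_sign E s1 t1 = - crossing_sign E s2 t2)"

definition Omega1F :: "diagram \<Rightarrow> diagram \<Rightarrow> bool" where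
  "Omega1F = up_to_reparam (\<lambda>D E. Omega1F_create D E \<or> Omega1F_create E D)"


subsection \<open>Third move\<close>

datatype strand = Bottom | Middle | Top

fun succ_strand :: "strand \<Rightarrow> strand" where
  "succ_strand Bottom = Middle"
| "succ_strand Middle = Top"
| "succ_strand Top = Bottom"

fun pred_strand :: "strand \<Rightarrow> strand" where
  "pred_strand Bottom = Top"
| "pred_strand Middle = Bottom"
| "pred_strand Top = Middle"

text \<open>
  Strand \<open>i\<close> has the parameters from \<open>a i\<close> to \<open>b i\<close>, and \<open>x i j\<close> is the parameter on strand \<open>i\<close>
  of its crossing with strand \<open>j\<close>; the values \<open>x i i\<close> play no role.
\<close>

definition triangle ::
    "diagram \<Rightarrow> (strand \<Rightarrow> real) \<Rightarrow> (strand \<Rightarrow> real) \<Rightarrow> (strand \<Rightarrow> strand \<Rightarrow> real) \<Rightarrow> bool" where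
  "triangle D a b x \<longleftrightarrow>
     (\<forall>i j. i \<noteq> j \<longrightarrow> x i j \<in> {a i<..<b i}) \<and>
     double_points_in (\<Union>i. {a i..b i}) D = {(x i j, x j i) | i j. i \<noteq> j} \<and>
     over D (x Middle Bottom) \<and> over D (x Top Bottom) \<and> over D (x Top Middle)"

text \<open>
  Going round the triangle along the bottom, the middle and the top side in this order, one runs
  through side \<open>i\<close> from the crossing with strand \<open>pred_strand i\<close> to the crossing with strand
  \<open>succ_strand i\<close>.
\<close>

definition agreeing_sides :: "(strand \<Rightarrow> strand \<Rightarrow> real) \<Rightarrow> nat" where
  "agreeing_sides x = card {i. x i (pred_strand i) < x i (succ_strand i)}"

text \<open>
  Three strands with given end points, crossing pairwise once, can be arranged in the disc in two
  ways (up to isotopy of the disc fixing its boundary), which differ by the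
  order in which each strand meets the other two; the move passes from one to the other.
\<close>

definition Omega3_local ::
    "(strand \<Rightarrow> strand \<Rightarrow> real) \<Rightarrow> (strand \<Rightarrow> strand \<Rightarrow> real) \<Rightarrow> diagram \<Rightarrow> diagram \<Rightarrow> bool" where
  "Omega3_local x y D E \<longleftrightarrow>
     (\<exists>B a b.
        (\<forall>i. a i < b i) \<and> (\<forall>i j. i \<noteq> j \<longrightarrow> {a i..b i} \<inter> {a j..b j} = {}) \<and>
        local_change B (\<Union>i. {a i..b i}) D E \<and>
        triangle D a b x \<and> triangle E a b y \<and>
        (\<forall>i. x i (pred_strand i) < x i (succ_strand i) \<longleftrightarrow>
             y i (succ_strand i) < y i (pred_strand i)))"

definition forward_Omega3 :: "diagram \<Rightarrow> diagram \<Rightarrow> bool" where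
  "forward_Omega3 =
     up_to_reparam (\<lambda>D E. \<exists>x y. Omega3_local x y D E \<and>
                            odd (agreeing_sides x) \<and> even (agreeing_sides y))"

end

theory Submission imports Defs begin

text \<open>
  Region indices are winding numbers, and near a point \<open>p\<close> of a knot diagram the winding number
  depends only on the direction \<open>d\<close> in which \<open>p\<close> is approached: it is \<open>L + n / 2\<close>, where \<open>n\<close> is the
  number of branches through \<open>p\<close> that have \<open>d\<close> on their left minus the number of those that have it
  on their right, and \<open>L\<close> does not depend on \<open>d\<close>. (Thus \<open>L\<close> is the principal value of the winding
  integral at \<open>p\<close>.) At a crossing the terms \<open>n / 2\<close> cancel in the average over the four sectors, so
  the index of the crossing is \<open>L\<close>. Since \<open>L\<close> also makes sense at the simple points of the curve,
  the index can be followed along the curve: it is constant between crossings, and when the curve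
  passes a crossing it changes by \<open>1\<close> or \<open>-1\<close>, the \<open>jump\<close>, depending on whether it comes to the left
  or to the right of the other branch; half of the jump has happened at the crossing itself. This is
  \<open>curve_index_change\<close>, and \<open>crossing_index_eq\<close> identifies the index of a crossing.

  A local move takes place in a disc. Strands with the same end points are homotopic in the disc, so
  winding numbers around points outside are preserved. Consequently the crossings outside the disc
  contribute the same to SCI before and after the move, and on each strand of the move both the index
  at its beginning and the sum of the jumps along it are preserved (\<open>curve_index_on_strand\<close>).

  For the second move, the two jumps on one strand must therefore cancel. So the two crossings have
  the same index, and as the same strand is the upper one at both, their signs are opposite. For
  the framed first move the signs are opposite by assumption; on the way from the first kink to the
  second the curve passes the second half of one jump and the first half of another, and these cancel
  because the kinks lie on the same side. Hence again the indices agree.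

  In the third move each strand \<open>i\<close> crosses the other two, and the move exchanges the order of the two
  crossings. So the index of the crossing of \<open>i\<close> and \<open>j\<close> changes, up to sign, by the jump of \<open>i\<close> at
  the third strand; the sign is given by the direction \<open>Q i\<close> of side \<open>i\<close> of the triangle. The
  jumps themselves are preserved, since a jump is the algebraic number of crossings of two arcs, which
  is determined by the turning of each arc about the end points of the other one
  (\<open>crossing_number_single_crossing\<close>). The change of the index of one crossing can be computed along
  either of its two strands. Comparing the results expresses the product of two jumps by the directions
  of the sides, and the total change of SCI turns out to be the product of the three \<open>Q i\<close>,
  which is \<open>1\<close> if the number of agreeing sides is odd.

  All of this is invariant under reparametrization (\<open>SCI_reparam\<close>).
\<close>

section \<open>Turning of an arc about a point\<close>

abbreviation velocity :: "(real \<Rightarrow> complex) \<Rightarrow> real \<Rightarrow> complex" where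
  "velocity g t \<equiv> vector_derivative g (at t)"

lemma C1_has_velocity:
  "g C1_differentiable_on UNIV \<Longrightarrow> (g has_vector_derivative velocity g t) (at t within A)"
  by (metis C1_differentiable_on_eq UNIV_I vector_derivative_works has_vector_derivative_at_within)

lemma C1_continuous_velocity: "g C1_differentiable_on UNIV \<Longrightarrow> continuous_on A (velocity g)"
  by (metis C1_differentiable_on_eq continuous_on_subset subset_UNIV)

lemma C1_continuous: "(g :: real \<Rightarrow> complex) C1_differentiable_on UNIV \<Longrightarrow> continuous_on A g"
  by (meson C1_has_velocity continuous_on_eq_continuous_within has_vector_derivative_continuous)

text \<open>
  For a closed curve this is the winding number. In general the real part is the angle swept out around
  \<open>z\<close> in units of a full turn, and the imaginary part records the change of the distance to
  \<open>z\<close>; it is kept so that the turning is a difference of complex logarithms. The parameter interval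
  may lie outside the unit interval, which allows one to choose the base point of a periodic curve.
\<close>
definition turn :: "(real \<Rightarrow> complex) \<Rightarrow> real \<Rightarrow> real \<Rightarrow> complex \<Rightarrow> complex" where
  "turn g a b z = integral {a..b} (\<lambda>t. velocity g t / (g t - z)) / (2 * of_real pi * \<i>)"

lemma turn_integrand_continuous:
  assumes "g C1_differentiable_on UNIV" "z \<notin> g ` A"
  shows "continuous_on A (\<lambda>t. velocity g t / (g t - z))"
  using assms by (intro continuous_intros C1_continuous_velocity C1_continuous) auto

lemma turn_integrable:
  assumes "g C1_differentiable_on UNIV" "z \<notin> g ` {a..b}"
  shows "(\<lambda>t. velocity g t / (g t - z)) integrable_on {a..b}"
  by (intro integrable_continuous_real turn_integrand_continuous assms)

lemma turn_combine:
  assumes "g C1_differentiable_on UNIV" "z \<notin> g ` {a..b}" "a \<le> c" "c \<le> b"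
  shows "turn g a b z = turn g a c z + turn g c b z"
  using Henstock_Kurzweil_Integration.integral_combine[OF assms(3,4) turn_integrable[OF assms(1,2)]]
  by (simp add: turn_def flip: add_divide_distrib)

lemma turn_refl [simp]: "turn g a a z = 0"
  by (simp add: turn_def)

text \<open>
  The condition says that some ray issuing from \<open>z\<close>, in a direction fixed by \<open>c\<close>, misses the arc; so a
  branch of the logarithm is available along it.
\<close>
lemma turn_eq_Ln:
  assumes g: "g C1_differentiable_on UNIV" and ab: "a \<le> b"
    and slit: "\<And>t. t \<in> {a..b} \<Longrightarrow> c * (g t - z) \<notin> \<real>\<^sub>\<le>\<^sub>0"
  shows "turn g a b z = (Ln (c * (g b - z)) - Ln (c * (g a - z))) / (2 * of_real pi * \<i>)"
proof -
  have "((\<lambda>t. Ln (c * (g t - z))) has_vector_derivative velocity g t / (g t - z)) (at t within {a..b})"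
    if t: "t \<in> {a..b}" for t
  proof -
    have nz: "c * (g t - z) \<noteq> 0" using slit[OF t] by auto
    have "((\<lambda>w. Ln (c * (w - z))) has_field_derivative inverse (c * (g t - z)) * c) (at (g t))"
      using slit[OF t] by (auto intro!: derivative_eq_intros simp: field_simps)
    from field_vector_diff_chain_at[OF C1_has_velocity[OF g, of t UNIV] this]
    have "((\<lambda>t. Ln (c * (g t - z))) has_vector_derivative velocity g t * (inverse (c * (g t - z)) * c)) (at t)"
      by (simp add: o_def)
    moreover have "velocity g t * (inverse (c * (g t - z)) * c) = velocity g t / (g t - z)"
      using nz by (simp add: field_simps)
    ultimately show ?thesis
      by (simp add: has_vector_derivative_at_within)
  qed
  then have "((\<lambda>t. velocity g t / (g t - z)) has_integral
              (Ln (c * (g b - z)) - Ln (c * (g a - z)))) {a..b}"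
    by (intro fundamental_theorem_of_calculus ab) auto
  then show ?thesis by (simp add: turn_def integral_unique)
qed

text \<open>
  The turning is determined modulo integers by the end points of the arc. This makes continuous
  combinations of turnings with cancelling end point terms constant.
\<close>
lemma exp_turn:
  assumes g: "g C1_differentiable_on UNIV" and ab: "a \<le> b" and z: "z \<notin> g ` {a..b}"
  shows "exp (2 * of_real pi * \<i> * turn g a b z) * (g a - z) = g b - z"
proof -
  define F where "F t = integral {a..t} (\<lambda>t. velocity g t / (g t - z))" for t
  have F: "(F has_vector_derivative velocity g t / (g t - z)) (at t within {a..b})"
    if "t \<in> {a..b}" for t
    unfolding F_def by (intro integral_has_vector_derivative turn_integrand_continuous g z that)
  have "((\<lambda>t. exp (- F t) * (g t - z)) has_vector_derivative 0) (at t within {a..b})"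
    if t: "t \<in> {a..b}" for t
  proof -
    have nz: "g t \<noteq> z" using z t by auto
    have 1: "((\<lambda>t. exp (- F t)) has_vector_derivative
            - (velocity g t / (g t - z)) * exp (- F t)) (at t within {a..b})"
      using field_vector_diff_chain_within[of "\<lambda>t. - F t" "- (velocity g t / (g t - z))" t "{a..b}" exp "exp (- F t)"]
        has_vector_derivative_minus[OF F[OF t]]
      by (auto simp: o_def intro: DERIV_exp has_field_derivative_at_within)
    have 2: "((\<lambda>t. g t - z) has_vector_derivative velocity g t) (at t within {a..b})"
      using has_vector_derivative_diff[OF C1_has_velocity[OF g, of t "{a..b}"] has_vector_derivative_const[of z]]
      by simp
    show ?thesis
      using has_vector_derivative_mult[OF 1 2] nz by (simp add: field_simps)
  qed
  then have "exp (- F a) * (g a - z) = exp (- F b) * (g b - z)"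
    using ab by (intro has_derivative_zero_unique[of "{a..b}" "\<lambda>t. exp (- F t) * (g t - z)"])
      (auto simp: has_vector_derivative_def)
  moreover have "F a = 0" by (simp add: F_def)
  moreover have "2 * of_real pi * \<i> * turn g a b z = F b" by (simp add: turn_def F_def)
  ultimately show ?thesis by (simp add: exp_minus field_simps)
qed

lemma turn_continuous_on:
  assumes g: "g C1_differentiable_on UNIV"
  shows "continuous_on (- g ` {a..b}) (turn g a b)"
proof -
  have vs: "continuous_on ((- g ` {a..b}) \<times> cbox a b) (\<lambda>x. velocity g (snd x))"
    by (rule continuous_on_compose2[OF C1_continuous_velocity[OF g, of UNIV]]) (auto intro: continuous_intros)
  have gs: "continuous_on ((- g ` {a..b}) \<times> cbox a b) (\<lambda>x. g (snd x))"
    by (rule continuous_on_compose2[OF C1_continuous[OF g, of UNIV]]) (auto intro: continuous_intros)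
  have "continuous_on ((- g ` {a..b}) \<times> cbox a b) (\<lambda>(z, t). velocity g t / (g t - z))"
    unfolding case_prod_unfold by (intro continuous_intros vs gs) auto
  then have "continuous_on (- g ` {a..b}) (\<lambda>z. integral (cbox a b) (\<lambda>t. velocity g t / (g t - z)))"
    by (rule integral_continuous_on_param)
  then show ?thesis unfolding turn_def[abs_def] by (auto intro!: continuous_intros)
qed

lemma open_off_arc:
  fixes g :: "real \<Rightarrow> complex"
  assumes "g C1_differentiable_on UNIV"
  shows "open (- g ` {a..b})"
  using compact_continuous_image[OF C1_continuous[OF assms] compact_Icc]
  by (simp add: compact_imp_closed open_Compl)

lemma turn_tendsto:
  assumes g: "g C1_differentiable_on UNIV" and z: "z \<notin> g ` {a..b}" and f: "(f \<longlongrightarrow> z) F"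
  shows "((\<lambda>x. turn g a b (f x)) \<longlongrightarrow> turn g a b z) F"
proof -
  have "isCont (turn g a b) z"
    using turn_continuous_on[OF g] open_off_arc[OF g] z continuous_on_eq_continuous_at by blast
  then show ?thesis using f isCont_tendsto_compose by blast
qed

lemma eventually_off_arc:
  fixes g :: "real \<Rightarrow> complex"
  assumes g: "g C1_differentiable_on UNIV" and z: "z \<notin> g ` {a..b}" and f: "(f \<longlongrightarrow> z) F"
  shows "eventually (\<lambda>x. f x \<notin> g ` {a..b}) F"
  using topological_tendstoD[OF f open_off_arc[OF g]] z by auto

lemma valid_path_C1: "g C1_differentiable_on UNIV \<Longrightarrow> valid_path (g :: real \<Rightarrow> complex)"
  using C1_differentiable_on_subset C1_differentiable_imp_piecewise valid_path_def by blast

lemma winding_number_eq_turn: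
  assumes "g C1_differentiable_on UNIV" "z \<notin> path_image g"
  shows "winding_number g z = turn g 0 1 z"
  using winding_number_valid_path[OF valid_path_C1[OF assms(1)] assms(2)]
  by (simp add: turn_def contour_integral_integral field_simps)

lemma winding_number_subpath_eq_turn:
  assumes g: "g C1_differentiable_on UNIV" and ab: "0 \<le> a" "a \<le> b" "b \<le> 1"
    and z: "z \<notin> g ` {a..b}"
  shows "winding_number (subpath a b g) z = turn g a b z"
proof (cases "a = b")
  case True
  with z show ?thesis by (simp add: winding_number_trivial)
next
  case False
  have ub: "vector_derivative (subpath a b g) (at t) = of_real (b - a) * velocity g ((b - a) * t + a)" for t
  proof -
    have "(subpath a b g has_vector_derivative (b - a) *\<^sub>R velocity g ((b - a) * t + a)) (at t)"
      unfolding subpath_def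
      by (rule vector_diff_chain_at[unfolded o_def, OF _ C1_has_velocity[OF g]])
        (auto intro!: derivative_eq_intros)
    then show ?thesis by (simp add: vector_derivative_at scaleR_conv_of_real)
  qed
  have pi: "path_image (subpath a b g) = g ` {a..b}" using ab by (simp add: path_image_subpath)
  have vp: "valid_path (subpath a b g)"
    using ab valid_path_subpath[OF valid_path_C1[OF g]] by auto
  have I: "integral {a..b} (\<lambda>t. velocity g t / (g t - z)) =
        integral {0..1} (\<lambda>t. (b - a) *\<^sub>R (velocity g ((b - a) * t + a) / (g ((b - a) * t + a) - z)))"
  proof -
    have "(\<lambda>x. (b - a) * x + a) ` {0..1} \<subseteq> {a..b}"
    proof safe
      fix x :: real assume "x \<in> {0..1}"
      then show "(b - a) * x + a \<in> {a..b}"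
        using ab mult_left_le[of x "b - a"] by auto
    qed
    then show ?thesis
      using has_integral_substitution[OF _ _ _ turn_integrand_continuous[OF g z],
          of 0 1 "\<lambda>x. (b - a) * x + a" "\<lambda>x. b - a"] ab
      by (intro integral_unique[symmetric]) (fastforce intro!: derivative_eq_intros)
  qed
  show ?thesis
    using winding_number_valid_path[OF vp, of z] z unfolding pi
    by (simp add: turn_def contour_integral_integral I ub scaleR_conv_of_real mult.commute)
      (simp add: subpath_def mult.commute)
qed

text \<open>
  The two arcs are homotopic with fixed end points in \<open>B\<close>, hence in the complement of \<open>z\<close>.
\<close>
lemma turn_simply_connected:
  assumes g: "g C1_differentiable_on UNIV" and h: "h C1_differentiable_on UNIV"
    and B: "simply_connected B" and ab: "0 \<le> a" "a \<le> b" "b \<le> 1"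
    and ends: "g a = h a" "g b = h b"
    and im: "g ` {a..b} \<subseteq> B" "h ` {a..b} \<subseteq> B" and z: "z \<notin> B"
  shows "turn g a b z = turn h a b z"
proof -
  have "path (subpath a b g)" "path (subpath a b h)"
    using ab by (simp_all add: path_subpath valid_path_imp_path valid_path_C1 g h)
  then have "homotopic_paths B (subpath a b g) (subpath a b h)"
    using B[unfolded simply_connected_eq_homotopic_paths] ab ends im
    by (simp add: path_image_subpath)
  then have "homotopic_paths (- {z}) (subpath a b g) (subpath a b h)"
    by (rule homotopic_paths_subset) (use z in auto)
  then have "winding_number (subpath a b g) z = winding_number (subpath a b h) z"
    by (rule winding_number_homotopic_paths)
  moreover have "z \<notin> g ` {a..b}" "z \<notin> h ` {a..b}" using im z by auto
  ultimately show ?thesis using winding_number_subpath_eq_turn g h ab by metis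
qed

lemma velocity_shift:
  assumes g: "g C1_differentiable_on UNIV" and p: "\<And>t. g (t + 1) = g t"
  shows "velocity g (t + 1) = velocity g t"
proof -
  have "(g \<circ> (\<lambda>x. x + 1) has_vector_derivative 1 *\<^sub>R velocity g (t + 1)) (at t)"
    by (rule vector_diff_chain_at[OF _ C1_has_velocity[OF g]]) (auto intro!: derivative_eq_intros)
  moreover have "g \<circ> (\<lambda>x. x + 1) = g" using p by auto
  ultimately show ?thesis by (simp add: vector_derivative_at)
qed

lemma turn_shift:
  assumes g: "g C1_differentiable_on UNIV" and p: "\<And>t. g (t + 1) = g t"
  shows "turn g (a + 1) (b + 1) z = turn g a b z"
  using integral_shift_Icc_real[of a b "\<lambda>t. velocity g t / (g t - z)" 1]
  by (simp add: turn_def o_def velocity_shift[OF g p] p add.commute)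

section \<open>Approaching a point of an arc\<close>

lemma det2_divide: "u \<noteq> 0 \<Longrightarrow> det2 u v = (cmod u)\<^sup>2 * Im (v / u)"
  by (simp add: det2_def Im_divide cmod_power2 complex_eq_iff sum_power2_eq_zero_iff)

lemma det2_commute: "det2 u v = - det2 v u"
  by (simp add: det2_def)

text \<open>
  For \<open>K > 0\<close> and in the coordinate in which \<open>T\<close> is the positive real direction, all velocities have a
  slope of absolute value less than \<open>K\<close> and point to the right. Chords inherit this property, so the arc is a graph of
  slope less than \<open>K\<close>.
\<close>
definition velocity_cone :: "(real \<Rightarrow> complex) \<Rightarrow> complex \<Rightarrow> real \<Rightarrow> real \<Rightarrow> real \<Rightarrow> bool" where
  "velocity_cone g T K a b \<longleftrightarrow> (\<forall>t\<in>{a..b}. \<bar>Im (velocity g t / T)\<bar> < K * Re (velocity g t / T))"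

text \<open>
  Both \<open>K Re - Im\<close> and \<open>K Re + Im\<close> have a positive derivative along the curve.
\<close>
lemma cone_chord:
  assumes g: "g C1_differentiable_on UNIV" and c: "velocity_cone g T K a b"
    and t: "a \<le> t" "t < t'" "t' \<le> b"
  shows "\<bar>Im ((g t' - g t) / T)\<bar> < K * Re ((g t' - g t) / T)"
proof -
  have *: "\<sigma> * Im ((g t' - g t) / T) < K * Re ((g t' - g t) / T)" if \<sigma>: "\<bar>\<sigma>\<bar> = 1" for \<sigma> :: real
  proof -
    define f where "f t = K * Re (g t / T) - \<sigma> * Im (g t / T)" for t
    have d: "((\<lambda>t. g t / T) has_vector_derivative velocity g x / T) (at x)" for x
      using has_vector_derivative_mult_left[OF C1_has_velocity[OF g, of x UNIV], of "inverse T"]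
      by (simp add: divide_inverse)
    have "f t < f t'"
    proof (rule DERIV_pos_imp_increasing[OF \<open>t < t'\<close>])
      fix x assume "t \<le> x" "x \<le> t'"
      then have "\<bar>Im (velocity g x / T)\<bar> < K * Re (velocity g x / T)"
        using c t unfolding velocity_cone_def by auto
      moreover have "\<sigma> * y \<le> \<bar>y\<bar>" for y :: real
        using \<sigma> by (metis abs_ge_self abs_mult mult_1)
      ultimately have "K * Re (velocity g x / T) - \<sigma> * Im (velocity g x / T) > 0"
        by (metis diff_gt_0_iff_gt order_le_less_trans)
      moreover have "(f has_real_derivative (K * Re (velocity g x / T) - \<sigma> * Im (velocity g x / T))) (at x)"
        unfolding f_def
        by (intro DERIV_diff DERIV_cmult bounded_linear.has_vector_derivative[OF bounded_linear_Re, THEN has_real_derivative_iff_has_vector_derivative[THEN iffD2]]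
            bounded_linear.has_vector_derivative[OF bounded_linear_Im, THEN has_real_derivative_iff_has_vector_derivative[THEN iffD2]] d)
      ultimately show "\<exists>y. DERIV f x :> y \<and> y > 0" by blast
    qed
    then show ?thesis by (simp add: f_def diff_divide_distrib algebra_simps)
  qed
  from *[of 1] *[of "-1"] show ?thesis by simp
qed

lemma cone_exists:
  assumes g: "g C1_differentiable_on UNIV" and T: "velocity g \<tau> \<noteq> 0" and K: "K > 0"
  shows "\<exists>\<delta>>0. \<forall>\<delta>'. \<delta>' \<le> \<delta> \<longrightarrow> velocity_cone g (velocity g \<tau>) K (\<tau> - \<delta>') (\<tau> + \<delta>')"
proof -
  let ?f = "\<lambda>t. K * Re (velocity g t / velocity g \<tau>) - \<bar>Im (velocity g t / velocity g \<tau>)\<bar>"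
  have "isCont (velocity g) \<tau>"
    using C1_continuous_velocity[OF g, of UNIV] continuous_on_eq_continuous_at by blast
  then have "isCont ?f \<tau>" using T by (intro continuous_intros) auto
  moreover have "?f \<tau> > 0" using T K by simp
  ultimately have "\<forall>\<^sub>F t in nhds \<tau>. ?f t > 0"
    unfolding continuous_at tendsto_at_iff_tendsto_nhds[of ?f] by (rule order_tendstoD(1))
  then obtain e where e: "e > 0" "\<And>t. dist t \<tau> < e \<Longrightarrow> ?f t > 0"
    unfolding eventually_nhds_metric by blast
  show ?thesis
  proof (intro exI[of _ "e/2"] conjI allI impI)
    fix \<delta>' assume "\<delta>' \<le> e/2"
    then show "velocity_cone g (velocity g \<tau>) K (\<tau> - \<delta>') (\<tau> + \<delta>')"
      unfolding velocity_cone_def using e by (force simp: dist_real_def)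
  qed (use e in auto)
qed

lemma Ln_quarter_turn:
  fixes \<sigma> :: real
  assumes \<sigma>: "\<bar>\<sigma>\<bar> = 1" and w: "Re w > 0"
  shows "Ln (of_real \<sigma> * \<i> * w) = Ln w + of_real \<sigma> * \<i> * of_real pi / 2"
proof (rule Ln_unique)
  have w0: "w \<noteq> 0" using w by auto
  have "\<sigma> = 1 \<or> \<sigma> = -1" using \<sigma> by linarith
  then have "exp (of_real \<sigma> * \<i> * of_real pi / 2) = of_real \<sigma> * \<i>"
    using arg_cong[OF cis_conv_exp[of "pi / 2"], of "\<lambda>x. x = \<i>"]
      arg_cong[OF cis_conv_exp[of "- (pi / 2)"], of "\<lambda>x. x = - \<i>"] by auto
  then show "exp (Ln w + of_real \<sigma> * \<i> * of_real pi / 2) = of_real \<sigma> * \<i> * w"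
    using w0 by (simp add: exp_add)
  have "\<bar>Im (Ln w)\<bar> < pi / 2" using Re_Ln_pos_lt[OF w0] w by simp
  then show "- pi < Im (Ln w + of_real \<sigma> * \<i> * of_real pi / 2)"
     "Im (Ln w + of_real \<sigma> * \<i> * of_real pi / 2) \<le> pi"
    using \<open>\<sigma> = 1 \<or> \<sigma> = -1\<close> by auto
qed

text \<open>
  The principal value of the turning of an arc about its own point \<open>g \<tau>\<close>: along the part before
  \<open>\<tau>\<close> the chord to \<open>g \<tau>\<close> turns from the direction of \<open>g \<tau> - g a\<close> to that of the velocity at
  \<open>\<tau>\<close>, along the part after \<open>\<tau>\<close> the chord from \<open>g \<tau>\<close> turns on to \<open>g b - g \<tau>\<close>.
\<close>
definition pv_turn :: "(real \<Rightarrow> complex) \<Rightarrow> complex \<Rightarrow> real \<Rightarrow> real \<Rightarrow> real \<Rightarrow> complex" where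
  "pv_turn g T a b \<tau> = (Ln ((g b - g \<tau>) / T) - Ln ((g \<tau> - g a) / T)) / (2 * of_real pi * \<i>)"

text \<open>
  The points \<open>z\<close> approach \<open>g \<tau>\<close> inside a sector that is steeper than the arc, on its left for
  \<open>\<sigma> = 1\<close> and on its right for \<open>\<sigma> = -1\<close>. The ray from such a point away from the arc
  does not meet it, so the turning is a difference of logarithms, continuous up to the limit.
  Compared with \<open>pv_turn\<close>, where the logarithms are taken relative to \<open>T\<close> instead of
  the normal direction, this adds \<open>\<sigma>\<close> times half a turn, a quarter at each end point.
\<close>
lemma turn_beside_arc:
  fixes \<sigma> :: real
  assumes g: "g C1_differentiable_on UNIV" and c: "velocity_cone g T K a b" and K: "K > 0" and T: "T \<noteq> 0"
    and \<tau>: "a < \<tau>" "\<tau> < b" and \<sigma>: "\<bar>\<sigma>\<bar> = 1"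
    and z: "(z \<longlongrightarrow> g \<tau>) F"
    and sec: "\<forall>\<^sub>F x in F. K * \<bar>Re ((z x - g \<tau>) / T)\<bar> < \<sigma> * Im ((z x - g \<tau>) / T)"
  shows "\<forall>\<^sub>F x in F. z x \<notin> g ` {a..b}"
    and "((\<lambda>x. turn g a b (z x)) \<longlongrightarrow> pv_turn g T a b \<tau> + of_real \<sigma> / 2) F"
proof -
  define c where "c = of_real \<sigma> * \<i> / T"
  have \<sigma>2: "\<sigma> = 1 \<or> \<sigma> = -1" using \<sigma> by linarith
  have chord: "\<bar>Im ((g t - g \<tau>) / T)\<bar> \<le> K * \<bar>Re ((g t - g \<tau>) / T)\<bar>" if "t \<in> {a..b}" for t
  proof -
    consider "t < \<tau>" | "t = \<tau>" | "t > \<tau>" by linarith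
    then show ?thesis
    proof cases
      case 1
      have "\<bar>Im ((g \<tau> - g t) / T)\<bar> < K * Re ((g \<tau> - g t) / T)"
        using cone_chord[OF g assms(2), of t \<tau>] 1 that \<tau> by auto
      also have "\<dots> \<le> K * \<bar>Re ((g \<tau> - g t) / T)\<bar>" using K by simp
      finally show ?thesis
        by (metis (no_types, opaque_lifting) abs_minus_commute diff_divide_distrib less_imp_le minus_complex.sel)
    next
      case 3
      have "\<bar>Im ((g t - g \<tau>) / T)\<bar> < K * Re ((g t - g \<tau>) / T)"
        using cone_chord[OF g assms(2), of \<tau> t] 3 that \<tau> by auto
      also have "\<dots> \<le> K * \<bar>Re ((g t - g \<tau>) / T)\<bar>" using K by simp
      finally show ?thesis by simp
    qed simp
  qed
  have slit: "c * (g t - w) \<notin> \<real>\<^sub>\<le>\<^sub>0"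
    if t: "t \<in> {a..b}" and w: "K * \<bar>Re ((w - g \<tau>) / T)\<bar> < \<sigma> * Im ((w - g \<tau>) / T)" for t w
  proof
    define h where "h = (g t - g \<tau>) / T"
    define v where "v = (w - g \<tau>) / T"
    have e: "c * (g t - w) = of_real \<sigma> * \<i> * (h - v)"
      by (simp add: c_def h_def v_def divide_simps T)
    assume "c * (g t - w) \<in> \<real>\<^sub>\<le>\<^sub>0"
    then have "Re h = Re v" "\<sigma> * Im v \<le> \<sigma> * Im h"
      unfolding e complex_nonpos_Reals_iff using \<sigma>2 by auto
    moreover have "\<sigma> * Im h \<le> \<bar>Im h\<bar>" using \<sigma>2 by auto
    moreover have "\<bar>Im h\<bar> \<le> K * \<bar>Re h\<bar>" using chord[OF t] by (simp add: h_def)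
    moreover have "K * \<bar>Re v\<bar> < \<sigma> * Im v" using w by (simp add: v_def)
    ultimately show False by simp
  qed
  show "\<forall>\<^sub>F x in F. z x \<notin> g ` {a..b}"
    using sec
  proof eventually_elim
    case (elim x)
    then show ?case using slit[of _ "z x"] by force
  qed
  have ev: "\<forall>\<^sub>F x in F. (Ln (c * (g b - z x)) - Ln (c * (g a - z x))) / (2 * of_real pi * \<i>) = turn g a b (z x)"
    using sec
  proof eventually_elim
    case (elim x)
    then show ?case using turn_eq_Ln[OF g, of a b c "z x"] slit[of _ "z x"] \<tau> by simp
  qed
  have Rb: "Re ((g b - g \<tau>) / T) > 0" and Ra: "Re ((g \<tau> - g a) / T) > 0"
    using cone_chord[OF g assms(2), of \<tau> b] cone_chord[OF g assms(2), of a \<tau>] \<tau> K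
    by (smt (verit) abs_ge_zero zero_less_mult_iff)+
  have eb: "c * (g b - g \<tau>) = of_real \<sigma> * \<i> * ((g b - g \<tau>) / T)" by (simp add: c_def)
  have ea: "c * (g a - g \<tau>) = of_real (- \<sigma>) * \<i> * ((g \<tau> - g a) / T)" 
    by (simp add: c_def divide_simps T) (simp add: algebra_simps)
  have "c * (g b - g \<tau>) \<notin> \<real>\<^sub>\<le>\<^sub>0" "c * (g a - g \<tau>) \<notin> \<real>\<^sub>\<le>\<^sub>0"
    unfolding ea eb complex_nonpos_Reals_iff
    using Ra Rb \<sigma>2 by (auto simp del: times_divide_eq_right)
  then have "((\<lambda>x. (Ln (c * (g b - z x)) - Ln (c * (g a - z x))) / (2 * of_real pi * \<i>)) \<longlongrightarrow>
        (Ln (c * (g b - g \<tau>)) - Ln (c * (g a - g \<tau>))) / (2 * of_real pi * \<i>)) F"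
    by (intro tendsto_intros z) auto
  moreover have "(Ln (c * (g b - g \<tau>)) - Ln (c * (g a - g \<tau>))) / (2 * of_real pi * \<i>)
       = pv_turn g T a b \<tau> + of_real \<sigma> / 2"
  proof -
    have 1: "Ln (c * (g b - g \<tau>)) = Ln ((g b - g \<tau>) / T) + of_real \<sigma> * \<i> * of_real pi / 2"
      unfolding eb by (rule Ln_quarter_turn[OF \<sigma> Rb])
    have 2: "Ln (c * (g a - g \<tau>)) = Ln ((g \<tau> - g a) / T) + of_real (- \<sigma>) * \<i> * of_real pi / 2"
      unfolding ea by (rule Ln_quarter_turn[OF _ Ra]) (use \<sigma> in simp)
    show ?thesis unfolding 1 2 pv_turn_def by (simp add: add_divide_distrib diff_divide_distrib)
  qed
  ultimately show "((\<lambda>x. turn g a b (z x)) \<longlongrightarrow> pv_turn g T a b \<tau> + of_real \<sigma> / 2) F"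
    using Lim_transform_eventually[OF _ ev] by simp
qed

text \<open>
  Besides straight segments this covers the points of a second curve that runs through \<open>p\<close>.
\<close>
definition directional :: "(real \<Rightarrow> complex) \<Rightarrow> complex \<Rightarrow> complex \<Rightarrow> bool" where
  "directional z p d \<longleftrightarrow> ((\<lambda>e. (z e - p) / of_real e) \<longlongrightarrow> d) (at_right 0)"

lemma eventually_pos_at_right: "\<forall>\<^sub>F e::real in at_right 0. e > 0"
  by (simp add: eventually_at_right_less)

lemma directional_tendsto:
  assumes "directional z p d" shows "(z \<longlongrightarrow> p) (at_right 0)"
proof -
  have "((\<lambda>e. p + of_real e * ((z e - p) / of_real e)) \<longlongrightarrow> p + of_real 0 * d) (at_right 0)"
    using assms unfolding directional_def by (intro tendsto_intros)
  moreover have "\<forall>\<^sub>F e in at_right 0. p + of_real e * ((z e - p) / of_real e) = z e"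
    using eventually_pos_at_right by eventually_elim simp
  ultimately show ?thesis using Lim_transform_eventually by fastforce
qed

lemma directional_line: "directional (\<lambda>e. p + of_real e * d) p d"
  unfolding directional_def
  by (rule tendsto_eventually) (use eventually_pos_at_right in eventually_elim, simp)

lemma directional_curve:
  assumes g: "g C1_differentiable_on UNIV" 
  shows "directional (\<lambda>e. g (s + \<sigma> * e)) (g s) (of_real \<sigma> * velocity g s)"
proof -
  have "((\<lambda>e. g (s + \<sigma> * e)) has_vector_derivative \<sigma> *\<^sub>R velocity g s) (at 0)"
  proof (rule vector_diff_chain_at[of "\<lambda>e. s + \<sigma> * e" \<sigma> 0 g, unfolded o_def])
    show "((\<lambda>e. s + \<sigma> * e) has_vector_derivative \<sigma>) (at 0)"
      unfolding has_real_derivative_iff_has_vector_derivative[symmetric]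
      by (auto intro!: derivative_eq_intros)
  qed (use C1_has_velocity[OF g, of s UNIV] in simp)
  then have "(\<lambda>e. norm (g (s + \<sigma> * e) - g s - e *\<^sub>R \<sigma> *\<^sub>R velocity g s) / norm e) \<midarrow>0\<rightarrow> 0"
    by (simp add: has_vector_derivative_def has_derivative_at)
  then have "((\<lambda>e. norm ((g (s + \<sigma> * e) - g s) / of_real e - of_real \<sigma> * velocity g s)) \<longlongrightarrow> 0) (at 0)"
  proof (rule Lim_transform_eventually)
    have "norm (x - e *\<^sub>R w) / norm e = norm (x / of_real e - w)" if "e \<noteq> 0" for x w :: complex and e :: real
    proof -
      have "x / of_real e - w = (x - e *\<^sub>R w) / of_real e"
        using that by (simp add: scaleR_conv_of_real diff_divide_distrib)
      then show ?thesis by (simp add: norm_divide)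
    qed
    then show "\<forall>\<^sub>F e in at 0. norm (g (s + \<sigma> * e) - g s - e *\<^sub>R \<sigma> *\<^sub>R velocity g s) / norm e =
        norm ((g (s + \<sigma> * e) - g s) / of_real e - of_real \<sigma> * velocity g s)"
      by (simp add: eventually_at_filter scaleR_conv_of_real[of \<sigma>])
  qed
  then have "((\<lambda>e. (g (s + \<sigma> * e) - g s) / of_real e) \<longlongrightarrow> of_real \<sigma> * velocity g s) (at 0)"
    by (rule LIM_zero_cancel[OF tendsto_norm_zero_cancel])
  then show ?thesis
    unfolding directional_def by (rule Lim_at_imp_Lim_at_within)
qed

lemma directional_cone:
  assumes T: "T \<noteq> 0" and d: "det2 T d \<noteq> 0"
  obtains K where "K > 0" "\<And>z p. directional z p d \<Longrightarrow>
     \<forall>\<^sub>F e in at_right 0. K * \<bar>Re ((z e - p) / T)\<bar> < sgn (det2 T d) * Im ((z e - p) / T)"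
proof
  define \<sigma> where "\<sigma> = sgn (det2 T d)"
  define K where "K = \<bar>Im (d / T)\<bar> / (1 + \<bar>Re (d / T)\<bar>)"
  have Im: "\<sigma> * Im (d / T) = \<bar>Im (d / T)\<bar>" "Im (d / T) \<noteq> 0"
    using d T unfolding \<sigma>_def det2_divide[OF T] by (auto simp: sgn_mult abs_sgn mult.commute)
  then show "K > 0" unfolding K_def by (simp add: divide_pos_pos add_pos_nonneg)
  have *: "K * \<bar>Re (d / T)\<bar> < \<sigma> * Im (d / T)"
    using Im by (simp add: K_def divide_less_eq add_pos_nonneg field_simps)
  fix z p assume "directional z p d"
  then have lim: "((\<lambda>e. (z e - p) / of_real e / T) \<longlongrightarrow> d / T) (at_right 0)"
    unfolding directional_def by (intro tendsto_intros T)
  have "((\<lambda>e. \<sigma> * Im ((z e - p) / of_real e / T) - K * \<bar>Re ((z e - p) / of_real e / T)\<bar>) \<longlongrightarrow>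
          \<sigma> * Im (d / T) - K * \<bar>Re (d / T)\<bar>) (at_right 0)"
    by (rule tendsto_diff[OF tendsto_mult[OF tendsto_const tendsto_Im]
          tendsto_mult[OF tendsto_const tendsto_rabs[OF tendsto_Re]]]) (fact lim)+
  then have "\<forall>\<^sub>F e in at_right 0. \<sigma> * Im ((z e - p) / of_real e / T) - K * \<bar>Re ((z e - p) / of_real e / T)\<bar> > 0"
    using * by (intro order_tendstoD) auto
  then show "\<forall>\<^sub>F e in at_right 0. K * \<bar>Re ((z e - p) / T)\<bar> < sgn (det2 T d) * Im ((z e - p) / T)"
    using eventually_pos_at_right
  proof eventually_elim
    case (elim e)
    have "(z e - p) / T = of_real e * ((z e - p) / of_real e / T)" using elim by simp
    then have "Re ((z e - p) / T) = e * Re ((z e - p) / of_real e / T)"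
      "Im ((z e - p) / T) = e * Im ((z e - p) / of_real e / T)"
      by (metis Re_complex_of_real Im_complex_of_real mult_zero_left diff_zero times_complex.sel(1),
          metis Re_complex_of_real Im_complex_of_real mult_zero_left add.right_neutral times_complex.sel(2))
    moreover have "e * (\<sigma> * Im ((z e - p) / of_real e / T) - K * \<bar>Re ((z e - p) / of_real e / T)\<bar>) > 0"
      using elim by simp
    ultimately show ?case using elim unfolding \<sigma>_def[symmetric]
      by (simp add: abs_mult algebra_simps)
  qed
qed

text \<open>
  \<open>L\<close> is the mean value of the limits of the turning on the two sides of the arc at its point of
  parameter \<open>\<tau>\<close>.
\<close>
definition arc_index :: "(real \<Rightarrow> complex) \<Rightarrow> real \<Rightarrow> real \<Rightarrow> real \<Rightarrow> complex \<Rightarrow> bool" where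
  "arc_index g a b \<tau> L \<longleftrightarrow>
     (\<forall>d z. det2 (velocity g \<tau>) d \<noteq> 0 \<longrightarrow> directional z (g \<tau>) d \<longrightarrow>
        (\<forall>\<^sub>F e in at_right 0. z e \<notin> g ` {a..b}) \<and>
        ((\<lambda>e. turn g a b (z e)) \<longlongrightarrow> L + of_real (sgn (det2 (velocity g \<tau>) d)) / 2) (at_right 0))"

text \<open>
  Away from \<open>\<tau>\<close> the turning is continuous at \<open>g \<tau>\<close>, so only a short piece around \<open>\<tau>\<close> matters.
  The closer \<open>d\<close> is to the direction of the arc, the shorter the piece has to be. The resulting
  value of \<open>L\<close> is nevertheless the same, because the direction perpendicular to the arc
  can be used for pieces of every length.
\<close>
lemma arc_index_exists:
  assumes g: "g C1_differentiable_on UNIV" and \<tau>: "a < \<tau>" "\<tau> < b"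
    and T: "velocity g \<tau> \<noteq> 0" and once: "\<And>t. t \<in> {a..b} \<Longrightarrow> g t = g \<tau> \<Longrightarrow> t = \<tau>"
  shows "\<exists>L. arc_index g a b \<tau> L"
proof -
  let ?T = "velocity g \<tau>"
  define L where "L \<delta> = turn g a (\<tau> - \<delta>) (g \<tau>) + pv_turn g ?T (\<tau> - \<delta>) (\<tau> + \<delta>) \<tau> + turn g (\<tau> + \<delta>) b (g \<tau>)" for \<delta>
  have lim: "(\<forall>\<^sub>F e in at_right 0. z e \<notin> g ` {a..b}) \<and>
      ((\<lambda>e. turn g a b (z e)) \<longlongrightarrow> L \<delta> + of_real \<sigma> / 2) (at_right 0)"
    if \<delta>: "\<delta> > 0" "a < \<tau> - \<delta>" "\<tau> + \<delta> < b" and c: "velocity_cone g ?T K (\<tau> - \<delta>) (\<tau> + \<delta>)" and K: "K > 0"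
      and \<sigma>: "\<bar>\<sigma>\<bar> = 1" and z: "(z \<longlongrightarrow> g \<tau>) (at_right 0)"
      and sec: "\<forall>\<^sub>F e in at_right 0. K * \<bar>Re ((z e - g \<tau>) / ?T)\<bar> < \<sigma> * Im ((z e - g \<tau>) / ?T)"
    for \<delta> K z and \<sigma> :: real
  proof -
    have off: "g \<tau> \<notin> g ` {a..\<tau> - \<delta>}" "g \<tau> \<notin> g ` {\<tau> + \<delta>..b}"
    proof -
      have "g t \<noteq> g \<tau>" if "t \<in> {a..\<tau> - \<delta>} \<union> {\<tau> + \<delta>..b}" for t
        using once[of t] \<delta> that by auto
      then show "g \<tau> \<notin> g ` {a..\<tau> - \<delta>}" "g \<tau> \<notin> g ` {\<tau> + \<delta>..b}"
        by (metis UnI1 imageE, metis UnI2 imageE)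
    qed
    note near = turn_beside_arc[OF g c K T _ _ \<sigma> z sec]
    have e1: "\<forall>\<^sub>F e in at_right 0. z e \<notin> g ` {a..\<tau> - \<delta>}" "\<forall>\<^sub>F e in at_right 0. z e \<notin> g ` {\<tau> + \<delta>..b}"
      "\<forall>\<^sub>F e in at_right 0. z e \<notin> g ` {\<tau> - \<delta>..\<tau> + \<delta>}"
      using eventually_off_arc[OF g off(1) z] eventually_off_arc[OF g off(2) z] near \<delta> by auto
    have "{a..b} = {a..\<tau> - \<delta>} \<union> {\<tau> - \<delta>..\<tau> + \<delta>} \<union> {\<tau> + \<delta>..b}" using \<delta> by auto
    then have im: "g ` {a..b} = g ` {a..\<tau> - \<delta>} \<union> g ` {\<tau> - \<delta>..\<tau> + \<delta>} \<union> g ` {\<tau> + \<delta>..b}"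
      by (simp add: image_Un)
    have ev: "\<forall>\<^sub>F e in at_right 0. z e \<notin> g ` {a..b}"
      using e1 by eventually_elim (simp add: im)
    have "((\<lambda>e. turn g a (\<tau> - \<delta>) (z e) + turn g (\<tau> - \<delta>) (\<tau> + \<delta>) (z e) + turn g (\<tau> + \<delta>) b (z e)) \<longlongrightarrow>
       turn g a (\<tau> - \<delta>) (g \<tau>) + (pv_turn g ?T (\<tau> - \<delta>) (\<tau> + \<delta>) \<tau> + of_real \<sigma> / 2) + turn g (\<tau> + \<delta>) b (g \<tau>)) (at_right 0)"
      using near \<delta> off by (intro tendsto_add turn_tendsto[OF g _ z]) auto
    moreover have "\<forall>\<^sub>F e in at_right 0. turn g a (\<tau> - \<delta>) (z e) + turn g (\<tau> - \<delta>) (\<tau> + \<delta>) (z e) + turn g (\<tau> + \<delta>) b (z e) = turn g a b (z e)"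
      using ev
    proof eventually_elim
      case (elim e)
      have "turn g a b (z e) = turn g a (\<tau> - \<delta>) (z e) + turn g (\<tau> - \<delta>) b (z e)"
        using turn_combine[OF g elim, of "\<tau> - \<delta>"] \<delta> by simp
      moreover have "turn g (\<tau> - \<delta>) b (z e) = turn g (\<tau> - \<delta>) (\<tau> + \<delta>) (z e) + turn g (\<tau> + \<delta>) b (z e)"
      proof (rule turn_combine[OF g])
        have "g ` {\<tau> - \<delta>..b} \<subseteq> g ` {a..b}" using \<delta> by (intro image_mono) auto
        with elim show "z e \<notin> g ` {\<tau> - \<delta>..b}" by blast
      qed (use \<delta> in auto)
      ultimately show ?case by simp
    qed
    ultimately have "((\<lambda>e. turn g a b (z e)) \<longlongrightarrow>
       turn g a (\<tau> - \<delta>) (g \<tau>) + (pv_turn g ?T (\<tau> - \<delta>) (\<tau> + \<delta>) \<tau> + of_real \<sigma> / 2) + turn g (\<tau> + \<delta>) b (g \<tau>)) (at_right 0)"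
      by (rule Lim_transform_eventually)
    with ev show ?thesis by (simp add: L_def algebra_simps)
  qed
  have good: "\<exists>\<delta>>0. a < \<tau> - \<delta> \<and> \<tau> + \<delta> < b \<and> velocity_cone g ?T K (\<tau> - \<delta>) (\<tau> + \<delta>)" if "K > 0" for K
  proof -
    obtain \<delta> where "\<delta> > 0" and c: "\<And>\<delta>'. \<delta>' \<le> \<delta> \<Longrightarrow> velocity_cone g ?T K (\<tau> - \<delta>') (\<tau> + \<delta>')"
      using cone_exists[OF g T \<open>K > 0\<close>] by blast
    moreover define \<delta>' where "\<delta>' = min \<delta> (min ((\<tau> - a) / 2) ((b - \<tau>) / 2))"
    ultimately have "\<delta>' > 0" using \<tau> by auto
    moreover have "\<delta>' \<le> \<delta>" "\<delta>' \<le> (\<tau> - a) / 2" "\<delta>' \<le> (b - \<tau>) / 2"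
      by (simp_all only: \<delta>'_def min_le_iff_disj order_refl simp_thms)
    ultimately have "\<delta>' > 0" "\<delta>' \<le> \<delta>" "a < \<tau> - \<delta>'" "\<tau> + \<delta>' < b" using \<tau> by auto
    then show ?thesis using \<tau> c[of \<delta>'] by (intro exI[of _ \<delta>']) auto
  qed
  define z0 where "z0 e = g \<tau> + of_real e * (\<i> * ?T)" for e
  have z0: "(z0 \<longlongrightarrow> g \<tau>) (at_right 0)"
    using directional_tendsto[OF directional_line] by (simp add: z0_def[abs_def])
  have z0s: "\<forall>\<^sub>F e in at_right 0. K * \<bar>Re ((z0 e - g \<tau>) / ?T)\<bar> < 1 * Im ((z0 e - g \<tau>) / ?T)" for K
    using eventually_pos_at_right by eventually_elim (use T in \<open>simp add: z0_def\<close>)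
  obtain \<delta>0 where d0: "\<delta>0 > 0" "a < \<tau> - \<delta>0" "\<tau> + \<delta>0 < b" "velocity_cone g ?T 1 (\<tau> - \<delta>0) (\<tau> + \<delta>0)"
    using good[of 1] by auto
  have "arc_index g a b \<tau> (L \<delta>0)"
    unfolding arc_index_def
  proof (intro allI impI)
    fix d z assume d: "det2 ?T d \<noteq> 0" and z: "directional z (g \<tau>) d"
    obtain K where K: "K > 0" "\<forall>\<^sub>F e in at_right 0. K * \<bar>Re ((z e - g \<tau>) / ?T)\<bar> < sgn (det2 ?T d) * Im ((z e - g \<tau>) / ?T)"
    proof (rule directional_cone[OF T d])
      fix K assume "0 < K" "\<And>z p. directional z p d \<Longrightarrow>
        \<forall>\<^sub>F e in at_right 0. K * \<bar>Re ((z e - p) / ?T)\<bar> < sgn (det2 ?T d) * Im ((z e - p) / ?T)"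
      then show thesis using that z by simp
    qed
    obtain \<delta> where \<delta>: "\<delta> > 0" "a < \<tau> - \<delta>" "\<tau> + \<delta> < b" "velocity_cone g ?T K (\<tau> - \<delta>) (\<tau> + \<delta>)"
      using good[OF K(1)] by auto
    have "L \<delta> + of_real 1 / 2 = L \<delta>0 + of_real 1 / 2"
      using lim[OF \<delta> K(1), of 1 z0, OF _ z0 z0s] lim[OF d0, of 1 z0, OF _ _ z0 z0s]
      by (intro tendsto_unique[of "at_right (0::real)"]) auto
    moreover have "\<bar>sgn (det2 ?T d)\<bar> = 1" using d by (simp add: sgn_if)
    ultimately show "(\<forall>\<^sub>F e in at_right 0. z e \<notin> g ` {a..b}) \<and>
        ((\<lambda>e. turn g a b (z e)) \<longlongrightarrow> L \<delta>0 + of_real (sgn (det2 ?T d)) / 2) (at_right 0)"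
      using lim[OF \<delta> K(1) _ directional_tendsto[OF z] K(2)] by simp
  qed
  then show ?thesis ..
qed

text \<open>
  On an arc that is a graph over one direction, the index of all inner points is given by a single
  formula. This yields its continuity along the arc.
\<close>
lemma arc_index_pv_turn:
  assumes g: "g C1_differentiable_on UNIV" and c: "velocity_cone g T K a b" and K: "K > 0" and T: "T \<noteq> 0"
    and \<tau>: "a < \<tau>" "\<tau> < b"
  shows "arc_index g a b \<tau> (pv_turn g T a b \<tau>)"
proof -
  have cv: "\<bar>Im (velocity g \<tau> / T)\<bar> < K * Re (velocity g \<tau> / T)"
    using c \<tau> unfolding velocity_cone_def by auto
  then have R: "Re (velocity g \<tau> / T) > 0"
    using K by (smt (verit) abs_ge_zero zero_less_mult_iff)
  then have v: "velocity g \<tau> \<noteq> 0" by auto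
  have once: "t = \<tau>" if "t \<in> {a..b}" "g t = g \<tau>" for t
    using cone_chord[OF g c, of t \<tau>] cone_chord[OF g c, of \<tau> t] that \<tau> by fastforce
  obtain L where L: "arc_index g a b \<tau> L"
    using arc_index_exists[OF g \<tau> v once] by blast
  define z where "z e = g \<tau> + of_real e * (\<i> * T)" for e
  have dz: "directional z (g \<tau>) (\<i> * T)"
    using directional_line by (simp add: z_def[abs_def])
  have zs: "\<forall>\<^sub>F e in at_right 0. K * \<bar>Re ((z e - g \<tau>) / T)\<bar> < 1 * Im ((z e - g \<tau>) / T)"
    using eventually_pos_at_right by eventually_elim (use T in \<open>simp add: z_def\<close>)
  have "det2 (q * T) (\<i> * T) = Re q * (cmod T)\<^sup>2" for q
    unfolding cmod_power2 by (simp add: det2_def power2_eq_square algebra_simps)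
  from this[of "velocity g \<tau> / T"] T
  have "det2 (velocity g \<tau>) (\<i> * T) = Re (velocity g \<tau> / T) * (cmod T)\<^sup>2" by simp
  then have s: "sgn (det2 (velocity g \<tau>) (\<i> * T)) = 1" using R T by (simp add: sgn_mult)
  have "det2 (velocity g \<tau>) (\<i> * T) \<noteq> 0" using s by auto
  with L[unfolded arc_index_def, rule_format, OF _ dz] s
  have "((\<lambda>e. turn g a b (z e)) \<longlongrightarrow> L + 1 / 2) (at_right 0)" by simp
  moreover have "((\<lambda>e. turn g a b (z e)) \<longlongrightarrow> pv_turn g T a b \<tau> + 1 / 2) (at_right 0)"
    using turn_beside_arc(2)[OF g c K T \<tau> _ directional_tendsto[OF dz] zs] by simp
  ultimately have "L + 1 / 2 = pv_turn g T a b \<tau> + 1 / 2"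
    by (intro tendsto_unique[of "at_right (0::real)"]) auto
  with L show ?thesis by simp
qed

lemma pv_turn_tendsto:
  assumes g: "g C1_differentiable_on UNIV" and c: "velocity_cone g T K a b" and K: "K > 0" and T: "T \<noteq> 0"
    and \<tau>: "a < \<tau>" "\<tau> < b" and f: "(f \<longlongrightarrow> \<tau>) F"
  shows "((\<lambda>x. pv_turn g T a b (f x)) \<longlongrightarrow> pv_turn g T a b \<tau>) F"
proof -
  have Rb: "Re ((g b - g \<tau>) / T) > 0" and Ra: "Re ((g \<tau> - g a) / T) > 0"
    using cone_chord[OF g c, of \<tau> b] cone_chord[OF g c, of a \<tau>] \<tau> K
    by (smt (verit) abs_ge_zero zero_less_mult_iff)+
  then have "(g b - g \<tau>) / T \<notin> \<real>\<^sub>\<le>\<^sub>0" "(g \<tau> - g a) / T \<notin> \<real>\<^sub>\<le>\<^sub>0"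
    by (auto simp: complex_nonpos_Reals_iff)
  moreover have "((\<lambda>x. g (f x)) \<longlongrightarrow> g \<tau>) F"
    using C1_continuous[OF g, of UNIV] f continuous_on_tendsto_compose by fastforce
  ultimately show ?thesis unfolding pv_turn_def by (intro tendsto_intros T) auto
qed

section \<open>The index of a point of a knot diagram\<close>

lemma Ints_dist_less_1_imp_eq:
  fixes a b :: complex
  assumes "a \<in> \<int>" "b \<in> \<int>" "dist a b < 1"
  shows "a = b"
proof -
  obtain m n where mn: "a = of_int m" "b = of_int n" using assms by (auto elim!: Ints_cases)
  have "norm (of_int (m - n) :: complex) < 1" using assms(3) by (simp add: dist_norm mn)
  then have "m = n" unfolding norm_of_int by linarith
  then show ?thesis by (simp add: mn)
qed

lemma no_int_between_0_1:
  assumes "0 < real_of_int n" "real_of_int n < 1"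
  shows False
proof -
  have "0 < n" "n < 1" using assms by (simp_all only: of_int_0_less_iff of_int_less_1_iff)
  then show False by simp
qed

definition branches :: "diagram \<Rightarrow> complex \<Rightarrow> real set" where
  "branches D p = {t \<in> {0..<1}. curve D t = p}"

text \<open>
  The winding number is approached along directions transversal to all branches at \<open>p\<close>; \<open>L\<close> is
  the mean of the values found in opposite directions.
\<close>
definition has_index :: "diagram \<Rightarrow> complex \<Rightarrow> complex \<Rightarrow> bool" where
  "has_index D p L \<longleftrightarrow>
     (\<forall>d z. (\<forall>t\<in>branches D p. det2 (tangent D t) d \<noteq> 0) \<longrightarrow> directional z p d \<longrightarrow>
        (\<forall>\<^sub>F e in at_right 0. z e \<notin> range (curve D)) \<and>
        ((\<lambda>e. winding_number (curve D) (z e)) \<longlongrightarrow>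
           L + of_real (\<Sum>t\<in>branches D p. sgn (det2 (tangent D t) d)) / 2) (at_right 0))"

definition mean_index :: "diagram \<Rightarrow> complex \<Rightarrow> complex" where
  "mean_index D p = (THE L. has_index D p L)"

text \<open>
  A crossing has a single partner, so this is \<open>1\<close> if the curve passes from the right of the
  other branch to its left at \<open>s\<close>, \<open>-1\<close> if it passes from left to right, and \<open>0\<close> at a simple point.
\<close>
definition jump :: "diagram \<Rightarrow> real \<Rightarrow> real" where
  "jump D s = (\<Sum>t | (s, t) \<in> double_points D. sgn (det2 (tangent D t) (tangent D s)))"

lemma has_index_unique:
  assumes "has_index D p L" "has_index D p L'" "\<forall>t\<in>branches D p. det2 (tangent D t) d \<noteq> 0"
  shows "L = L'"
proof -
  let ?z = "\<lambda>e. p + of_real e * d"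
  have "L + of_real (\<Sum>t\<in>branches D p. sgn (det2 (tangent D t) d)) / 2 =
        L' + of_real (\<Sum>t\<in>branches D p. sgn (det2 (tangent D t) d)) / 2"
    by (rule tendsto_unique[of "at_right (0::real)" "\<lambda>e. winding_number (curve D) (?z e)"])
      (use assms directional_line[of p d] in \<open>auto simp: has_index_def\<close>)
  then show ?thesis by simp
qed

lemma periodic_int:
  assumes "\<And>t. f (t + 1) = (f t :: 'a)"
  shows "f (t + of_int n) = f t"
proof (induction n rule: int_induct[where k = 0])
  case (step1 i)
  then show ?case using assms[of "t + of_int i"] by (simp add: add.assoc)
next
  case (step2 i)
  then show ?case using assms[of "t + of_int i - 1"] by (simp add: algebra_simps)
qed simp

lemma periodic_frac:
  assumes "\<And>t. f (t + 1) = (f t :: 'a)"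
  shows "f (frac t) = f t"
  using periodic_int[of f "frac t" "\<lfloor>t\<rfloor>"] assms by (simp add: frac_def)
locale knot =
  fixes D :: diagram
  assumes knot: "knot_diagram D"
begin

abbreviation "\<gamma> \<equiv> curve D"

lemma C1: "\<gamma> C1_differentiable_on UNIV"
  and per: "\<gamma> (t + 1) = \<gamma> t"
  and over_per: "over D (t + 1) = over D t"
  and tangent_nz: "tangent D t \<noteq> 0"
  and finite_double_points: "finite (double_points D)"
  and partner_unique: "(r, s) \<in> double_points D \<Longrightarrow> (r, t) \<in> double_points D \<Longrightarrow> s = t"
  and transverse: "(s, t) \<in> double_points D \<Longrightarrow> det2 (tangent D s) (tangent D t) \<noteq> 0"
  and over_under: "(s, t) \<in> double_points D \<Longrightarrow> over D s \<longleftrightarrow> \<not> over D t"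
  using knot unfolding knot_diagram_def by blast+

lemma double_points_sym: "(s, t) \<in> double_points D \<Longrightarrow> (t, s) \<in> double_points D"
  by (auto simp: double_points_def)

lemma tangent_eq: "tangent D t = velocity \<gamma> t"
  by (simp add: tangent_def)

lemma tangent_per: "tangent D (t + 1) = tangent D t"
  unfolding tangent_eq by (rule velocity_shift[OF C1 per])

lemmas curve_frac = periodic_frac[of \<gamma>, OF per]
lemmas tangent_frac = periodic_frac[of "tangent D", OF tangent_per]

lemma image_window: "\<gamma> ` {c..c + 1} = range \<gamma>"
proof -
  have "\<gamma> t \<in> \<gamma> ` {c..c + 1}" for t
  proof -
    have "\<gamma> (c + frac (t - c)) = \<gamma> t"
      using periodic_int[of \<gamma> t "- \<lfloor>t - c\<rfloor>", OF per] by (simp add: frac_def algebra_simps)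
    moreover have "c + frac (t - c) \<in> {c..c + 1}" by (simp add: frac_lt_1 less_imp_le)
    ultimately show ?thesis by (metis imageI)
  qed
  then show ?thesis by auto
qed

lemma path_image_eq: "path_image \<gamma> = range \<gamma>"
  using image_window[of 0] by (simp add: path_image_def)

lemma turn_window:
  assumes z: "z \<notin> range \<gamma>"
  shows "turn \<gamma> c (c + 1) z = winding_number \<gamma> z"
proof -
  have shift: "turn \<gamma> (a + of_int n) (b + of_int n) z = turn \<gamma> a b z" for a b n
    using periodic_int[of "\<lambda>t. turn \<gamma> (a + t) (b + t) z" 0 n] turn_shift[OF C1 per]
    by (simp add: add.assoc[symmetric])
  have z': "z \<notin> \<gamma> ` A" for A using z by auto
  have fr: "0 \<le> frac c" "frac c < 1" by (simp_all add: frac_lt_1)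
  have "turn \<gamma> c (c + 1) z = turn \<gamma> (frac c) (frac c + 1) z"
    using shift[of "frac c" "\<lfloor>c\<rfloor>" "frac c + 1"] by (simp add: frac_def)
  also have "\<dots> = turn \<gamma> (frac c) 1 z + turn \<gamma> 1 (frac c + 1) z"
    using fr by (intro turn_combine C1 z') auto
  also have "turn \<gamma> 1 (frac c + 1) z = turn \<gamma> 0 (frac c) z"
    using turn_shift[OF C1 per, of 0 "frac c" z] by simp
  also have "turn \<gamma> (frac c) 1 z + turn \<gamma> 0 (frac c) z = turn \<gamma> 0 1 z"
    using turn_combine[OF C1 z', where a = 0 and b = 1 and c = "frac c"] fr by simp
  also have "\<dots> = winding_number \<gamma> z"
    using winding_number_eq_turn[OF C1] z path_image_eq by simp
  finally show ?thesis .
qed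

lemma winding_number_int: "z \<notin> range \<gamma> \<Longrightarrow> winding_number \<gamma> z \<in> \<int>"
  using integer_winding_number[of \<gamma> z] per[of 0] path_image_eq valid_path_imp_path[OF valid_path_C1[OF C1]]
  by (simp add: pathstart_def pathfinish_def)

lemma frac_in_branches: "\<gamma> u = p \<Longrightarrow> frac u \<in> branches D p"
  by (simp add: branches_def curve_frac frac_lt_1)

lemma branches_cases:
  assumes "0 \<le> s" "s < 1"
  obtains (simple) "branches D (\<gamma> s) = {s}" "\<And>t. (s, t) \<notin> double_points D"
  | (double) t where "(s, t) \<in> double_points D" "branches D (\<gamma> s) = {s, t}" "s \<noteq> t" "0 \<le> t" "t < 1" "\<gamma> t = \<gamma> s"
proof (cases "\<exists>t. (s, t) \<in> double_points D")
  case True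
  then obtain t where t: "(s, t) \<in> double_points D" by blast
  have "u = s \<or> u = t" if "u \<in> branches D (\<gamma> s)" for u
    using that t partner_unique[OF t, of u] assms by (auto simp: branches_def double_points_def)
  moreover have "s \<noteq> t" "0 \<le> t" "t < 1" "\<gamma> t = \<gamma> s" using t by (auto simp: double_points_def)
  ultimately show ?thesis using that(2)[OF t] assms by (auto simp: branches_def)
next
  case False
  then show ?thesis using that(1) assms by (fastforce simp: branches_def double_points_def)
qed

lemma transversal_exists:
  assumes "0 \<le> s" "s < 1"
  shows "\<exists>d. \<forall>t\<in>branches D (\<gamma> s). det2 (tangent D t) d \<noteq> 0"
  using assms
proof (cases rule: branches_cases)
  case simple
  have "det2 (tangent D s) (\<i> * tangent D s) = (cmod (tangent D s))\<^sup>2"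
    unfolding cmod_power2 by (simp add: det2_def power2_eq_square)
  then show ?thesis using simple tangent_nz[of s] by (intro exI[of _ "\<i> * tangent D s"]) simp
next
  case (double t)
  have "det2 (tangent D s) (tangent D s + tangent D t) = det2 (tangent D s) (tangent D t)"
    "det2 (tangent D t) (tangent D s + tangent D t) = - det2 (tangent D s) (tangent D t)"
    by (simp_all add: det2_def algebra_simps)
  then show ?thesis using double transverse[OF double(1)] by (intro exI[of _ "tangent D s + tangent D t"]) auto
qed

text \<open>
  At a crossing, one period of the curve is cut into two arcs that each run through it once.
\<close>
lemma has_indexI_two_arcs:
  assumes s: "0 \<le> s" "s < 1" and dp: "(s, t) \<in> double_points D"
    and u: "a < u" "u < b" "\<gamma> u = \<gamma> s" "tangent D u = tangent D s" "arc_index \<gamma> a b u L1"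
    and v: "b < v" "v < a + 1" "\<gamma> v = \<gamma> s" "tangent D v = tangent D t" "arc_index \<gamma> b (a + 1) v L2"
  shows "has_index D (\<gamma> s) (L1 + L2)"
  unfolding has_index_def
proof (intro allI impI)
  fix d z assume tr: "\<forall>t\<in>branches D (\<gamma> s). det2 (tangent D t) d \<noteq> 0" and z: "directional z (\<gamma> s) d"
  have br: "branches D (\<gamma> s) = {s, t}" "s \<noteq> t"
    using branches_cases[OF s] dp partner_unique by metis+
  have ev: "\<forall>\<^sub>F e in at_right 0. z e \<notin> \<gamma> ` {a..b}" "\<forall>\<^sub>F e in at_right 0. z e \<notin> \<gamma> ` {b..a + 1}"
    and l1: "((\<lambda>e. turn \<gamma> a b (z e)) \<longlongrightarrow> L1 + of_real (sgn (det2 (tangent D s) d)) / 2) (at_right 0)"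
    and l2: "((\<lambda>e. turn \<gamma> b (a + 1) (z e)) \<longlongrightarrow> L2 + of_real (sgn (det2 (tangent D t) d)) / 2) (at_right 0)"
    using u(5)[unfolded arc_index_def, rule_format, of d z] v(5)[unfolded arc_index_def, rule_format, of d z]
      tr br z u v by (simp_all add: tangent_eq)
  have "{a..a + 1} = {a..b} \<union> {b..a + 1}" using u v by auto
  then have "range \<gamma> = \<gamma> ` {a..b} \<union> \<gamma> ` {b..a + 1}"
    using image_window[of a] by (simp add: image_Un)
  with ev have off: "\<forall>\<^sub>F e in at_right 0. z e \<notin> range \<gamma>"
    by (auto elim: eventually_elim2)
  then have "\<forall>\<^sub>F e in at_right 0. turn \<gamma> a b (z e) + turn \<gamma> b (a + 1) (z e) = winding_number \<gamma> (z e)"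
  proof eventually_elim
    case (elim e)
    then have "z e \<notin> \<gamma> ` {a..a + 1}" by (simp add: image_window)
    then show ?case using turn_combine[OF C1, of "z e" a "a + 1" b] turn_window[OF elim, of a] u v by simp
  qed
  with tendsto_add[OF l1 l2]
  have "((\<lambda>e. winding_number \<gamma> (z e)) \<longlongrightarrow> L1 + of_real (sgn (det2 (tangent D s) d)) / 2 +
      (L2 + of_real (sgn (det2 (tangent D t) d)) / 2)) (at_right 0)"
    by (rule Lim_transform_eventually)
  with off br show "(\<forall>\<^sub>F e in at_right 0. z e \<notin> range \<gamma>) \<and>
        ((\<lambda>e. winding_number \<gamma> (z e)) \<longlongrightarrow>
           L1 + L2 + of_real (\<Sum>t\<in>branches D (\<gamma> s). sgn (det2 (tangent D t) d)) / 2) (at_right 0)"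
    by (simp add: add_divide_distrib algebra_simps)
qed

text \<open>
  At a simple point, the part of the curve away from the point contributes its turning, which is
  continuous there.
\<close>
lemma has_indexI_one_arc:
  assumes s: "0 \<le> s" "s < 1" and simple: "branches D (\<gamma> s) = {s}"
    and u: "a < u" "u < b" "b \<le> a + 1" "\<gamma> u = \<gamma> s" "tangent D u = tangent D s" "arc_index \<gamma> a b u L"
    and far: "\<gamma> s \<notin> \<gamma> ` {b..a + 1}"
  shows "has_index D (\<gamma> s) (L + turn \<gamma> b (a + 1) (\<gamma> s))"
  unfolding has_index_def
proof (intro allI impI)
  fix d z assume tr: "\<forall>t\<in>branches D (\<gamma> s). det2 (tangent D t) d \<noteq> 0" and z: "directional z (\<gamma> s) d"
  note zl = directional_tendsto[OF z]
  have ev: "\<forall>\<^sub>F e in at_right 0. z e \<notin> \<gamma> ` {a..b}" "\<forall>\<^sub>F e in at_right 0. z e \<notin> \<gamma> ` {b..a + 1}"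
    and l1: "((\<lambda>e. turn \<gamma> a b (z e)) \<longlongrightarrow> L + of_real (sgn (det2 (tangent D s) d)) / 2) (at_right 0)"
    using u(6)[unfolded arc_index_def, rule_format, of d z] eventually_off_arc[OF C1 far zl]
      tr simple z u by (simp_all add: tangent_eq)
  have l2: "((\<lambda>e. turn \<gamma> b (a + 1) (z e)) \<longlongrightarrow> turn \<gamma> b (a + 1) (\<gamma> s)) (at_right 0)"
    by (rule turn_tendsto[OF C1 far zl])
  have "{a..a + 1} = {a..b} \<union> {b..a + 1}" using u by auto
  then have "range \<gamma> = \<gamma> ` {a..b} \<union> \<gamma> ` {b..a + 1}"
    using image_window[of a] by (simp add: image_Un)
  with ev have off: "\<forall>\<^sub>F e in at_right 0. z e \<notin> range \<gamma>"
    by (auto elim: eventually_elim2)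
  then have "\<forall>\<^sub>F e in at_right 0. turn \<gamma> a b (z e) + turn \<gamma> b (a + 1) (z e) = winding_number \<gamma> (z e)"
  proof eventually_elim
    case (elim e)
    then have "z e \<notin> \<gamma> ` {a..a + 1}" by (simp add: image_window)
    then show ?case using turn_combine[OF C1, of "z e" a "a + 1" b] turn_window[OF elim, of a] u by simp
  qed
  with tendsto_add[OF l1 l2]
  have "((\<lambda>e. winding_number \<gamma> (z e)) \<longlongrightarrow> L + of_real (sgn (det2 (tangent D s) d)) / 2 +
      turn \<gamma> b (a + 1) (\<gamma> s)) (at_right 0)"
    by (rule Lim_transform_eventually)
  with off simple show "(\<forall>\<^sub>F e in at_right 0. z e \<notin> range \<gamma>) \<and>
        ((\<lambda>e. winding_number \<gamma> (z e)) \<longlongrightarrow>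
           L + turn \<gamma> b (a + 1) (\<gamma> s) + of_real (\<Sum>t\<in>branches D (\<gamma> s). sgn (det2 (tangent D t) d)) / 2) (at_right 0)"
    by (simp add: algebra_simps)
qed

text \<open>
  The partner \<open>t\<close> of \<open>s\<close> may lie before or after \<open>s\<close>; the shifted parameter \<open>v\<close> lies in the period that
  starts at \<open>s\<close>.
\<close>
lemma far_arc_once:
  assumes s: "0 \<le> s" "s < 1" and dp: "(s, t) \<in> double_points D" and \<delta>: "0 < \<delta>" "2 * \<delta> < 1"
    and own: "\<And>u. u \<in> {s - \<delta>..s + \<delta>} \<Longrightarrow> \<gamma> u = \<gamma> s \<Longrightarrow> u = s"
  obtains v where "s + \<delta> < v" "v < s - \<delta> + 1" "\<gamma> v = \<gamma> s" "tangent D v = tangent D t"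
    "\<And>u. u \<in> {s + \<delta>..s - \<delta> + 1} \<Longrightarrow> \<gamma> u = \<gamma> s \<Longrightarrow> u = v"
proof -
  have br: "branches D (\<gamma> s) = {s, t}" "s \<noteq> t" "0 \<le> t" "t < 1" "\<gamma> t = \<gamma> s"
    using branches_cases[OF s] dp partner_unique by metis+
  define v where "v = (if t > s then t else t + 1)"
  have v: "s < v" "v < s + 1" "\<gamma> v = \<gamma> s" "tangent D v = tangent D t"
    using br s per[of t] tangent_per[of t] by (auto simp: v_def)
  have "v > s + \<delta>" using own[of v] v \<delta> by (cases "v \<le> s + \<delta>") auto
  moreover have "v < s - \<delta> + 1"
  proof (rule ccontr)
    assume "\<not> v < s - \<delta> + 1"
    then show False using own[of "v - 1"] v \<delta> per[of "v - 1"] by auto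
  qed
  moreover have "u = v" if u: "u \<in> {s + \<delta>..s - \<delta> + 1}" "\<gamma> u = \<gamma> s" for u
  proof -
    have "frac u \<in> {s, t}" using frac_in_branches[OF u(2)] br by simp
    moreover have "frac u \<noteq> s"
    proof
      assume "frac u = s"
      then have "u = s + of_int \<lfloor>u\<rfloor>" by (simp add: frac_def)
      moreover have "s + \<delta> \<le> u" "u \<le> s - \<delta> + 1" using u by auto
      ultimately have "0 < real_of_int \<lfloor>u\<rfloor>" "real_of_int \<lfloor>u\<rfloor> < 1" using \<delta> by linarith+
      then show False by (rule no_int_between_0_1)
    qed
    ultimately have "u = t + of_int \<lfloor>u\<rfloor>" by (auto simp: frac_def)
    moreover have "\<exists>k::int. v = t + of_int k"
      by (cases "t > s") (auto simp: v_def intro: exI[of _ "0::int"] exI[of _ "1::int"])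
    ultimately obtain n :: int where n: "u = v + of_int n"
      by (metis add_diff_cancel_left' add_diff_eq diff_add_eq of_int_diff)
    then have "-1 < real_of_int n" "real_of_int n < 1" using u v \<delta> by auto
    then have "n = 0" by linarith
    then show ?thesis using n by simp
  qed
  ultimately show ?thesis using that v by blast
qed

lemma own_arc:
  obtains \<delta> where "0 < \<delta>" "2 * \<delta> < 1" "velocity_cone \<gamma> (tangent D s) 1 (s - \<delta>) (s + \<delta>)"
proof -
  obtain \<delta> where "\<delta> > 0" and c: "\<And>\<delta>'. \<delta>' \<le> \<delta> \<Longrightarrow> velocity_cone \<gamma> (tangent D s) 1 (s - \<delta>') (s + \<delta>')"
    using cone_exists[OF C1, of s 1] tangent_nz[of s] unfolding tangent_eq by auto
  then show ?thesis using that[of "min \<delta> (1/4)"] by auto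
qed

lemma cone_inj:
  assumes "velocity_cone \<gamma> T 1 a b" "u \<in> {a..b}" "v \<in> {a..b}" "\<gamma> u = \<gamma> v"
  shows "u = v"
  using cone_chord[OF C1 assms(1), of u v] cone_chord[OF C1 assms(1), of v u] assms(2-)
  by (cases u v rule: linorder_cases) auto

lemma far_off:
  assumes \<tau>: "branches D (\<gamma> \<tau>) = {\<tau>}" and w: "s - \<delta> < \<tau>" "\<tau> < s + \<delta>"
  shows "\<gamma> \<tau> \<notin> \<gamma> ` {s + \<delta>..s - \<delta> + 1}"
proof
  assume "\<gamma> \<tau> \<in> \<gamma> ` {s + \<delta>..s - \<delta> + 1}"
  then obtain u where u: "u \<in> {s + \<delta>..s - \<delta> + 1}" "\<gamma> u = \<gamma> \<tau>" by auto
  then have "frac u = \<tau>" using frac_in_branches[OF u(2)] \<tau> by simp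
  then have "u = \<tau> + of_int \<lfloor>u\<rfloor>" by (simp add: frac_def)
  moreover have "s + \<delta> \<le> u" "u \<le> s - \<delta> + 1" using u by auto
  ultimately have "0 < real_of_int \<lfloor>u\<rfloor>" "real_of_int \<lfloor>u\<rfloor> < 1" using w by linarith+
  then show False by (rule no_int_between_0_1)
qed

lemma index_simple:
  assumes \<delta>: "0 < \<delta>" "2 * \<delta> < 1" and c: "velocity_cone \<gamma> T 1 (s - \<delta>) (s + \<delta>)" and T: "T \<noteq> 0"
    and \<tau>: "0 \<le> \<tau>" "\<tau> < 1" "branches D (\<gamma> \<tau>) = {\<tau>}" and w: "s - \<delta> < \<tau>" "\<tau> < s + \<delta>"
  shows "has_index D (\<gamma> \<tau>) (pv_turn \<gamma> T (s - \<delta>) (s + \<delta>) \<tau> + turn \<gamma> (s + \<delta>) (s - \<delta> + 1) (\<gamma> \<tau>))"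
proof -
  have "arc_index \<gamma> (s - \<delta>) (s + \<delta>) \<tau> (pv_turn \<gamma> T (s - \<delta>) (s + \<delta>) \<tau>)"
    by (rule arc_index_pv_turn[OF C1 c _ T w]) simp
  from has_indexI_one_arc[OF \<tau> w _ refl refl this far_off[OF \<tau>(3) w]] \<delta>
  show ?thesis by simp
qed

lemma index_double:
  assumes s: "0 \<le> s" "s < 1" "(s, t) \<in> double_points D"
    and \<delta>: "0 < \<delta>" "2 * \<delta> < 1" and c: "velocity_cone \<gamma> T 1 (s - \<delta>) (s + \<delta>)" and T: "T \<noteq> 0"
  obtains v L where "s + \<delta> < v" "v < s - \<delta> + 1" "\<gamma> v = \<gamma> s" "tangent D v = tangent D t"
    "arc_index \<gamma> (s + \<delta>) (s - \<delta> + 1) v L"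
    "has_index D (\<gamma> s) (pv_turn \<gamma> T (s - \<delta>) (s + \<delta>) s + L)"
proof -
  have own: "u = s" if "u \<in> {s - \<delta>..s + \<delta>}" "\<gamma> u = \<gamma> s" for u
    using cone_inj[OF c that(1), of s] that \<delta> by auto
  obtain v where v: "s + \<delta> < v" "v < s - \<delta> + 1" "\<gamma> v = \<gamma> s" "tangent D v = tangent D t"
    "\<And>u. u \<in> {s + \<delta>..s - \<delta> + 1} \<Longrightarrow> \<gamma> u = \<gamma> s \<Longrightarrow> u = v"
    using far_arc_once[OF s \<delta> own] by metis
  obtain L where L: "arc_index \<gamma> (s + \<delta>) (s - \<delta> + 1) v L"
    using arc_index_exists[OF C1 v(1,2)] v tangent_nz[of v] unfolding tangent_eq by auto
  have "arc_index \<gamma> (s - \<delta>) (s + \<delta>) s (pv_turn \<gamma> T (s - \<delta>) (s + \<delta>) s)"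
    using \<delta> by (intro arc_index_pv_turn[OF C1 c _ T]) auto
  then have "has_index D (\<gamma> s) (pv_turn \<gamma> T (s - \<delta>) (s + \<delta>) s + L)"
    using \<delta> v L by (intro has_indexI_two_arcs[OF s, of "s - \<delta>" s "s + \<delta>" _ v]) auto
  with v L that show ?thesis by blast
qed

lemma has_index_mean_index:
  assumes s: "0 \<le> s" "s < 1"
  shows "has_index D (\<gamma> s) (mean_index D (\<gamma> s))"
proof -
  obtain \<delta> where \<delta>: "0 < \<delta>" "2 * \<delta> < 1" "velocity_cone \<gamma> (tangent D s) 1 (s - \<delta>) (s + \<delta>)"
    using own_arc .
  have "\<exists>L. has_index D (\<gamma> s) L"
    using s
  proof (cases rule: branches_cases)
    case simple
    then show ?thesis using index_simple[OF \<delta> tangent_nz s simple(1)] \<delta> by auto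
  next
    case (double t)
    show ?thesis by (rule index_double[OF s double(1) \<delta> tangent_nz]) blast
  qed
  moreover obtain d where "\<forall>t\<in>branches D (\<gamma> s). det2 (tangent D t) d \<noteq> 0"
    using transversal_exists[OF s] by blast
  ultimately have "\<exists>!L. has_index D (\<gamma> s) L" using has_index_unique by blast
  then show ?thesis unfolding mean_index_def by (rule theI')
qed

lemma mean_index_eqI:
  assumes "0 \<le> s" "s < 1" "has_index D (\<gamma> s) L"
  shows "mean_index D (\<gamma> s) = L"
  using has_index_unique has_index_mean_index[OF assms(1,2)] assms(3) transversal_exists[OF assms(1,2)] by blast

text \<open>
  On the left of a simple point the winding number, an integer, exceeds the index by one half.
\<close>
lemma mean_index_simple_half_int:
  assumes s: "0 \<le> s" "s < 1" "branches D (\<gamma> s) = {s}"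
  shows "mean_index D (\<gamma> s) + 1 / 2 \<in> \<int>"
proof -
  let ?d = "\<i> * tangent D s" let ?z = "\<lambda>e. \<gamma> s + of_real e * ?d"
  have d: "det2 (tangent D s) ?d > 0"
    using tangent_nz[of s] by (simp add: det2_def flip: power2_eq_square) 
      (simp add: complex_eq_iff sum_power2_gt_zero_iff)
  then have *: "(\<forall>\<^sub>F e in at_right 0. ?z e \<notin> range \<gamma>) \<and>
      ((\<lambda>e. winding_number \<gamma> (?z e)) \<longlongrightarrow> mean_index D (\<gamma> s) + 1 / 2) (at_right 0)"
    using has_index_mean_index[OF s(1,2), unfolded has_index_def, rule_format, OF _ directional_line[of "\<gamma> s" ?d]] s(3)
    by simp
  then have "\<forall>\<^sub>F e in at_right 0. winding_number \<gamma> (?z e) \<in> \<int>"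
    using winding_number_int by (auto elim: eventually_mono)
  then show ?thesis
    using Lim_in_closed_set[OF closed_Ints _ _ conjunct2[OF *]] by simp
qed

lemma eventually_simple:
  assumes s: "0 < s" "s < 1"
  shows "\<forall>\<^sub>F x in at s. 0 < x \<and> x < 1 \<and> branches D (\<gamma> x) = {x}"
proof -
  have "finite (fst ` double_points D)" using finite_double_points by blast
  then have "open (- (fst ` double_points D - {s}))" by (intro open_Compl finite_imp_closed) auto
  then have "\<forall>\<^sub>F x in at s. x \<in> - (fst ` double_points D - {s})"
    by (intro eventually_at_topological[THEN iffD2] exI[of _ "- (fst ` double_points D - {s})"]) auto
  moreover have "\<forall>\<^sub>F x in at s. x \<in> {0<..<1}"
    using s by (intro eventually_at_in_open') auto
  moreover have "\<forall>\<^sub>F x in at s. x \<noteq> s" by (simp add: eventually_at_filter)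
  ultimately show ?thesis
  proof eventually_elim
    case (elim x)
    then have "x \<notin> fst ` double_points D" by auto
    then have "(x, t) \<notin> double_points D" for t by force
    then show ?case using elim branches_cases[of x] by (metis greaterThanLessThan_iff less_imp_le)
  qed
qed

lemma jump_eq:
  assumes "(s, t) \<in> double_points D"
  shows "jump D s = sgn (det2 (tangent D t) (tangent D s))"
proof -
  have "{t. (s, t) \<in> double_points D} = {t}" using assms partner_unique by auto
  then show ?thesis by (simp add: jump_def)
qed
text \<open>
  For \<open>\<sigma> = 1\<close> this describes the index just after \<open>s\<close>, for \<open>\<sigma> = -1\<close> just before \<open>s\<close>. The contribution
  of the arc through \<open>s\<close> itself varies continuously. The other branch at \<open>s\<close>, if there is one, is approached
  in the direction of the tangent at \<open>s\<close>, or in the opposite one, which changes its contribution by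
  half of the jump. As the indices of simple points belong to a discrete set, they are equal to
  their limit.
\<close>
lemma index_step:
  assumes s: "0 < s" "s < 1" and \<sigma>: "\<sigma> = 1 \<or> \<sigma> = -1"
  shows "\<forall>\<^sub>F e in at_right 0. mean_index D (\<gamma> (s + \<sigma> * e)) = mean_index D (\<gamma> s) + of_real (\<sigma> * jump D s) / 2"
proof -
  let ?T = "tangent D s"
  obtain \<delta> where \<delta>: "0 < \<delta>" "2 * \<delta> < 1" "velocity_cone \<gamma> ?T 1 (s - \<delta>) (s + \<delta>)"
    using own_arc .
  have z: "directional (\<lambda>e. \<gamma> (s + \<sigma> * e)) (\<gamma> s) (of_real \<sigma> * ?T)"
    unfolding tangent_eq by (rule directional_curve[OF C1])
  note zl = directional_tendsto[OF z]
  have "((\<lambda>e. s + \<sigma> * e) \<longlongrightarrow> s + \<sigma> * 0) (at_right 0)" by (intro tendsto_intros)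
  then have sl: "((\<lambda>e. s + \<sigma> * e) \<longlongrightarrow> s) (at_right 0)" by simp
  moreover have "\<forall>\<^sub>F e in at_right 0. s + \<sigma> * e \<noteq> s"
    using eventually_pos_at_right by eventually_elim (use \<sigma> in auto)
  ultimately have fl: "filterlim (\<lambda>e. s + \<sigma> * e) (at s) (at_right 0)"
    by (simp add: filterlim_at)
  have near: "\<forall>\<^sub>F e in at_right 0. 0 < s + \<sigma> * e \<and> s + \<sigma> * e < 1 \<and> branches D (\<gamma> (s + \<sigma> * e)) = {s + \<sigma> * e}"
    using eventually_compose_filterlim[OF eventually_simple[OF s] fl] .
  moreover have "\<forall>\<^sub>F e in at_right 0. s + \<sigma> * e \<in> {s - \<delta><..<s + \<delta>}"
    using topological_tendstoD[OF sl, of "{s - \<delta><..<s + \<delta>}"] \<delta> by auto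
  ultimately have formula: "\<forall>\<^sub>F e in at_right 0. pv_turn \<gamma> ?T (s - \<delta>) (s + \<delta>) (s + \<sigma> * e) +
      turn \<gamma> (s + \<delta>) (s - \<delta> + 1) (\<gamma> (s + \<sigma> * e)) = mean_index D (\<gamma> (s + \<sigma> * e))"
  proof eventually_elim
    case (elim e)
    then show ?case using mean_index_eqI[OF _ _ index_simple[OF \<delta> tangent_nz]] by auto
  qed
  have pv: "((\<lambda>e. pv_turn \<gamma> ?T (s - \<delta>) (s + \<delta>) (s + \<sigma> * e)) \<longlongrightarrow> pv_turn \<gamma> ?T (s - \<delta>) (s + \<delta>) s) (at_right 0)"
    using \<delta> by (intro pv_turn_tendsto[OF C1 \<delta>(3) _ tangent_nz _ _ sl]) auto
  obtain M where M: "((\<lambda>e. turn \<gamma> (s + \<delta>) (s - \<delta> + 1) (\<gamma> (s + \<sigma> * e))) \<longlongrightarrow> M) (at_right 0)"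
    "pv_turn \<gamma> ?T (s - \<delta>) (s + \<delta>) s + M = mean_index D (\<gamma> s) + of_real (\<sigma> * jump D s) / 2"
    using less_imp_le[OF s(1)] s(2)
  proof (cases rule: branches_cases)
    case simple
    then have "jump D s = 0" by (simp add: jump_def)
    then show ?thesis
      using that[of "turn \<gamma> (s + \<delta>) (s - \<delta> + 1) (\<gamma> s)"] turn_tendsto[OF C1 far_off[OF simple(1)] zl]
       mean_index_eqI[OF _ _ index_simple[OF \<delta> tangent_nz _ _ simple(1)]] s \<delta> by auto
  next
    case (double t)
    note j = jump_eq[OF double(1)]
    obtain v L where v: "s + \<delta> < v" "v < s - \<delta> + 1" "\<gamma> v = \<gamma> s" "tangent D v = tangent D t"
      "arc_index \<gamma> (s + \<delta>) (s - \<delta> + 1) v L"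
      and L: "has_index D (\<gamma> s) (pv_turn \<gamma> ?T (s - \<delta>) (s + \<delta>) s + L)"
      using index_double[OF _ s(2) double(1) \<delta> tangent_nz] s by auto
    have dd: "det2 (tangent D t) (of_real \<sigma> * ?T) = \<sigma> * det2 (tangent D t) ?T"
      by (simp add: det2_def algebra_simps)
    have "det2 (tangent D t) ?T \<noteq> 0" using transverse[OF double_points_sym[OF double(1)]] .
    then have "((\<lambda>e. turn \<gamma> (s + \<delta>) (s - \<delta> + 1) (\<gamma> (s + \<sigma> * e))) \<longlongrightarrow>
        L + of_real (sgn (\<sigma> * det2 (tangent D t) ?T)) / 2) (at_right 0)"
      using v(5)[unfolded arc_index_def, rule_format, of "of_real \<sigma> * ?T"] z v(3,4) \<sigma>
      by (auto simp: tangent_eq[symmetric] dd)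
    moreover have "mean_index D (\<gamma> s) = pv_turn \<gamma> ?T (s - \<delta>) (s + \<delta>) s + L"
      using mean_index_eqI[OF _ _ L] s by simp
    moreover have "sgn (\<sigma> * det2 (tangent D t) ?T) = \<sigma> * jump D s"
      using \<sigma> by (auto simp: j sgn_mult)
    ultimately show ?thesis using that by (simp add: add.assoc)
  qed
  let ?l = "mean_index D (\<gamma> s) + of_real (\<sigma> * jump D s) / 2"
  have lim: "((\<lambda>e. mean_index D (\<gamma> (s + \<sigma> * e)) + 1 / 2) \<longlongrightarrow> ?l + 1 / 2) (at_right 0)"
    using Lim_transform_eventually[OF tendsto_add[OF pv M(1)] formula] unfolding M(2)
    by (intro tendsto_intros)
  have int: "\<forall>\<^sub>F e in at_right 0. mean_index D (\<gamma> (s + \<sigma> * e)) + 1 / 2 \<in> \<int>"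
    using near by eventually_elim (use mean_index_simple_half_int in auto)
  have li: "?l + 1 / 2 \<in> \<int>"
    using Lim_in_closed_set[OF closed_Ints int _ lim] by simp
  have "\<forall>\<^sub>F e in at_right 0. dist (mean_index D (\<gamma> (s + \<sigma> * e)) + 1 / 2) (?l + 1 / 2) < 1"
    using lim by (rule tendstoD) simp
  with int show ?thesis
  proof eventually_elim
    case (elim e)
    then have "mean_index D (\<gamma> (s + \<sigma> * e)) + 1 / 2 = ?l + 1 / 2"
      using li Ints_dist_less_1_imp_eq by blast
    then show ?case by simp
  qed
qed

definition curve_index :: "real \<Rightarrow> real" where
  "curve_index s = Re (mean_index D (\<gamma> s))"

lemma jump_eq_0: "s \<notin> fst ` double_points D \<Longrightarrow> jump D s = 0"
  unfolding jump_def by (rule sum.neutral) force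

lemma curve_index_change:
  assumes "0 < c" "c < d" "d < 1"
  shows "curve_index d = curve_index c + jump D c / 2 + jump D d / 2
     + (\<Sum>t\<in>fst ` double_points D \<inter> {c<..<d}. jump D t)"
proof -
  let ?P = "fst ` double_points D"
  have fP: "finite ?P" using finite_double_points by blast
  \<comment> \<open>removing the jumps, half of them at the crossing itself, leaves a locally constant function\<close>
  define G where "G t = curve_index t - (\<Sum>u\<in>?P \<inter> {..<t}. jump D u) - jump D t / 2" for t
  have loc: "\<forall>\<^sub>F e in at_right 0. G (s + \<sigma> * e) = G s" if s: "0 < s" "s < 1" and \<sigma>: "\<sigma> = 1 \<or> \<sigma> = -1" for s \<sigma>
  proof -
    have "open (- (?P - {s}))" using fP by (intro open_Compl finite_imp_closed) auto
    then obtain r where r: "r > 0" "ball s r \<subseteq> - (?P - {s})"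
      by (metis ComplI Diff_iff insertI1 openE)
    have "\<forall>\<^sub>F e in at_right 0. 0 < e \<and> e < r" using r eventually_at_right_less
      by (metis (mono_tags, lifting) eventually_at_right_field)
    with index_step[OF s \<sigma>] show ?thesis
    proof eventually_elim
      case (elim e)
      let ?x = "s + \<sigma> * e"
      have nP: "u \<notin> ?P" if "\<bar>u - s\<bar> \<le> e" "u \<noteq> s" for u
        using r(2) elim that by (force simp: dist_real_def)
      have "\<bar>?x - s\<bar> \<le> e" "?x \<noteq> s" using elim \<sigma> by auto
      then have jx: "jump D ?x = 0" by (intro jump_eq_0 nP)
      have cx: "curve_index ?x = curve_index s + \<sigma> * jump D s / 2"
        using elim(1) by (simp add: curve_index_def)
      show ?case
      proof (cases "\<sigma> = 1")
        case True
        have "?P \<inter> {..<?x} = (?P \<inter> {..<s}) \<union> (?P \<inter> {s})"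
        proof -
          have "u \<le> s" if u: "u \<in> ?P" "u < ?x" for u
          proof (rule ccontr)
            assume "\<not> u \<le> s"
            then have "\<bar>u - s\<bar> \<le> e" "u \<noteq> s" using u True by auto
            with nP u show False by blast
          qed
          moreover have "s < ?x" using elim True by simp
          ultimately show ?thesis by (auto intro: le_neq_trans)
        qed
        moreover have "sum (jump D) ((?P \<inter> {..<s}) \<union> (?P \<inter> {s})) =
            (\<Sum>u\<in>?P \<inter> {..<s}. jump D u) + (\<Sum>u\<in>?P \<inter> {s}. jump D u)"
          using fP by (intro sum.union_disjoint) auto
        ultimately have "(\<Sum>u\<in>?P \<inter> {..<?x}. jump D u) = (\<Sum>u\<in>?P \<inter> {..<s}. jump D u) + (\<Sum>u\<in>?P \<inter> {s}. jump D u)"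
          by simp
        moreover have "(\<Sum>u\<in>?P \<inter> {s}. jump D u) = jump D s"
          using jump_eq_0[of s] by (cases "s \<in> ?P") auto
        ultimately show ?thesis using True cx jx by (simp add: G_def)
      next
        case False
        then have \<sigma>m: "\<sigma> = -1" using \<sigma> by simp
        have "?P \<inter> {..<?x} = ?P \<inter> {..<s}"
        proof -
          have "u < ?x" if "u \<in> ?P" "u < s" for u
          proof (rule ccontr)
            assume "\<not> u < ?x"
            then have "\<bar>u - s\<bar> \<le> e" "u \<noteq> s" using that \<sigma>m by auto
            with nP that show False by blast
          qed
          then show ?thesis using \<sigma>m elim by auto
        qed
        then show ?thesis using \<sigma>m cx jx by (simp add: G_def)
      qed
    qed
  qed
  have dG: "(G has_real_derivative 0) (at s)" if s: "0 < s" "s < 1" for s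
  proof -
    have r: "\<forall>\<^sub>F x in at_right s. G x = G s"
      using loc[OF s, of 1] by (simp add: eventually_at_right_to_0[of _ s] add.commute)
    have l: "\<forall>\<^sub>F x in at_left s. G x = G s"
      using loc[OF s, of "-1"] 
      by (simp add: eventually_at_left_to_right eventually_at_right_to_0[of _ "-s"] algebra_simps)
    have "\<forall>\<^sub>F x in at s. G x = G s" using l r by (simp add: eventually_at_split)
    then have "\<forall>\<^sub>F x in nhds s. G x = G s"
      unfolding eventually_at_filter by (rule eventually_mono) auto
    then show ?thesis
      by (subst DERIV_cong_ev[OF refl _ refl, of _ "\<lambda>_. G s"]) auto
  qed
  have "G d = G c"
    by (rule DERIV_isconst3[of 0 1 d c]) (use assms dG in auto)
  moreover have "?P \<inter> {..<d} = (?P \<inter> {..<c}) \<union> (?P \<inter> {c}) \<union> (?P \<inter> {c<..<d})" using assms by auto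
  then have "(\<Sum>u\<in>?P \<inter> {..<d}. jump D u) = (\<Sum>u\<in>?P \<inter> {..<c}. jump D u) + (\<Sum>u\<in>?P \<inter> {c}. jump D u) + (\<Sum>u\<in>?P \<inter> {c<..<d}. jump D u)"
    using fP by (simp add: sum.union_disjoint Int_Un_distrib2 disjoint_iff)
  moreover have "(\<Sum>u\<in>?P \<inter> {c}. jump D u) = jump D c"
    using jump_eq_0[of c] by (cases "c \<in> ?P") auto
  ultimately show ?thesis by (simp add: G_def)
qed

section \<open>The index of a crossing\<close>

lemma region_index_eq:
  assumes R: "R \<in> regions D" and z: "z \<in> R"
  shows "winding_number \<gamma> z = of_int (region_index D R)" and "z \<notin> range \<gamma>"
proof -
  have sub: "R \<subseteq> - path_image \<gamma>" and con: "connected R"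
    using R by (auto simp: regions_def in_components_subset in_components_connected dest: in_components_subset)
  then have off: "w \<notin> range \<gamma>" if "w \<in> R" for w using that path_image_eq by auto
  then show "z \<notin> range \<gamma>" using z by simp
  have "winding_number \<gamma> constant_on R"
    using winding_number_constant[OF valid_path_imp_path[OF valid_path_C1[OF C1]] _ con] per[of 0] sub
    by (auto simp: pathstart_def pathfinish_def)
  then obtain c where c: "\<And>w. w \<in> R \<Longrightarrow> winding_number \<gamma> w = c" by (auto simp: constant_on_def)
  obtain k where k: "c = of_int k"
    using winding_number_int[OF off[OF z]] c[OF z] by (auto elim: Ints_cases)
  have "region_index D R = k"
    unfolding region_index_def by (rule the_equality) (use c k z in force)+
  then show "winding_number \<gamma> z = of_int (region_index D R)" using c[OF z] k by simp
qed

text \<open>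
  The short segment from the crossing into the sector avoids the curve, hence lies in one region.
\<close>
lemma corner_region_index:
  assumes d: "d = a *\<^sub>R tangent D s + b *\<^sub>R tangent D t"
    and off: "\<forall>\<^sub>F e in at_right 0. \<gamma> s + of_real e * d \<notin> range \<gamma>"
  shows "\<forall>\<^sub>F e in at_right 0. winding_number \<gamma> (\<gamma> s + of_real e * d) =
      of_int (region_index D (corner_region D s t a b))"
proof -
  let ?z = "\<lambda>e::real. \<gamma> s + of_real e * d"
  obtain \<epsilon> where \<epsilon>: "\<epsilon> > 0" "\<And>e. 0 < e \<Longrightarrow> e < \<epsilon> \<Longrightarrow> ?z e \<notin> range \<gamma>"
    using off by (auto simp: eventually_at_right_field)
  define R where "R = connected_component_set (- path_image \<gamma>) (?z (\<epsilon> / 2))"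
  have "connected (?z ` {0<..<\<epsilon>})"
    by (intro connected_continuous_image continuous_intros) simp
  then have sub: "?z ` {0<..<\<epsilon>} \<subseteq> R"
    unfolding R_def
  proof (intro connected_component_maximal)
    show "?z (\<epsilon> / 2) \<in> ?z ` {0<..<\<epsilon>}" using \<epsilon>(1) by (intro imageI) simp
    show "?z ` {0<..<\<epsilon>} \<subseteq> - path_image \<gamma>"
    proof (rule image_subsetI)
      fix e assume "e \<in> {0<..<\<epsilon>}"
      then show "?z e \<in> - path_image \<gamma>" unfolding path_image_eq Compl_iff by (intro \<epsilon>(2)) auto
    qed
  qed
  have R: "R \<in> regions D"
    unfolding R_def regions_def using \<epsilon>(2)[of "\<epsilon> / 2"] \<epsilon>(1) by (intro componentsI) (simp add: path_image_eq)
  have ev: "\<forall>\<^sub>F e in at_right 0. ?z e \<in> R"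
    unfolding eventually_at_right_field using \<epsilon>(1)
    by (intro exI[of _ \<epsilon>] conjI allI impI subsetD[OF sub] imageI) auto
  have "corner_region D s t a b = R"
    unfolding corner_region_def
  proof (rule the_equality)
    show "R \<in> regions D \<and> (\<forall>\<^sub>F e in at_right 0. \<gamma> s + e *\<^sub>R (a *\<^sub>R tangent D s + b *\<^sub>R tangent D t) \<in> R)"
      using R ev by (simp add: d scaleR_conv_of_real)
  next
    fix R' assume R': "R' \<in> regions D \<and> (\<forall>\<^sub>F e in at_right 0. \<gamma> s + e *\<^sub>R (a *\<^sub>R tangent D s + b *\<^sub>R tangent D t) \<in> R')"
    then have "\<forall>\<^sub>F e in at_right 0. ?z e \<in> R'" by (simp add: d scaleR_conv_of_real)
    with ev have "\<forall>\<^sub>F e in at_right (0::real). ?z e \<in> R \<and> ?z e \<in> R'" by (rule eventually_conj)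
    then obtain e where "?z e \<in> R" "?z e \<in> R'"
      using eventually_happens[of _ "at_right (0::real)"] by fastforce
    then show "R' = R" using R R' components_nonoverlap unfolding regions_def by blast
  qed
  with ev show ?thesis
    using region_index_eq(1)[OF R] by (auto elim: eventually_mono)
qed

text \<open>
  The sector \<open>(a, b)\<close> lies on the side \<open>b\<close> of the branch at \<open>s\<close> and on the side \<open>- a\<close> of the branch at \<open>t\<close>,
  up to a common sign; both contributions cancel in the sum over the four sectors.
\<close>
lemma crossing_index_eq:
  assumes dp: "(s, t) \<in> double_points D"
  shows "crossing_index D s t = curve_index s"
proof -
  define \<sigma> where "\<sigma> = sgn (det2 (tangent D s) (tangent D t))"
  have s: "0 \<le> s" "s < 1" using dp by (auto simp: double_points_def)
  have br: "branches D (\<gamma> s) = {s, t}" "s \<noteq> t"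
    using branches_cases[OF s] dp partner_unique by metis+
  have corner: "real_of_int (region_index D (corner_region D s t a b)) = curve_index s + (b - a) * \<sigma> / 2"
    if ab: "a = 1 \<or> a = -1" "b = 1 \<or> b = -1" for a b
  proof -
    define d where "d = a *\<^sub>R tangent D s + b *\<^sub>R tangent D t"
    let ?z = "\<lambda>e::real. \<gamma> s + of_real e * d"
    let ?k = "region_index D (corner_region D s t a b)"
    have dd: "det2 (tangent D s) d = b * det2 (tangent D s) (tangent D t)"
      "det2 (tangent D t) d = - (a * det2 (tangent D s) (tangent D t))"
      by (simp_all add: d_def det2_def algebra_simps)
    have "\<forall>u\<in>branches D (\<gamma> s). det2 (tangent D u) d \<noteq> 0"
      using br transverse[OF dp] ab by (auto simp: dd)
    from has_index_mean_index[OF s, unfolded has_index_def, rule_format, OF bspec[OF this] directional_line]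
    have off: "\<forall>\<^sub>F e in at_right 0. ?z e \<notin> range \<gamma>"
      and lim: "((\<lambda>e. winding_number \<gamma> (?z e)) \<longlongrightarrow> mean_index D (\<gamma> s) +
         of_real (\<Sum>t\<in>branches D (\<gamma> s). sgn (det2 (tangent D t) d)) / 2) (at_right 0)"
      by blast+
    have "((\<lambda>e. winding_number \<gamma> (?z e)) \<longlongrightarrow> of_int ?k) (at_right 0)"
      by (rule tendsto_eventually[OF corner_region_index[OF d_def off]])
    from tendsto_unique[OF _ this lim]
    have "of_int ?k = mean_index D (\<gamma> s) + of_real (\<Sum>t\<in>branches D (\<gamma> s). sgn (det2 (tangent D t) d)) / 2"
      by simp
    also have "(\<Sum>t\<in>branches D (\<gamma> s). sgn (det2 (tangent D t) d)) = (b - a) * \<sigma>"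
      using br ab by (auto simp: dd \<sigma>_def sgn_mult)
    finally have "Re (of_int ?k) = Re (mean_index D (\<gamma> s) + of_real ((b - a) * \<sigma>) / 2)"
      by simp
    then show ?thesis by (simp add: curve_index_def)
  qed
  show ?thesis
    unfolding crossing_index_def using corner[of 1 1] corner[of 1 "-1"] corner[of "-1" 1] corner[of "-1" "-1"]
    by simp
qed

lemma crossings_subset: "crossings D \<subseteq> double_points D"
  by (auto simp: crossings_def)

end

section \<open>Reparametrization\<close>

locale reparametrized = D: knot D + E: knot E for D E +
  fixes r :: "real \<Rightarrow> real"
  assumes rC1: "r C1_differentiable_on UNIV"
    and r_pos: "deriv r t > 0"
    and r_per: "r (t + 1) = r t + 1"
    and curve_E: "curve E = curve D \<circ> r"
    and over_E: "(s, t) \<in> double_points E \<Longrightarrow> over E s = over D (r s)"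
begin

lemma r_deriv: "(r has_real_derivative deriv r t) (at t within A)"
proof -
  have "r differentiable at t" using rC1 by (simp add: C1_differentiable_on_eq)
  then have "r field_differentiable at t"
    using real_differentiable_def field_differentiable_def by blast
  then show ?thesis
    using DERIV_deriv_iff_field_differentiable has_field_derivative_at_within by blast
qed

lemma r_strict_mono: "s < t \<Longrightarrow> r s < r t"
  using DERIV_pos_imp_increasing r_deriv[of _ UNIV] r_pos by (metis)

lemma r_inj: "r s = r t \<longleftrightarrow> s = t"
  using r_strict_mono by (metis less_irrefl linorder_neqE_linordered_idom)

lemma r_int: "r (t + of_int n) = r t + of_int n"
  using periodic_int[of "\<lambda>t. r t - t" t n] r_per by (simp add: algebra_simps)

lemma r_cont: "continuous_on A r"
  using r_deriv DERIV_continuous_on by blast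

lemma r_surj: "\<exists>x. r x = u"
proof -
  define m where "m = \<lfloor>u - r 0\<rfloor>"
  have "r (of_int m) \<le> u" "u \<le> r (of_int m + 1)"
    using r_int[of 0 m] r_per[of "of_int m"] by (simp_all add: m_def) linarith+
  then show ?thesis using IVT'[of r "of_int m" u "of_int m + 1"] r_cont by auto
qed

text \<open>
  The induced bijection between the parameters in the fundamental interval.
\<close>
definition "h t = frac (r t)"

lemma h_bij: "bij_betw h {0..<1} {0..<1}"
  unfolding bij_betw_def
proof
  show "inj_on h {0..<1}"
  proof (rule inj_onI)
    fix s t assume st: "s \<in> {0..<1::real}" "t \<in> {0..<1}" "h s = h t"
    then have "r s = r (t + of_int (\<lfloor>r s\<rfloor> - \<lfloor>r t\<rfloor>))"
      unfolding r_int by (simp add: h_def frac_def)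
    then have *: "s = t + of_int (\<lfloor>r s\<rfloor> - \<lfloor>r t\<rfloor>)" using r_inj by blast
    then have "\<lfloor>s\<rfloor> = \<lfloor>t\<rfloor> + (\<lfloor>r s\<rfloor> - \<lfloor>r t\<rfloor>)" by (metis floor_add_int)
    moreover have "\<lfloor>s\<rfloor> = 0" "\<lfloor>t\<rfloor> = 0" using st by (simp_all add: floor_eq_iff)
    ultimately show "s = t" using * by simp
  qed
  have "u \<in> h ` {0..<1}" if u: "u \<in> {0..<1}" for u
  proof -
    obtain x where x: "r x = u" using r_surj by blast
    have "r (frac x) = u - of_int \<lfloor>x\<rfloor>"
      using r_int[of "frac x" "\<lfloor>x\<rfloor>"] x by (simp add: frac_def)
    then have "h (frac x) = u" using u by (simp add: h_def frac_def) (simp add: floor_eq_iff)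
    then show ?thesis by (metis atLeastLessThan_iff frac_ge_0 frac_lt_1 imageI)
  qed
  moreover have "h t \<in> {0..<1}" for t by (simp add: h_def frac_lt_1)
  ultimately show "h ` {0..<1} = {0..<1}" by auto
qed

lemma h_curve: "curve D (h t) = curve E t"
  by (simp add: h_def D.curve_frac curve_E)

lemma h_tangent: "tangent E t = deriv r t *\<^sub>R tangent D (h t)"
proof -
  have "(curve D \<circ> r has_vector_derivative deriv r t *\<^sub>R velocity (curve D) (r t)) (at t)"
    using r_deriv[of t UNIV] C1_has_velocity[OF D.C1]
    by (intro vector_diff_chain_at) (auto simp: has_real_derivative_iff_has_vector_derivative)
  then have "tangent E t = deriv r t *\<^sub>R tangent D (r t)"
    by (simp add: tangent_def curve_E vector_derivative_at)
  then show ?thesis by (simp add: h_def D.tangent_frac)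
qed

lemma h_det2: "det2 (tangent E s) d = deriv r s * det2 (tangent D (h s)) d"
  by (simp add: h_tangent det2_def algebra_simps)

lemma h_sgn: "sgn (det2 (tangent E s) d) = sgn (det2 (tangent D (h s)) d)"
  using r_pos[of s] by (simp add: h_det2 sgn_mult)

lemma h_sgn2: "sgn (det2 (tangent E s) (tangent E t)) = sgn (det2 (tangent D (h s)) (tangent D (h t)))"
  unfolding h_sgn using h_sgn[of t] by (metis det2_commute sgn_minus)

lemma h_double_points:
  assumes "s \<in> {0..<1}" "t \<in> {0..<1}"
  shows "(s, t) \<in> double_points E \<longleftrightarrow> (h s, h t) \<in> double_points D"
  using assms h_bij by (auto simp: double_points_def h_curve bij_betw_def inj_on_eq_iff)

lemma range_eq: "range (curve E) = range (curve D)"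
  using r_surj by (auto simp: curve_E image_iff) metis

lemma winding_number_eq:
  assumes z: "z \<notin> range (curve D)"
  shows "winding_number (curve E) z = winding_number (curve D) z"
proof -
  have z': "z \<notin> curve D ` {r 0..r 0 + 1}" using z by auto
  have r1: "r 1 = r 0 + 1" using r_per[of 0] by simp
  have m: "r x \<in> {r 0..r 0 + 1}" if "x \<in> {0..1}" for x
    using that r_strict_mono[of 0 x] r_strict_mono[of x 1] r1 by (cases "x = 0"; cases "x = 1") auto
  have vE: "velocity (curve E) t = of_real (deriv r t) * velocity (curve D) (r t)" for t
    using h_tangent[of t] by (simp add: h_def D.tangent_frac) (simp add: tangent_def scaleR_conv_of_real)
  have "((\<lambda>x. deriv r x *\<^sub>R (velocity (curve D) (r x) / (curve D (r x) - z))) has_integral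
      integral {r 0..r 1} (\<lambda>t. velocity (curve D) t / (curve D t - z))) {0..1}"
    using m r_deriv by (intro has_integral_substitution[OF _ _ _ turn_integrand_continuous[OF D.C1 z']])
      (auto simp: r1)
  then have "turn (curve E) 0 1 z = turn (curve D) (r 0) (r 0 + 1) z"
    unfolding turn_def vE by (simp add: curve_E r1 integral_unique scaleR_conv_of_real)
  then show ?thesis
    using winding_number_eq_turn[OF E.C1] E.path_image_eq range_eq z D.turn_window[OF z] by simp
qed

lemma h_branches: "bij_betw h (branches E p) (branches D p)"
  unfolding branches_def by (rule bij_betw_Collect[OF h_bij]) (simp add: h_curve)

lemma has_index_transfer:
  assumes "has_index D p L"
  shows "has_index E p L"
  unfolding has_index_def
proof (intro allI impI)
  fix d z assume tr: "\<forall>t\<in>branches E p. det2 (tangent E t) d \<noteq> 0" and z: "directional z p d"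
  have "det2 (tangent D t) d \<noteq> 0" if "t \<in> branches D p" for t
  proof -
    have "t \<in> h ` branches E p" using bij_betw_imp_surj_on[OF h_branches[of p]] that by simp
    then obtain u where u: "u \<in> branches E p" "t = h u" by blast
    from bspec[OF tr u(1)] show ?thesis unfolding u(2) h_det2[of u d] by simp
  qed
  with assms z have *: "\<forall>\<^sub>F e in at_right 0. z e \<notin> range (curve D)"
    "((\<lambda>e. winding_number (curve D) (z e)) \<longlongrightarrow>
           L + of_real (\<Sum>t\<in>branches D p. sgn (det2 (tangent D t) d)) / 2) (at_right 0)"
    unfolding has_index_def by blast+
  have "(\<Sum>t\<in>branches D p. sgn (det2 (tangent D t) d)) = (\<Sum>t\<in>branches E p. sgn (det2 (tangent E t) d))"
    by (subst sum.reindex_bij_betw[OF h_branches, symmetric]) (simp add: h_sgn)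
  moreover have "\<forall>\<^sub>F e in at_right 0. winding_number (curve D) (z e) = winding_number (curve E) (z e)"
    using *(1) by eventually_elim (simp add: winding_number_eq)
  ultimately show "(\<forall>\<^sub>F e in at_right 0. z e \<notin> range (curve E)) \<and>
    ((\<lambda>e. winding_number (curve E) (z e)) \<longlongrightarrow>
           L + of_real (\<Sum>t\<in>branches E p. sgn (det2 (tangent E t) d)) / 2) (at_right 0)"
    using * Lim_transform_eventually[OF *(2)] by (simp add: range_eq)
qed

lemma h_curve_index:
  assumes "s \<in> {0..<1}"
  shows "E.curve_index s = D.curve_index (h s)"
proof -
  have "h s \<in> {0..<1}" by (simp add: h_def frac_lt_1)
  then have "has_index E (curve E s) (mean_index D (curve D (h s)))"
    using D.has_index_mean_index[of "h s"] has_index_transfer by (simp add: h_curve)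
  then show ?thesis
    using E.mean_index_eqI[of s] assms by (simp add: E.curve_index_def D.curve_index_def h_curve)
qed

lemma SCI_eq: "SCI E = SCI D"
proof -
  have ov: "over E s = over D (h s)" if "(s, t) \<in> double_points E" for s t
    using over_E[OF that] periodic_frac[of "over D", OF D.over_per] by (simp add: h_def)
  have bij: "bij_betw (map_prod h h) (crossings E) (crossings D)"
  proof -
    have "x \<in> crossings E \<longleftrightarrow> map_prod h h x \<in> crossings D" if "x \<in> {0..<1} \<times> {0..<1}" for x
    proof -
      obtain s t where x: "x = (s, t)" "s \<in> {0..<1}" "t \<in> {0..<1}" using \<open>x \<in> {0..<1} \<times> {0..<1}\<close> by auto
      show ?thesis using h_double_points[OF x(2,3)] ov[of s t] by (auto simp: x(1) crossings_def)
    qed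
    then have "bij_betw (map_prod h h) {x \<in> {0..<1} \<times> {0..<1}. x \<in> crossings E}
        {x \<in> {0..<1} \<times> {0..<1}. x \<in> crossings D}"
      using h_bij by (intro bij_betw_Collect)
        (auto intro: bij_betw_map_prod)
    moreover have "{x \<in> {0..<1} \<times> {0..<1}. x \<in> crossings F} = crossings F" for F
      by (auto simp: crossings_def double_points_def)
    ultimately show ?thesis by simp
  qed
  have "SCI D = (\<Sum>x\<in>crossings E. case map_prod h h x of (s, t) \<Rightarrow> crossing_sign D s t * crossing_index D s t)"
    unfolding SCI_def by (rule sum.reindex_bij_betw[OF bij, symmetric])
  also have "\<dots> = SCI E"
    unfolding SCI_def
  proof (rule sum.cong[OF refl], clarsimp)
    fix s t assume "(s, t) \<in> crossings E"
    then have dp: "(s, t) \<in> double_points E" by (simp add: crossings_def)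
    then have st: "s \<in> {0..<1}" "t \<in> {0..<1}" by (auto simp: double_points_def)
    have dpD: "(h s, h t) \<in> double_points D" using dp h_double_points[OF st] by simp
    have "crossing_index D (h s) (h t) = crossing_index E s t"
      using D.crossing_index_eq[OF dpD] E.crossing_index_eq[OF dp] h_curve_index[OF st(1)] by simp
    moreover have "crossing_sign D (h s) (h t) = crossing_sign E s t"
      using ov[OF dp] by (simp add: crossing_sign_def h_sgn2)
    ultimately show "crossing_sign D (h s) (h t) * crossing_index D (h s) (h t) =
        crossing_sign E s t * crossing_index E s t" by simp
  qed
  finally show ?thesis by simp
qed

end

lemma SCI_reparam:
  assumes "knot_diagram D" "knot_diagram E" "reparam D E"
  shows "SCI E = SCI D"
proof -
  obtain r where "reparametrized D E r"
    using assms unfolding reparam_def reparametrized_def reparametrized_axioms_def knot_def by fastforce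
  then show ?thesis by (rule reparametrized.SCI_eq)
qed

section \<open>Algebraic number of crossings of two arcs\<close>

lemma connected_Ints_constant:
  fixes f :: "real \<Rightarrow> complex"
  assumes "connected A" "continuous_on A f" "\<And>x. x \<in> A \<Longrightarrow> f x \<in> \<int>"
  shows "f constant_on A"
proof (rule continuous_discrete_range_constant[OF assms(1,2)])
  fix x assume "x \<in> A"
  then have "1 \<le> norm (f y - f x)" if "y \<in> A" "f y \<noteq> f x" for y
    using that Ints_dist_less_1_imp_eq[of "f y" "f x"] assms(3) by (force simp: dist_norm)
  then show "\<exists>e>0. \<forall>y. y \<in> A \<and> f y \<noteq> f x \<longrightarrow> e \<le> norm (f y - f x)"
    by (intro exI[of _ 1]) auto
qed

lemma turn_upper_limit_continuous:
  assumes "g C1_differentiable_on UNIV" "w \<notin> g ` {a..b}"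
  shows "continuous_on {a..b} (\<lambda>t. turn g a t w)"
  unfolding turn_def
  by (intro continuous_intros indefinite_integral_continuous_1 turn_integrable assms) auto

lemma exp_eq_imp_diff_Ints:
  assumes "exp (2 * of_real pi * \<i> * x) = exp (2 * of_real pi * \<i> * y)"
  shows "x - y \<in> \<int>"
proof -
  obtain n :: int where "2 * of_real pi * \<i> * x = 2 * of_real pi * \<i> * y + of_real (of_int (2 * n) * pi) * \<i>"
    using assms unfolding exp_eq by blast
  then have "2 * of_real pi * \<i> * (x - y) = 2 * of_real pi * \<i> * of_int n" by (simp add: algebra_simps)
  then have "x - y = of_int n" by simp
  then show ?thesis by simp
qed

text \<open>
  The winding number around \<open>0\<close> of the difference of the two arcs, taken along the boundary of the rectangle
  of their parameters: each side of the rectangle contributes the turning of one arc about an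
  end point of the other one.
\<close>
definition crossing_number :: "(real \<Rightarrow> complex) \<Rightarrow> real \<Rightarrow> real \<Rightarrow> real \<Rightarrow> real \<Rightarrow> complex" where
  "crossing_number g a b c d = (turn g c d (g b) - turn g c d (g a)) - (turn g a b (g d) - turn g a b (g c))"

text \<open>
  While \<open>t\<close> runs along the first arc, the turning of the second arc about \<open>g t\<close> changes in two ways:
  continuously, because the directions from \<open>g t\<close> to the end points of the second arc change, and by a
  jump where the arcs cross. The continuous change is the turning of the initial part of the first
  arc about these end points, up to sign; \<open>\<Phi>\<close> is the difference, which therefore is
  constant up to the jump.
\<close>
lemma crossing_number_single_crossing:
  assumes g: "g C1_differentiable_on UNIV"
    and x: "a < x" "x < b" and y: "c < y" "y < d" and xy: "g x = g y"
    and once: "\<And>s t. s \<in> {a..b} \<Longrightarrow> t \<in> {c..d} \<Longrightarrow> g s = g t \<Longrightarrow> s = x \<and> t = y"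
    and tr: "det2 (velocity g y) (velocity g x) \<noteq> 0"
  shows "crossing_number g a b c d = of_real (sgn (det2 (velocity g y) (velocity g x)))"
proof -
  let ?\<sigma> = "sgn (det2 (velocity g y) (velocity g x))"
  define h where "h t = turn g a t (g d) - turn g a t (g c)" for t
  define \<Phi> where "\<Phi> t = turn g c d (g t) - h t" for t
  have vy: "velocity g y \<noteq> 0" using tr by (auto simp: det2_def)
  have nd: "g d \<notin> g ` {a..b}" "g c \<notin> g ` {a..b}"
    using once[of _ d] once[of _ c] y by (metis atLeastAtMost_iff imageE less_irrefl order_refl less_imp_le less_trans)+
  have nt: "g t \<notin> g ` {c..d}" if "t \<in> {a..b}" "t \<noteq> x" for t
  proof
    assume "g t \<in> g ` {c..d}"
    then obtain u where "u \<in> {c..d}" "g t = g u" by auto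
    then show False using once[OF that(1)] that(2) by blast
  qed
  have h: "continuous_on {a..b} h"
    unfolding h_def by (intro continuous_intros turn_upper_limit_continuous g nd)
  have E: "exp (2 * of_real pi * \<i> * \<Phi> t) = (g a - g d) / (g a - g c)" if t: "t \<in> {a..b}" "t \<noteq> x" for t
  proof -
    have sub: "g ` {a..t} \<subseteq> g ` {a..b}" using t by (intro image_mono) auto
    then have nd': "g d \<notin> g ` {a..t}" "g c \<notin> g ` {a..t}" using nd by auto
    have ne: "g t \<noteq> g d" "g t \<noteq> g c" "g a \<noteq> g d" "g a \<noteq> g c"
      using nd t x by (metis atLeastAtMost_iff imageI less_imp_le less_trans order_refl)+
    have 1: "exp (2 * of_real pi * \<i> * turn g c d (g t)) * (g c - g t) = g d - g t"
      using exp_turn[OF g _ nt[OF t]] y by simp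
    have 2: "exp (2 * of_real pi * \<i> * turn g a t (g d)) * (g a - g d) = g t - g d"
      using exp_turn[OF g _ nd'(1)] t by simp
    have 3: "exp (2 * of_real pi * \<i> * turn g a t (g c)) * (g a - g c) = g t - g c"
      using exp_turn[OF g _ nd'(2)] t by simp
    have "exp (2 * of_real pi * \<i> * \<Phi> t) = exp (2 * of_real pi * \<i> * turn g c d (g t)) *
        exp (2 * of_real pi * \<i> * turn g a t (g c)) / exp (2 * of_real pi * \<i> * turn g a t (g d))"
      by (simp add: \<Phi>_def h_def exp_add[symmetric] exp_diff[symmetric] right_diff_distrib distrib_left diff_diff_eq2)
    also have "\<dots> = (g d - g t) / (g c - g t) * ((g t - g c) / (g a - g c)) / ((g t - g d) / (g a - g d))"
      using ne by (simp flip: 1 2 3)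
    also have "\<dots> = (g a - g d) / (g a - g c)"
      using ne by (simp add: divide_simps) (simp add: algebra_simps)
    finally show ?thesis .
  qed
  have const: "\<Phi> u = \<Phi> v" if A: "A \<subseteq> {a..b} - {x}" "connected A" "u \<in> A" "v \<in> A" for A u v
  proof -
    have "continuous_on A \<Phi>"
      unfolding \<Phi>_def
    proof (intro continuous_intros)
      show "continuous_on A h" using h A(1) by (auto intro: continuous_on_subset)
      have "g t \<in> - g ` {c..d}" if "t \<in> A" for t
        unfolding Compl_iff using A(1) that by (intro nt) auto
      then have "g ` A \<subseteq> - g ` {c..d}" by (rule image_subsetI)
      then show "continuous_on A (\<lambda>t. turn g c d (g t))"
        using continuous_on_compose2[OF turn_continuous_on[OF g] C1_continuous[OF g]] by blast
    qed
    then have "continuous_on A (\<lambda>t. \<Phi> t - \<Phi> v)" by (intro continuous_intros)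
    moreover have "\<Phi> t - \<Phi> v \<in> \<int>" if "t \<in> A" for t
    proof (rule exp_eq_imp_diff_Ints)
      have "t \<in> {a..b}" "t \<noteq> x" "v \<in> {a..b}" "v \<noteq> x" using A that by auto
      then show "exp (2 * of_real pi * \<i> * \<Phi> t) = exp (2 * of_real pi * \<i> * \<Phi> v)"
        using E[of t] E[of v] by metis
    qed
    ultimately have "(\<lambda>t. \<Phi> t - \<Phi> v) constant_on A"
      by (intro connected_Ints_constant A(2))
    then obtain k where "\<forall>t\<in>A. \<Phi> t - \<Phi> v = k" by (auto simp: constant_on_def)
    from bspec[OF this A(3)] bspec[OF this A(4)] show ?thesis by simp
  qed
  obtain L where L: "arc_index g c d y L"
    using arc_index_exists[OF g y vy] once[of x] xy x by (metis atLeastAtMost_iff less_imp_le)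
  \<comment> \<open>both one-sided limits of \<open>\<Phi>\<close> at the crossing\<close>
  have lim: "((\<lambda>e. \<Phi> (x + \<sigma> * e)) \<longlongrightarrow> L + of_real (\<sigma> * ?\<sigma>) / 2 - h x) (at_right 0)"
    if \<sigma>: "\<sigma> = 1 \<or> \<sigma> = -1" for \<sigma>
    unfolding \<Phi>_def
  proof (intro tendsto_diff)
    have "directional (\<lambda>e. g (x + \<sigma> * e)) (g y) (of_real \<sigma> * velocity g x)"
      using directional_curve[OF g, of x \<sigma>] xy by simp
    moreover have dd: "det2 (velocity g y) (of_real \<sigma> * velocity g x) = \<sigma> * det2 (velocity g y) (velocity g x)"
      by (simp add: det2_def algebra_simps)
    ultimately show "((\<lambda>e. turn g c d (g (x + \<sigma> * e))) \<longlongrightarrow> L + of_real (\<sigma> * ?\<sigma>) / 2) (at_right 0)"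
      using L[unfolded arc_index_def, rule_format, of "of_real \<sigma> * velocity g x"] tr \<sigma>
      by (auto simp: sgn_mult)
    have "isCont h x"
      using h x by (intro continuous_on_interior) auto
    moreover have "((\<lambda>e. x + \<sigma> * e) \<longlongrightarrow> x + \<sigma> * 0) (at_right 0)" by (intro tendsto_intros)
    ultimately show "((\<lambda>e. h (x + \<sigma> * e)) \<longlongrightarrow> h x) (at_right 0)"
      using isCont_tendsto_compose by fastforce
  qed
  have "\<forall>\<^sub>F e in at_right 0. \<Phi> b = \<Phi> (x + 1 * e)"
    unfolding eventually_at_right_field
  proof (intro exI[of _ "b - x"] conjI allI impI)
    fix e assume "0 < e" "e < b - x"
    then show "\<Phi> b = \<Phi> (x + 1 * e)" using x by (intro const[of "{x<..b}"]) auto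
  qed (use x in simp)
  from Lim_transform_eventually[OF tendsto_const this]
  have b: "\<Phi> b = L + of_real ?\<sigma> / 2 - h x"
    using tendsto_unique[OF _ _ lim[of 1]] by fastforce
  have "\<forall>\<^sub>F e in at_right 0. \<Phi> a = \<Phi> (x + (-1) * e)"
    unfolding eventually_at_right_field
  proof (intro exI[of _ "x - a"] conjI allI impI)
    fix e assume "0 < e" "e < x - a"
    then show "\<Phi> a = \<Phi> (x + (-1) * e)" using x by (intro const[of "{a..<x}"]) auto
  qed (use x in simp)
  from Lim_transform_eventually[OF tendsto_const this]
  have a: "\<Phi> a = L - of_real ?\<sigma> / 2 - h x"
    using tendsto_unique[OF _ _ lim[of "-1"]] by fastforce
  have "crossing_number g a b c d = \<Phi> b - \<Phi> a"
    by (simp add: crossing_number_def \<Phi>_def h_def)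
  then show ?thesis unfolding a b by simp
qed

section \<open>Changing strands inside a disc\<close>

text \<open>
  Unlike \<open>local_change\<close>, these conditions are symmetric in \<open>D\<close> and \<open>E\<close>, and the strands are
  indexed. The last one keeps double points away from the end points of the strands.
\<close>
locale tangle = D: knot D + E: knot E for D E +
  fixes B :: "complex set" and a b :: "'i::finite \<Rightarrow> real"
  assumes disc: "B homeomorphic cball (0 :: complex) 1"
    and ab: "a i < b i"
    and disjoint: "i \<noteq> j \<Longrightarrow> {a i..b i} \<inter> {a j..b j} = {}"
    and unit: "0 < a i" "b i < 1"
    and inside: "t \<in> {a i..b i} \<Longrightarrow> curve D t \<in> B \<and> curve E t \<in> B"
    and outside: "t \<in> {0..1} \<Longrightarrow> t \<notin> (\<Union>i. {a i..b i}) \<Longrightarrow> curve E t = curve D t \<and> curve D t \<notin> B"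
    and over_outside: "(s, t) \<in> double_points D \<Longrightarrow> s \<notin> (\<Union>i. {a i..b i}) \<Longrightarrow> over E s = over D s"
    and ends_simple: "(s, t) \<in> double_points D \<union> double_points E \<Longrightarrow> s \<in> {a i..b i} \<Longrightarrow> s \<in> {a i<..<b i}"
begin

abbreviation "S \<equiv> (\<Union>i. {a i..b i})"

lemma S_subset: "S \<subseteq> {0..1}"
proof
  fix t assume "t \<in> S"
  then obtain i where "t \<in> {a i..b i}" by blast
  then show "t \<in> {0..1}" using unit[of i] by auto
qed

lemma closed_S: "closed S" by (intro closed_UN) auto

lemma closed_B: "closed B"
  using disc homeomorphic_compactness by (metis compact_cball compact_imp_closed)

lemma simply_connected_B: "simply_connected B"
  using disc homeomorphic_simply_connected_eq convex_imp_simply_connected convex_cball by metis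

lemma in_disc_iff:
  assumes "t \<in> {0..1}"
  shows "curve D t \<in> B \<longleftrightarrow> t \<in> S" "curve E t \<in> B \<longleftrightarrow> t \<in> S"
proof -
  have "curve D t \<in> B \<and> curve E t \<in> B" if "t \<in> S" using that inside by blast
  moreover have "curve D t \<notin> B \<and> curve E t \<notin> B" if "t \<notin> S" using outside[OF assms that] by simp
  ultimately show "curve D t \<in> B \<longleftrightarrow> t \<in> S" "curve E t \<in> B \<longleftrightarrow> t \<in> S" by blast+
qed

lemma double_point_in_S:
  assumes "(s, t) \<in> double_points D"
  shows "s \<in> S \<longleftrightarrow> t \<in> S"
proof -
  have st: "s \<in> {0..1}" "t \<in> {0..1}" "curve D s = curve D t" using assms by (auto simp: double_points_def)
  then show ?thesis using in_disc_iff(1)[of s] in_disc_iff(1)[of t] by simp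
qed

lemma double_points_outside:
  assumes "s \<notin> S"
  shows "(s, t) \<in> double_points D \<longleftrightarrow> (s, t) \<in> double_points E"
proof (cases "s \<in> {0..<1} \<and> t \<in> {0..<1}")
  case True
  then have s: "curve E s = curve D s" "curve D s \<notin> B" using outside assms by auto
  show ?thesis
  proof (cases "t \<in> S")
    case True
    then have "curve D t \<in> B" "curve E t \<in> B" using inside by auto
    then show ?thesis using s by (auto simp: double_points_def)
  next
    case False
    then have "curve E t = curve D t" using outside True by auto
    then show ?thesis using s by (auto simp: double_points_def)
  qed
qed (auto simp: double_points_def)

lemma swap: "tangle E D B a b"
proof unfold_locales
  fix s t assume "(s, t) \<in> double_points E" "s \<notin> S"
  then show "over D s = over E s" using over_outside double_points_outside by metis
next
  fix s t i assume "(s, t) \<in> double_points E \<union> double_points D" "s \<in> {a i..b i}"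
  then show "s \<in> {a i<..<b i}" using ends_simple[of s t i] by blast
next
  fix i j :: 'i assume "i \<noteq> j"
  then show "{a i..b i} \<inter> {a j..b j} = {}" by (rule disjoint)
next
  fix t assume t: "t \<in> {0..1}" "t \<notin> S"
  then show "curve D t = curve E t \<and> curve E t \<notin> B" using outside[OF t] by simp
next
  fix t i assume "t \<in> {a i..b i}"
  then show "curve E t \<in> B \<and> curve D t \<in> B" using inside[of t i] by simp
qed (use disc ab unit in simp_all)

text \<open>
  Just before and just after a strand the curve lies outside the disc. This gives access to the end
  points of the strands as limits of points around which winding numbers do not change.
\<close>
lemma just_outside:
  "\<forall>\<^sub>F e in at_right 0. a i - e \<in> {0<..<1} - S" "\<forall>\<^sub>F e in at_right 0. b i + e \<in> {0<..<1} - S"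
proof -
  define T where "T = (\<Union>j\<in>-{i}. {a j..b j})"
  have "closed T" unfolding T_def by (intro closed_UN) auto
  moreover have "a i \<notin> T" "b i \<notin> T" unfolding T_def using disjoint[of i] ab[of i] by force+
  ultimately have o: "open ({0<..<1} - T)" "a i \<in> {0<..<1} - T" "b i \<in> {0<..<1} - T"
    using unit[of i] ab[of i] by auto
  have l: "((\<lambda>e. a i - e) \<longlongrightarrow> a i - 0) (at_right 0)" "((\<lambda>e. b i + e) \<longlongrightarrow> b i + 0) (at_right 0)"
    by (intro tendsto_intros)+
  have S: "S = T \<union> {a i..b i}" unfolding T_def by auto
  have "\<forall>\<^sub>F e in at_right 0. a i - e \<in> {0<..<1} - T" using topological_tendstoD[OF l(1) o(1)] o(2) by simp
  then show "\<forall>\<^sub>F e in at_right 0. a i - e \<in> {0<..<1} - S"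
    using eventually_pos_at_right by eventually_elim (auto simp: S)
  have "\<forall>\<^sub>F e in at_right 0. b i + e \<in> {0<..<1} - T" using topological_tendstoD[OF l(2) o(1)] o(3) by simp
  then show "\<forall>\<^sub>F e in at_right 0. b i + e \<in> {0<..<1} - S"
    using eventually_pos_at_right by eventually_elim (auto simp: S)
qed

lemma end_limits:
  "((\<lambda>e. curve D (a i - e)) \<longlongrightarrow> curve D (a i)) (at_right 0)"
  "((\<lambda>e. curve D (b i + e)) \<longlongrightarrow> curve D (b i)) (at_right 0)"
  using directional_tendsto[OF directional_curve[OF D.C1, of "a i" "-1"]]
    directional_tendsto[OF directional_curve[OF D.C1, of "b i" 1]] by simp_all

lemma ends_eq: "curve E (a i) = curve D (a i)" "curve E (b i) = curve D (b i)"
proof -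
  have "\<forall>\<^sub>F e in at_right 0. curve D (a i - e) = curve E (a i - e)"
    using just_outside(1)[of i] by eventually_elim (use outside in auto)
  from Lim_transform_eventually[OF end_limits(1) this]
  show "curve E (a i) = curve D (a i)"
    using tendsto_unique[OF _ tangle.end_limits(1)[OF swap]] by fastforce
  have "\<forall>\<^sub>F e in at_right 0. curve D (b i + e) = curve E (b i + e)"
    using just_outside(2)[of i] by eventually_elim (use outside in auto)
  from Lim_transform_eventually[OF end_limits(2) this]
  show "curve E (b i) = curve D (b i)"
    using tendsto_unique[OF _ tangle.end_limits(2)[OF swap]] by fastforce
qed

lemma tangent_outside:
  assumes t: "t \<in> {0..1}" "t \<notin> S"
  shows "tangent E t = tangent D t"
proof -
  have *: "tangent E t = tangent D t" if t: "t \<in> {0..<1}" "t \<notin> S" for t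
  proof -
    \<comment> \<open>a neighbourhood of \<open>t\<close> in which the curves agree; for \<open>t = 0\<close> it includes negative
      parameters, where periodicity is used\<close>
    define U where "U = {-1<..<1} - (S \<union> (\<lambda>x. x - 1) ` S)"
    have "closed ((\<lambda>x. x - 1) ` S)"
      using closed_translation[OF closed_S, of "-1"] by (simp add: image_def add.commute)
    then have "open U" unfolding U_def using closed_S by auto
    moreover have "t \<in> U"
    proof -
      have "t \<noteq> x - 1" if x: "x \<in> S" for x
      proof -
        obtain i where "x \<le> b i" using x by auto
        then show ?thesis using t(1) unit(2)[of i] by auto
      qed
      then have "t \<notin> (\<lambda>x. x - 1) ` S" by blast
      moreover have "t \<in> {-1<..<1}" using t(1) by auto
      ultimately show ?thesis unfolding U_def using t(2) by blast
    qed
    moreover have "curve D u = curve E u" if "u \<in> U" for u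
    proof (cases "u \<ge> 0")
      case True
      then show ?thesis using that outside[of u] unfolding U_def by auto
    next
      case False
      have "u + 1 \<notin> S" using that unfolding U_def by (force simp: image_iff)
      then show ?thesis using that outside[of "u + 1"] False D.per[of u] E.per[of u] unfolding U_def by auto
    qed
    ultimately show ?thesis
      using has_vector_derivative_transform_within_open[OF C1_has_velocity[OF D.C1, of t UNIV]]
      unfolding tangent_def by (metis vector_derivative_at)
  qed
  show ?thesis
  proof (cases "t = 1")
    case True
    have "0 \<notin> S"
    proof
      assume "0 \<in> S"
      then obtain i where "0 \<in> {a i..b i}" by blast
      then show False using unit(1)[of i] by simp
    qed
    then show ?thesis using True *[of 0] D.tangent_per[of 0] E.tangent_per[of 0] by auto
  qed (use * t in auto)
qed

text \<open>
  The disc is simply connected.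
\<close>
lemma strand_turn:
  assumes "z \<notin> B"
  shows "turn (curve D) (a i) (b i) z = turn (curve E) (a i) (b i) z"
  using unit[of i] ab[of i] inside[of _ i]
  by (intro turn_simply_connected[OF D.C1 E.C1 simply_connected_B _ _ _ _ _ _ _ assms]) (auto simp: ends_eq)

lemma winding_number_eq:
  assumes z: "z \<notin> B" and off: "z \<notin> range (curve D)"
  shows "z \<notin> range (curve E)" and "winding_number (curve E) z = winding_number (curve D) z"
proof -
  have "z \<notin> curve E ` {0..1}"
  proof
    assume "z \<in> curve E ` {0..1}"
    then obtain t where t: "t \<in> {0..1}" "z = curve E t" by auto
    then show False using z off inside[of t] outside[of t] by (cases "t \<in> S") auto
  qed
  then show offE: "z \<notin> range (curve E)" using E.image_window[of 0] by simp
  let ?f = "\<lambda>K t. velocity (curve K) t / (curve K t - z)"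
  have offA: "z \<notin> curve D ` A" "z \<notin> curve E ` A" for A using off offE by auto
  have int: "?f D integrable_on {u..v}" "?f E integrable_on {u..v}" for u v
    using turn_integrable[OF D.C1 offA(1)] turn_integrable[OF E.C1 offA(2)] by auto
  have "((\<lambda>t. ?f D t - ?f E t) has_integral 0) {a i..b i}" for i
    using has_integral_diff[OF integrable_integral[OF int(1)] integrable_integral[OF int(2)], of "a i" "b i"]
      strand_turn[OF z, of i] by (simp add: turn_def)
  then have "((\<lambda>t. ?f D t - ?f E t) has_integral (\<Sum>i\<in>(UNIV :: 'i set). 0)) S"
    by (intro has_integral_UN) (use disjoint in \<open>simp_all add: pairwise_def del: Int_atLeastAtMost\<close>)
  then have "((\<lambda>t. if t \<in> S then ?f D t - ?f E t else 0) has_integral 0) {0..1}"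
    unfolding has_integral_restrict[OF S_subset] by simp
  then have "((\<lambda>t. ?f D t - ?f E t) has_integral 0) {0..1}"
  proof (rule has_integral_eq[rotated])
    fix t :: real assume t: "t \<in> {0..1}"
    show "(if t \<in> S then ?f D t - ?f E t else 0) = ?f D t - ?f E t"
    proof (cases "t \<in> S")
      case False
      have "velocity (curve E) t = velocity (curve D) t" "curve E t = curve D t"
        using outside[OF t False] tangent_outside[OF t False] unfolding tangent_def by blast+
      then have "?f D t - ?f E t = 0" by simp
      with False show ?thesis by (metis (full_types))
    qed (simp only: if_True)
  qed
  moreover have "((\<lambda>t. ?f D t - ?f E t) has_integral integral {0..1} (?f D) - integral {0..1} (?f E)) {0..1}"
    by (intro has_integral_diff integrable_integral int)
  ultimately have "0 = integral {0..1} (?f D) - integral {0..1} (?f E)"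
    by (rule has_integral_unique)
  then have "integral {0..1} (?f D) = integral {0..1} (?f E)" by simp
  then show "winding_number (curve E) z = winding_number (curve D) z"
    using winding_number_eq_turn[OF D.C1] winding_number_eq_turn[OF E.C1] D.path_image_eq E.path_image_eq off offE
    by (simp add: turn_def)
qed

text \<open>
  The index is determined by the winding numbers near the point, and a neighbourhood of the point
  lies outside the disc.
\<close>
lemma curve_index_outside:
  assumes s: "0 \<le> s" "s < 1" "s \<notin> S"
  shows "E.curve_index s = D.curve_index s"
proof -
  define p where "p = curve D s"
  have p: "curve E s = p" "p \<notin> B" using outside[of s] s by (auto simp: p_def)
  have out: "t \<notin> S" if "curve D t = p \<or> curve E t = p" for t using that p(2) inside by auto
  have br: "branches E p = branches D p"
  proof -
    have "curve E t = p \<longleftrightarrow> curve D t = p" if "t \<in> {0..<1}" for t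
      using that out[of t] outside[of t] by (cases "t \<in> S") auto
    then show ?thesis unfolding branches_def by blast
  qed
  have tg: "tangent E t = tangent D t" if "t \<in> branches D p" for t
    using that out tangent_outside[of t] by (auto simp: branches_def)
  have "has_index E p (mean_index D p)"
    unfolding has_index_def
  proof (intro allI impI)
    fix d z assume tr: "\<forall>t\<in>branches E p. det2 (tangent E t) d \<noteq> 0" and z: "directional z p d"
    then have "\<forall>t\<in>branches D p. det2 (tangent D t) d \<noteq> 0" using br tg by simp
    with D.has_index_mean_index[OF s(1,2)] z
    have *: "\<forall>\<^sub>F e in at_right 0. z e \<notin> range (curve D)"
      "((\<lambda>e. winding_number (curve D) (z e)) \<longlongrightarrow> mean_index D p +
           of_real (\<Sum>t\<in>branches D p. sgn (det2 (tangent D t) d)) / 2) (at_right 0)"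
      unfolding has_index_def p_def[symmetric] by blast+
    have nB: "\<forall>\<^sub>F e in at_right 0. z e \<in> - B"
      by (rule topological_tendstoD[OF directional_tendsto[OF z]]) (use closed_B p(2) in auto)
    have "\<forall>\<^sub>F e in at_right 0. z e \<notin> range (curve E)"
      using *(1) nB by eventually_elim (use winding_number_eq(1) in auto)
    moreover have "\<forall>\<^sub>F e in at_right 0. winding_number (curve D) (z e) = winding_number (curve E) (z e)"
      using *(1) nB by eventually_elim (use winding_number_eq(2) in auto)
    ultimately show "(\<forall>\<^sub>F e in at_right 0. z e \<notin> range (curve E)) \<and>
        ((\<lambda>e. winding_number (curve E) (z e)) \<longlongrightarrow> mean_index D p +
           of_real (\<Sum>t\<in>branches E p. sgn (det2 (tangent E t) d)) / 2) (at_right 0)"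
      using Lim_transform_eventually[OF *(2)] br tg by simp
  qed
  then have "mean_index E p = mean_index D p" using E.mean_index_eqI[OF s(1,2)] p(1) by simp
  then show ?thesis by (simp add: D.curve_index_def E.curve_index_def p(1) flip: p_def)
qed

lemma SCI_split:
  "SCI D = (\<Sum>(s, t)\<in>crossings D \<inter> (- S) \<times> UNIV. crossing_sign D s t * crossing_index D s t)
     + (\<Sum>(s, t)\<in>crossings D \<inter> S \<times> S. crossing_sign D s t * D.curve_index s)"
proof -
  have fin: "finite (crossings D)" using D.crossings_subset D.finite_double_points finite_subset by blast
  have un: "crossings D = (crossings D \<inter> (- S) \<times> UNIV) \<union> (crossings D \<inter> S \<times> S)"
  proof -
    have "x \<in> S \<times> S" if "x \<in> crossings D" "x \<notin> (- S) \<times> UNIV" for x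
      using that double_point_in_S[of "fst x" "snd x"] by (cases x) (simp add: crossings_def del: UN_iff)
    then show ?thesis by blast
  qed
  have "SCI D = (\<Sum>(s, t)\<in>(crossings D \<inter> (- S) \<times> UNIV) \<union> (crossings D \<inter> S \<times> S). crossing_sign D s t * crossing_index D s t)"
    unfolding SCI_def using un by simp
  also have "\<dots> = (\<Sum>(s, t)\<in>crossings D \<inter> (- S) \<times> UNIV. crossing_sign D s t * crossing_index D s t)
     + (\<Sum>(s, t)\<in>crossings D \<inter> S \<times> S. crossing_sign D s t * crossing_index D s t)"
    using fin by (intro sum.union_disjoint) auto
  also have "(\<Sum>(s, t)\<in>crossings D \<inter> S \<times> S. crossing_sign D s t * crossing_index D s t) =
      (\<Sum>(s, t)\<in>crossings D \<inter> S \<times> S. crossing_sign D s t * D.curve_index s)"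
    by (intro sum.cong refl) (auto simp: crossings_def D.crossing_index_eq)
  finally show ?thesis .
qed

text \<open>
  Crossings outside the disc keep their signs and their indices.
\<close>
lemma SCI_change:
  "SCI E - SCI D = (\<Sum>(s, t)\<in>crossings E \<inter> S \<times> S. crossing_sign E s t * E.curve_index s)
    - (\<Sum>(s, t)\<in>crossings D \<inter> S \<times> S. crossing_sign D s t * D.curve_index s)"
proof -
  have "(\<Sum>(s, t)\<in>crossings E \<inter> (- S) \<times> UNIV. crossing_sign E s t * crossing_index E s t) =
     (\<Sum>(s, t)\<in>crossings D \<inter> (- S) \<times> UNIV. crossing_sign D s t * crossing_index D s t)"
  proof (rule sum.cong)
    show "crossings E \<inter> (- S) \<times> UNIV = crossings D \<inter> (- S) \<times> UNIV"
      using double_points_outside over_outside by (auto simp: crossings_def simp del: UN_iff)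
    fix x assume "x \<in> crossings D \<inter> (- S) \<times> UNIV"
    then obtain s t where x: "x = (s, t)" "(s, t) \<in> double_points D" "s \<notin> S"
      by (cases x) (auto simp: crossings_def simp del: UN_iff)
    have t: "t \<notin> S" "(s, t) \<in> double_points E"
      using double_point_in_S[OF x(2)] double_points_outside[OF x(3)] x by auto
    have st: "s \<in> {0..<1}" "t \<in> {0..<1}" using x by (auto simp: double_points_def)
    have "crossing_index E s t = crossing_index D s t"
      using D.crossing_index_eq[OF x(2)] E.crossing_index_eq[OF t(2)] curve_index_outside[of s] st x(3) by simp
    moreover have "crossing_sign E s t = crossing_sign D s t"
      using tangent_outside[of s] tangent_outside[of t] st x t over_outside[OF x(2,3)]
      by (simp add: crossing_sign_def)
    ultimately show "(case x of (s, t) \<Rightarrow> crossing_sign E s t * crossing_index E s t) =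
        (case x of (s, t) \<Rightarrow> crossing_sign D s t * crossing_index D s t)" by (simp add: x(1))
  qed
  then show ?thesis using SCI_split tangle.SCI_split[OF swap] by simp
qed

definition strand_params :: "diagram \<Rightarrow> 'i \<Rightarrow> real set" where
  "strand_params K i = fst ` double_points K \<inter> {a i<..<b i}"

text \<open>
  Here \<open>w\<close> is the index just before and \<open>w'\<close> the index just after the strand. Both are taken at points
  outside the disc and hence are the same for \<open>D\<close> and \<open>E\<close>.
\<close>
lemma curve_index_on_strand:
  fixes i
  obtains w w' where
    "\<And>t. t \<in> {a i<..<b i} \<Longrightarrow> D.curve_index t = w + (\<Sum>u\<in>strand_params D i \<inter> {..<t}. jump D u) + jump D t / 2"
    "\<And>t. t \<in> {a i<..<b i} \<Longrightarrow> E.curve_index t = w + (\<Sum>u\<in>strand_params E i \<inter> {..<t}. jump E u) + jump E t / 2"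
    "w' = w + (\<Sum>u\<in>strand_params D i. jump D u)"
    "w' = w + (\<Sum>u\<in>strand_params E i. jump E u)"
proof -
  let ?P = "fst ` (double_points D \<union> double_points E)"
  have "finite ?P" using D.finite_double_points E.finite_double_points by blast
  then have o: "open (- ?P)" by (intro open_Compl finite_imp_closed)
  have "s \<notin> ?P" if "s \<in> {a i, b i}" for s using ends_simple[of s _ i] that ab[of i] by fastforce
  then have "a i \<in> - ?P" "b i \<in> - ?P" by auto
  then obtain r1 r2 where r: "r1 > 0" "ball (a i) r1 \<subseteq> - ?P" "r2 > 0" "ball (b i) r2 \<subseteq> - ?P"
    using o by (meson openE)
  have "\<forall>\<^sub>F e in at_right 0. 0 < e \<and> e < min r1 r2"
    using r by (auto simp: eventually_at_right_field intro!: exI[of _ "min r1 r2"])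
  with just_outside[of i] have "\<forall>\<^sub>F e in at_right 0. a i - e \<in> {0<..<1} - S \<and> b i + e \<in> {0<..<1} - S \<and> 0 < e \<and> e < min r1 r2"
    by (auto simp only: eventually_conj_iff)
  then obtain e where e: "a i - e \<in> {0<..<1} - S" "b i + e \<in> {0<..<1} - S" "0 < e" "e < r1" "e < r2"
    using eventually_happens[of _ "at_right (0::real)"] by fastforce
  define c d where "c = a i - e" and "d = b i + e"
  have cP: "u \<notin> ?P" if "c \<le> u" "u \<le> a i" for u using that r(2) e unfolding c_def by (force simp: dist_real_def)
  have dP: "u \<notin> ?P" if "b i \<le> u" "u \<le> d" for u using that r(4) e unfolding d_def by (force simp: dist_real_def)
  have cd: "0 < c" "c < a i" "b i < d" "d < 1" using e by (auto simp: c_def d_def)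
  have D1: "fst ` double_points D \<inter> {c<..<t} = strand_params D i \<inter> {..<t}"
    and E1: "fst ` double_points E \<inter> {c<..<t} = strand_params E i \<inter> {..<t}" if "t < b i" for t
  proof -
    define PD PE where "PD = fst ` double_points D" and "PE = fst ` double_points E"
    have "a i < u" if "u \<in> PD \<union> PE" "c < u" for u
      using cP[of u] that unfolding PD_def PE_def image_Un by force
    then show "fst ` double_points D \<inter> {c<..<t} = strand_params D i \<inter> {..<t}"
      "fst ` double_points E \<inter> {c<..<t} = strand_params E i \<inter> {..<t}"
      using cd that unfolding strand_params_def PD_def[symmetric] PE_def[symmetric] by auto
  qed
  have D2: "fst ` double_points D \<inter> {c<..<d} = strand_params D i"
    and E2: "fst ` double_points E \<inter> {c<..<d} = strand_params E i"
  proof -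
    define PD PE where "PD = fst ` double_points D" and "PE = fst ` double_points E"
    have "a i < u" if "u \<in> PD \<union> PE" "c < u" for u
      using cP[of u] that unfolding PD_def PE_def image_Un by force
    moreover have "u < b i" if "u \<in> PD \<union> PE" "u < d" for u
      using dP[of u] that unfolding PD_def PE_def image_Un by force
    ultimately show "fst ` double_points D \<inter> {c<..<d} = strand_params D i"
      "fst ` double_points E \<inter> {c<..<d} = strand_params E i"
      using cd ab[of i] unfolding strand_params_def PD_def[symmetric] PE_def[symmetric] by auto
  qed
  have j: "jump D c = 0" "jump E c = 0" "jump D d = 0" "jump E d = 0"
    using cP[of c] dP[of d] cd by (auto intro!: D.jump_eq_0 E.jump_eq_0 simp: image_Un)
  have ce: "E.curve_index c = D.curve_index c" "E.curve_index d = D.curve_index d"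
    using e cd ab[of i] by (auto intro!: curve_index_outside simp: c_def d_def)
  show ?thesis
  proof (rule that[of "D.curve_index c" "D.curve_index d"])
    show "D.curve_index t = D.curve_index c + (\<Sum>u\<in>strand_params D i \<inter> {..<t}. jump D u) + jump D t / 2"
      if "t \<in> {a i<..<b i}" for t
      using D.curve_index_change[of c t] D1[of t] that cd j by simp
    show "E.curve_index t = D.curve_index c + (\<Sum>u\<in>strand_params E i \<inter> {..<t}. jump E u) + jump E t / 2"
      if "t \<in> {a i<..<b i}" for t
      using E.curve_index_change[of c t] E1[of t] that cd j ce by simp
    show "D.curve_index d = D.curve_index c + (\<Sum>u\<in>strand_params D i. jump D u)"
      using D.curve_index_change[of c d] D2 cd j ab[of i] by simp
    show "D.curve_index d = D.curve_index c + (\<Sum>u\<in>strand_params E i. jump E u)"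
      using E.curve_index_change[of c d] E2 cd j ce ab[of i] by simp
  qed
qed

text \<open>
  Turnings about points outside the disc are preserved, and the end points of a strand are limits
  of such points.
\<close>
lemma crossing_number_eq:
  assumes D: "\<And>s t. s \<in> {a i..b i} \<Longrightarrow> t \<in> {a j..b j} \<Longrightarrow> s \<in> {a i, b i} \<or> t \<in> {a j, b j} \<Longrightarrow> curve D s \<noteq> curve D t"
    and E: "\<And>s t. s \<in> {a i..b i} \<Longrightarrow> t \<in> {a j..b j} \<Longrightarrow> s \<in> {a i, b i} \<or> t \<in> {a j, b j} \<Longrightarrow> curve E s \<noteq> curve E t"
  shows "crossing_number (curve D) (a i) (b i) (a j) (b j) = crossing_number (curve E) (a i) (b i) (a j) (b j)"
proof -
  have *: "turn (curve D) (a k) (b k) p = turn (curve E) (a k) (b k) p"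
    if p: "p = curve D (a l) \<or> p = curve D (b l)" "p \<notin> curve D ` {a k..b k}" "p \<notin> curve E ` {a k..b k}" for k l p
  proof -
    obtain z where z: "(z \<longlongrightarrow> p) (at_right (0::real))" "\<forall>\<^sub>F e in at_right 0. z e \<notin> B"
    proof -
      have "\<forall>\<^sub>F e in at_right 0. curve D (a l - e) \<notin> B" "\<forall>\<^sub>F e in at_right 0. curve D (b l + e) \<notin> B"
        using just_outside[of l] by (eventually_elim, use outside in auto)+
      then show ?thesis using p(1) that end_limits[of l] by blast
    qed
    have "\<forall>\<^sub>F e in at_right 0. turn (curve D) (a k) (b k) (z e) = turn (curve E) (a k) (b k) (z e)"
      using z(2) by eventually_elim (rule strand_turn)
    from Lim_transform_eventually[OF turn_tendsto[OF D.C1 p(2) z(1)] this]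
    show ?thesis using tendsto_unique[OF _ turn_tendsto[OF E.C1 p(3) z(1)]] by fastforce
  qed
  have "turn (curve D) (a j) (b j) (curve D (a i)) = turn (curve E) (a j) (b j) (curve D (a i))"
    "turn (curve D) (a j) (b j) (curve D (b i)) = turn (curve E) (a j) (b j) (curve D (b i))"
    "turn (curve D) (a i) (b i) (curve D (a j)) = turn (curve E) (a i) (b i) (curve D (a j))"
    "turn (curve D) (a i) (b i) (curve D (b j)) = turn (curve E) (a i) (b i) (curve D (b j))"
    using D E ab[of i] ab[of j] ends_eq
    by (auto intro!: * simp: image_iff) (metis atLeastAtMost_iff less_imp_le order_refl)+
  then show ?thesis by (simp add: crossing_number_def ends_eq)
qed

end

section \<open>Sums over the crossings in the disc\<close>

context knot begin

lemma jump_sym: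
  assumes "(s, t) \<in> double_points D"
  shows "jump D t = - jump D s"
  using jump_eq[OF assms] jump_eq[OF double_points_sym[OF assms]] det2_commute sgn_minus by metis

lemma crossing_sign_eq_jump:
  assumes "(s, t) \<in> double_points D"
  shows "crossing_sign D s t = (if over D s then - jump D s else jump D s)"
  using jump_eq[OF assms] det2_commute[of "tangent D s"] by (simp add: crossing_sign_def sgn_minus)

lemma curve_index_sym: "(s, t) \<in> double_points D \<Longrightarrow> curve_index t = curve_index s"
  by (simp add: curve_index_def double_points_def)

lemma crossing_term_sym:
  assumes "(s, t) \<in> double_points D"
  shows "crossing_sign D t s * curve_index t = crossing_sign D s t * curve_index s"
  using crossing_sign_eq_jump[OF assms] crossing_sign_eq_jump[OF double_points_sym[OF assms]]
    jump_sym[OF assms] over_under[OF assms] curve_index_sym[OF assms] by simp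

text \<open>
  The tangles of the moves are described by ordered pairs of parameters, in which every crossing occurs
  twice; its contribution is the same for both orders.
\<close>
lemma sum_crossings_in:
  "(\<Sum>(s, t)\<in>crossings D \<inter> S \<times> S. crossing_sign D s t * curve_index s) =
   (\<Sum>(s, t)\<in>double_points_in S D. crossing_sign D s t * curve_index s) / 2"
proof -
  let ?f = "\<lambda>(s, t). crossing_sign D s t * curve_index s"
  let ?C = "crossings D \<inter> S \<times> S"
  have fin: "finite ?C" using crossings_subset finite_double_points finite_subset by blast
  have un: "double_points_in S D = ?C \<union> prod.swap ` ?C"
  proof -
    have "(s, t) \<in> ?C \<union> prod.swap ` ?C" if "(s, t) \<in> double_points_in S D" for s t
    proof (cases "over D s")
      case True
      then show ?thesis using that by (auto simp: double_points_in_def crossings_def)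
    next
      case False
      then have "(t, s) \<in> ?C"
        using that double_points_sym over_under by (auto simp: double_points_in_def crossings_def)
      then show ?thesis by force
    qed
    then have "double_points_in S D \<subseteq> ?C \<union> prod.swap ` ?C" by (rule subrelI)
    moreover have "?C \<union> prod.swap ` ?C \<subseteq> double_points_in S D"
      using double_points_sym by (auto simp: double_points_in_def crossings_def)
    ultimately show ?thesis by (rule equalityI)
  qed
  have dis: "?C \<inter> prod.swap ` ?C = {}"
  proof -
    have "(t, s) \<notin> ?C" if "(s, t) \<in> ?C" for s t
      using that over_under[of s t] by (simp add: crossings_def)
    then show ?thesis by fastforce
  qed
  have "sum ?f (prod.swap ` ?C) = sum (?f \<circ> prod.swap) ?C"
    by (rule sum.reindex) simp
  also have "\<dots> = sum ?f ?C"
  proof (rule sum.cong[OF refl])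
    fix x assume "x \<in> ?C"
    then obtain s t where x: "x = (s, t)" "(s, t) \<in> double_points D" by (auto simp: crossings_def)
    show "(?f \<circ> prod.swap) x = ?f x"
      using crossing_term_sym[OF x(2)] by (simp add: x(1))
  qed
  finally have "sum ?f (double_points_in S D) = 2 * sum ?f ?C"
    unfolding un using fin dis by (simp add: sum.union_disjoint)
  then show ?thesis by simp
qed

end

lemma (in tangle) SCI_change_in:
  "SCI E - SCI D = ((\<Sum>(s, t)\<in>double_points_in S E. crossing_sign E s t * E.curve_index s)
    - (\<Sum>(s, t)\<in>double_points_in S D. crossing_sign D s t * D.curve_index s)) / 2"
  unfolding SCI_change D.sum_crossings_in E.sum_crossings_in by (simp add: diff_divide_distrib)

lemma tangleI:
  fixes a b :: "'i::finite \<Rightarrow> real"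
  assumes loc: "local_change B (\<Union>i. {a i..b i}) D E"
    and ab: "\<And>i. a i < b i" and dis: "\<And>i j. i \<noteq> j \<Longrightarrow> {a i..b i} \<inter> {a j..b j} = {}"
    and ends: "\<And>s t i. (s, t) \<in> double_points_in (\<Union>i. {a i..b i}) D \<union> double_points_in (\<Union>i. {a i..b i}) E \<Longrightarrow>
                 s \<in> {a i..b i} \<Longrightarrow> s \<in> {a i<..<b i}"
  shows "tangle D E B a b"
proof -
  let ?S = "\<Union>i. {a i..b i}"
  have kD: "knot D" and kE: "knot E" and disc: "B homeomorphic cball (0 :: complex) 1"
    and S: "?S \<subseteq> {0<..<1}"
    and inn: "\<And>t. t \<in> interior ?S \<Longrightarrow> curve D t \<in> interior B \<and> curve E t \<in> interior B"
    and eq: "\<And>t. t \<in> {0..1} - interior ?S \<Longrightarrow> curve E t = curve D t"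
    and out: "\<And>t. t \<in> {0..1} - ?S \<Longrightarrow> curve D t \<notin> B"
    and ov: "\<And>s t. (s, t) \<in> double_points D \<Longrightarrow> s \<notin> ?S \<Longrightarrow> over E s = over D s"
    using loc unfolding local_change_def knot_def by (auto simp del: UN_iff)
  have "closed B" using disc homeomorphic_compactness by (metis compact_cball compact_imp_closed)
  have inside: "curve D t \<in> B \<and> curve E t \<in> B" if t: "t \<in> {a i..b i}" for t i
  proof -
    have "{a i<..<b i} \<subseteq> interior ?S"
    proof (rule interior_maximal)
      have "{a i<..<b i} \<subseteq> {a i..b i}" by auto
      then show "{a i<..<b i} \<subseteq> ?S" by blast
    qed simp
    then have "curve D ` {a i<..<b i} \<subseteq> B" "curve E ` {a i<..<b i} \<subseteq> B"
      using inn interior_subset by blast+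
    then have "curve D ` closure {a i<..<b i} \<subseteq> B" "curve E ` closure {a i<..<b i} \<subseteq> B"
      using image_closure_subset[OF C1_continuous[OF knot.C1[OF kD]] \<open>closed B\<close>]
        image_closure_subset[OF C1_continuous[OF knot.C1[OF kE]] \<open>closed B\<close>] by blast+
    then show ?thesis using t ab[of i] by auto
  qed
  have outside: "curve E t = curve D t \<and> curve D t \<notin> B" if "t \<in> {0..1}" "t \<notin> ?S" for t
    using that eq[of t] out[of t] interior_subset[of ?S] by blast
  have pair: "t \<in> ?S" if "(s, t) \<in> double_points D \<union> double_points E" "s \<in> ?S" for s t
  proof (rule ccontr)
    assume "t \<notin> ?S"
    moreover have "t \<in> {0..1}" using that by (auto simp: double_points_def)
    ultimately have "curve D t \<notin> B" "curve E t = curve D t" using outside by blast+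
    moreover have "curve D s \<in> B" "curve E s \<in> B" using that(2) inside by blast+
    moreover have "curve D s = curve D t \<or> curve E s = curve E t"
      using that(1) by (auto simp: double_points_def)
    ultimately show False by metis
  qed
  show ?thesis
  proof (intro tangle.intro tangle_axioms.intro kD kE disc ab inside outside ov)
    show "{a i..b i} \<inter> {a j..b j} = {}" if "i \<noteq> j" for i j using dis that .
    show "0 < a i" "b i < 1" for i
      using subsetD[OF S, of "a i"] subsetD[OF S, of "b i"] ab[of i] by (auto intro: less_imp_le)
    show "s \<in> {a i<..<b i}" if "(s, t) \<in> double_points D \<union> double_points E" "s \<in> {a i..b i}" for s t i
    proof (rule ends[OF _ that(2), of t])
      have "s \<in> ?S" using that(2) by blast
      then show "(s, t) \<in> double_points_in ?S D \<union> double_points_in ?S E"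
        using that(1) pair[OF that(1)] unfolding double_points_in_def by blast
    qed
  qed
qed

section \<open>The first and the second move\<close>

lemma SCI_Omega1F_create:
  assumes "Omega1F_create D E"
  shows "SCI E = SCI D"
proof -
  obtain B a b s1 t1 s2 t2 where
    loc: "local_change B {a..b} D E" and dpD: "double_points_in {a..b} D = {}"
    and o: "a < s1" "s1 < t1" "t1 < s2" "s2 < t2" "t2 < b"
    and dpE: "double_points_in {a..b} E = {(s1, t1), (t1, s1), (s2, t2), (t2, s2)}"
    and side: "kink_side E s1 t1 = kink_side E s2 t2"
    and sign: "crossing_sign E s1 t1 = - crossing_sign E s2 t2"
    using assms unfolding Omega1F_create_def by blast
  interpret tangle D E B "\<lambda>_::unit. a" "\<lambda>_::unit. b"
    using loc o by (intro tangleI) (auto simp: dpD dpE)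
  have S: "S = {a..b}" by simp
  have in1: "(s1, t1) \<in> double_points E" and in2: "(s2, t2) \<in> double_points E"
    using dpE unfolding double_points_in_def by blast+
  have none: "fst ` double_points E \<inter> {t1<..<s2} = {}"
  proof -
    have "u \<notin> {t1<..<s2}" if "(u, v) \<in> double_points E" for u v
    proof
      assume u: "u \<in> {t1<..<s2}"
      then have "u \<in> {a..b}" using o by auto
      then have "(u, v) \<in> double_points_in {a..b} E"
        using that tangle.double_point_in_S[OF swap that] unfolding double_points_in_def S by blast
      then show False using u o unfolding dpE by auto
    qed
    then show ?thesis by auto
  qed
  have "E.curve_index s2 = E.curve_index t1 + jump E t1 / 2 + jump E s2 / 2"
    using E.curve_index_change[of t1 s2] none o unit by simp
  moreover have "jump E t1 = - jump E s2"
    using side E.jump_eq[OF in1] E.jump_eq[OF in2] E.jump_sym[OF in1]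
      det2_commute[of "tangent E t1"] det2_commute[of "tangent E t2"]
    by (simp add: kink_side_def sgn_minus)
  ultimately have "E.curve_index s2 = E.curve_index s1" using E.curve_index_sym[OF in1] by simp
  moreover have "crossing_sign E t1 s1 * E.curve_index t1 = crossing_sign E s1 t1 * E.curve_index s1"
    and "crossing_sign E t2 s2 * E.curve_index t2 = crossing_sign E s2 t2 * E.curve_index s2"
    using E.crossing_term_sym[OF in1] E.crossing_term_sym[OF in2] .
  ultimately show ?thesis using SCI_change_in sign o unfolding S dpD dpE by simp
qed

lemma SCI_Omega2_create:
  assumes "Omega2_create D E"
  shows "SCI E = SCI D"
proof -
  obtain B a1 b1 a2 b2 s1 s2 t1 t2 where
    o: "a1 < b1" "b1 < a2" "a2 < b2"
    and loc: "local_change B ({a1..b1} \<union> {a2..b2}) D E"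
    and dpD: "double_points_in ({a1..b1} \<union> {a2..b2}) D = {}"
    and st: "s1 \<in> {a1<..<b1}" "s2 \<in> {a1<..<b1}" "t1 \<in> {a2<..<b2}" "t2 \<in> {a2<..<b2}" "s1 \<noteq> s2" "t1 \<noteq> t2"
    and dpE: "double_points_in ({a1..b1} \<union> {a2..b2}) E = {(s1, t1), (t1, s1), (s2, t2), (t2, s2)}"
    and ov: "over E s1 \<longleftrightarrow> over E s2"
    using assms unfolding Omega2_create_def by auto
  define a b where "a i = (if i then a2 else a1)" and "b i = (if i then b2 else b1)" for i
  have S: "(\<Union>i. {a i..b i}) = {a1..b1} \<union> {a2..b2}" by (auto simp: a_def b_def UNIV_bool)
  interpret tangle D E B a b
  proof (rule tangleI, unfold S)
    show "local_change B ({a1..b1} \<union> {a2..b2}) D E" by (rule loc)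
  qed (use o st in \<open>auto simp: dpD dpE a_def b_def split: if_splits\<close>)
  have in1: "(s1, t1) \<in> double_points E" and in2: "(s2, t2) \<in> double_points E"
    using dpE unfolding double_points_in_def by blast+
  have "strand_params D False = {}"
  proof -
    have "u \<notin> {a1<..<b1}" if "(u, v) \<in> double_points D" for u v
    proof
      assume "u \<in> {a1<..<b1}"
      then have "u \<in> S" unfolding S by auto
      then have "(u, v) \<in> double_points_in S D"
        using that double_point_in_S[OF that] unfolding double_points_in_def by blast
      then show False unfolding S dpD by simp
    qed
    then show ?thesis by (auto simp: strand_params_def a_def b_def)
  qed
  moreover have pE: "strand_params E False = {s1, s2}"
  proof -
    have "u = s1 \<or> u = s2" if "(u, v) \<in> double_points E" "u \<in> {a1<..<b1}" for u v
    proof -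
      have "u \<in> S" using that unfolding S by auto
      then have "(u, v) \<in> double_points_in S E"
        using that tangle.double_point_in_S[OF swap that(1)] unfolding double_points_in_def by blast
      then show ?thesis using that(2) st o unfolding S dpE by auto
    qed
    then show ?thesis using st in1 in2 by (auto simp: strand_params_def a_def b_def image_iff) force+
  qed
  moreover obtain w w' where
    w: "\<And>t. t \<in> {a False<..<b False} \<Longrightarrow> E.curve_index t = w + (\<Sum>u\<in>strand_params E False \<inter> {..<t}. jump E u) + jump E t / 2"
      "w' = w + (\<Sum>u\<in>strand_params D False. jump D u)" "w' = w + (\<Sum>u\<in>strand_params E False. jump E u)"
    using curve_index_on_strand[of False] by metis
  ultimately have j: "jump E s2 = - jump E s1" using st by simp
  have "E.curve_index s1 = E.curve_index s2"
  proof (cases "s1 < s2")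
    case True
    then have "{s1, s2} \<inter> {..<s1} = {}" "{s1, s2} \<inter> {..<s2} = {s1}" by auto
    then show ?thesis using w(1)[of s1] w(1)[of s2] st j by (simp add: pE a_def b_def)
  next
    case False
    then have "{s1, s2} \<inter> {..<s1} = {s2}" "{s1, s2} \<inter> {..<s2} = {}" using st by auto
    then show ?thesis using w(1)[of s1] w(1)[of s2] st j by (simp add: pE a_def b_def)
  qed
  moreover have "crossing_sign E s2 t2 = - crossing_sign E s1 t1"
    using E.crossing_sign_eq_jump[OF in1] E.crossing_sign_eq_jump[OF in2] ov j by simp
  moreover have "crossing_sign E t1 s1 * E.curve_index t1 = crossing_sign E s1 t1 * E.curve_index s1"
    and "crossing_sign E t2 s2 * E.curve_index t2 = crossing_sign E s2 t2 * E.curve_index s2"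
    using E.crossing_term_sym[OF in1] E.crossing_term_sym[OF in2] .
  moreover have "s1 \<noteq> t1" "s1 \<noteq> t2" "s2 \<noteq> t1" "s2 \<noteq> t2" using st o by auto
  ultimately show ?thesis using SCI_change_in st unfolding S dpD dpE by simp
qed

section \<open>The third move\<close>

lemma UNIV_strand: "(UNIV :: strand set) = {Bottom, Middle, Top}"
  using strand.exhaust by auto

instance strand :: finite
  by standard (simp add: UNIV_strand)

lemma third_strand: "i \<noteq> succ_strand i" "i \<noteq> pred_strand i" "pred_strand i \<noteq> succ_strand i"
  "j \<noteq> i \<Longrightarrow> j = pred_strand i \<or> j = succ_strand i"
  by (cases i; cases j; simp)+

text \<open>
  Consequences of the description of the double points of three strands that cross pairwise once,
  for a general number of strands.
\<close>
lemma (in tangle) triangle_crossing: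
  fixes x :: "'i \<Rightarrow> 'i \<Rightarrow> real"
  assumes x': "\<forall>i j. i \<noteq> j \<longrightarrow> x i j \<in> {a i<..<b i}"
    and dp: "double_points_in S D = {(x i j, x j i) | i j. i \<noteq> j}"
  shows "i \<noteq> j \<Longrightarrow> (x i j, x j i) \<in> double_points D"
    and "(s, t) \<in> double_points D \<Longrightarrow> s \<in> {a i..b i} \<Longrightarrow> \<exists>j. j \<noteq> i \<and> s = x i j \<and> t = x j i"
    and "i \<noteq> j \<Longrightarrow> s \<in> {a i..b i} \<Longrightarrow> t \<in> {a j..b j} \<Longrightarrow> curve D s = curve D t \<Longrightarrow> s = x i j \<and> t = x j i"
    and "i \<noteq> j \<Longrightarrow> i \<noteq> k \<Longrightarrow> j \<noteq> k \<Longrightarrow> x i j \<noteq> x i k"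
    and "i \<noteq> j \<Longrightarrow> crossing_number (curve D) (a i) (b i) (a j) (b j) = of_real (jump D (x i j))"
proof -
  note x = x'[rule_format]
  have same: "i = j" if "s \<in> {a i..b i}" "s \<in> {a j..b j}" for s i j
    using disjoint[of i j] that by blast
  show 1: "(x i j, x j i) \<in> double_points D" if "i \<noteq> j" for i j
    using dp that unfolding double_points_in_def by blast
  show 2: "\<exists>j. j \<noteq> i \<and> s = x i j \<and> t = x j i" if st: "(s, t) \<in> double_points D" "s \<in> {a i..b i}" for s t i
  proof -
    have "s \<in> S" using st(2) by blast
    then have "(s, t) \<in> double_points_in S D"
      using st double_point_in_S[OF st(1)] unfolding double_points_in_def by blast
    then obtain k j where kj: "s = x k j" "t = x j k" "k \<noteq> j" unfolding dp by auto
    then have "k = i" using same[of s k i] x[OF kj(3)] st(2) by auto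
    then show ?thesis using kj by auto
  qed
  show 3: "s = x i j \<and> t = x j i"
    if "i \<noteq> j" "s \<in> {a i..b i}" "t \<in> {a j..b j}" "curve D s = curve D t" for s t i j
  proof -
    have "s \<noteq> t" using same that by blast
    then have "(s, t) \<in> double_points D"
      using that unit[of i] unit[of j] by (auto simp: double_points_def)
    from 2[OF this that(2)] obtain k where k: "k \<noteq> i" "s = x i k" "t = x k i" by blast
    then have "k = j" using same[of t k j] x[of k i] that(3) by auto
    then show ?thesis using k by simp
  qed
  show "x i j \<noteq> x i k" if "i \<noteq> j" "i \<noteq> k" "j \<noteq> k" for i j k
  proof
    assume "x i j = x i k"
    then have "x j i = x k i" using D.partner_unique 1[of i j] 1[of i k] that by metis
    then show False using same[of "x j i" j k] x[of j i] x[of k i] that by auto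
  qed
  show "crossing_number (curve D) (a i) (b i) (a j) (b j) = of_real (jump D (x i j))" if ij: "i \<noteq> j" for i j
  proof -
    note dpij = 1[OF ij]
    have "curve D (x i j) = curve D (x j i)" using dpij by (simp add: double_points_def)
    then show ?thesis
      using crossing_number_single_crossing[OF D.C1, of "a i" "x i j" "b i" "a j" "x j i" "b j"]
        x[of i j] x[of j i] ij 3[OF ij] D.transverse[OF D.double_points_sym[OF dpij]]
      unfolding D.jump_eq[OF dpij] D.tangent_eq by auto
  qed
qed

lemma (in tangle) sum_triangle:
  fixes x :: "'i \<Rightarrow> 'i \<Rightarrow> real"
  assumes x': "\<forall>i j. i \<noteq> j \<longrightarrow> x i j \<in> {a i<..<b i}"
    and dp: "double_points_in S D = {(x i j, x j i) | i j. i \<noteq> j}"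
  shows "(\<Sum>(s, t)\<in>double_points_in S D. f s t) = (\<Sum>(i, j)\<in>{(i, j). i \<noteq> j}. f (x i j) (x j i))"
proof -
  note x = x'[rule_format]
  have same: "i = j" if "s \<in> {a i<..<b i}" "s \<in> {a j<..<b j}" for s i j
    using disjoint[of i j] that by force
  have "double_points_in S D = (\<lambda>(i, j). (x i j, x j i)) ` {(i, j). i \<noteq> j}"
    unfolding dp by auto
  moreover have "inj_on (\<lambda>(i, j). (x i j, x j i)) {(i, j). i \<noteq> j}"
    using x same by (auto simp: inj_on_def) metis+
  ultimately show ?thesis by (simp add: sum.reindex case_prod_unfold)
qed

text \<open>
  The jump \<open>\<epsilon> i j\<close> of strand \<open>i\<close> at strand \<open>j\<close> is the same in \<open>D\<close> and \<open>E\<close>. If \<open>i\<close>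
  meets the third strand \<open>k\<close> before \<open>j\<close> in \<open>D\<close>, it does so after \<open>j\<close> in \<open>E\<close>, and the index of the
  crossing with \<open>j\<close> loses \<open>\<epsilon> i k\<close>; otherwise it gains \<open>\<epsilon> i k\<close>. As the crossing of \<open>i\<close> and
  \<open>j\<close> is also the one of \<open>j\<close> and \<open>i\<close>, these changes \<open>\<Delta> i j\<close> are symmetric, which relates the
  jumps to the directions of the sides.
\<close>
lemma SCI_Omega3_local:
  assumes "Omega3_local x y D E"
  defines "Q \<equiv> \<lambda>i. if x i (pred_strand i) < x i (succ_strand i) then 1 else (-1 :: real)"
  shows "SCI E = SCI D + Q Bottom * Q Middle * Q Top"
proof -
  obtain B a b where ab: "\<And>i. a i < b i" and dis: "\<And>i j. i \<noteq> j \<Longrightarrow> {a i..b i} \<inter> {a j..b j} = {}"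
    and loc: "local_change B (\<Union>i. {a i..b i}) D E"
    and tD: "triangle D a b x" and tE: "triangle E a b y"
    and flip: "\<And>i. x i (pred_strand i) < x i (succ_strand i) \<longleftrightarrow> y i (succ_strand i) < y i (pred_strand i)"
    using assms(1) unfolding Omega3_local_def by blast
  have x': "\<forall>i j. i \<noteq> j \<longrightarrow> x i j \<in> {a i<..<b i}" and y': "\<forall>i j. i \<noteq> j \<longrightarrow> y i j \<in> {a i<..<b i}"
    and dpD: "double_points_in (\<Union>i. {a i..b i}) D = {(x i j, x j i) | i j. i \<noteq> j}"
    and dpE: "double_points_in (\<Union>i. {a i..b i}) E = {(y i j, y j i) | i j. i \<noteq> j}"
    and ovD: "over D (x Middle Bottom)" "over D (x Top Bottom)" "over D (x Top Middle)"
    and ovE: "over E (y Middle Bottom)" "over E (y Top Bottom)" "over E (y Top Middle)"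
    using tD tE unfolding triangle_def by blast+
  note x = x'[rule_format] and y = y'[rule_format]
  have same: "i = j" if "s \<in> {a i..b i}" "s \<in> {a j..b j}" for s i j
    using dis[of i j] that by blast
  interpret tangle D E B a b
  proof (rule tangleI[OF loc ab dis])
    fix s t i assume st: "(s, t) \<in> double_points_in (\<Union>i. {a i..b i}) D \<union> double_points_in (\<Union>i. {a i..b i}) E"
      and s: "s \<in> {a i..b i}"
    obtain k j where "s = x k j \<or> s = y k j" "k \<noteq> j" using st unfolding dpD dpE by blast
    then have k: "s \<in> {a k<..<b k}" using x y by metis
    then have "k = i" using same[of s k i] s by auto
    then show "s \<in> {a i<..<b i}" using k by simp
  qed
  interpret ED: tangle E D B a b by (rule swap)
  note crD = triangle_crossing[OF x' dpD] and crE = ED.triangle_crossing[OF y' dpE]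
  define \<epsilon> where "\<epsilon> i j = jump D (x i j)" for i j
  have \<epsilon>E: "jump E (y i j) = \<epsilon> i j" if ij: "i \<noteq> j" for i j
  proof -
    have "crossing_number (curve D) (a i) (b i) (a j) (b j) = crossing_number (curve E) (a i) (b i) (a j) (b j)"
    proof (rule crossing_number_eq)
      fix s t assume st: "s \<in> {a i..b i}" "t \<in> {a j..b j}" "s \<in> {a i, b i} \<or> t \<in> {a j, b j}"
      show "curve D s \<noteq> curve D t"
        using crD(3)[OF ij st(1,2)] st(3) x[of i j] x[of j i] ij by auto
      show "curve E s \<noteq> curve E t"
        using crE(3)[OF ij st(1,2)] st(3) y[of i j] y[of j i] ij by auto
    qed
    then show ?thesis unfolding crD(5)[OF ij] crE(5)[OF ij] by (simp add: \<epsilon>_def)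
  qed
  have \<epsilon>_sym: "\<epsilon> j i = - \<epsilon> i j" if "i \<noteq> j" for i j
    using D.jump_sym[OF crD(1)[OF that]] by (simp add: \<epsilon>_def)
  have \<epsilon>_val: "\<epsilon> i j = 1 \<or> \<epsilon> i j = -1" if "i \<noteq> j" for i j
    using D.jump_eq[OF crD(1)[OF that]] D.transverse[OF D.double_points_sym[OF crD(1)[OF that]]]
    by (auto simp: \<epsilon>_def sgn_if)
  define \<Delta> where "\<Delta> i j = E.curve_index (y i j) - D.curve_index (x i j)" for i j
  have \<Delta>_sym: "\<Delta> j i = \<Delta> i j" if "i \<noteq> j" for i j
    using D.curve_index_sym[OF crD(1)[OF that]] E.curve_index_sym[OF crE(1)[OF that]] by (simp add: \<Delta>_def)
  have \<Delta>: "\<Delta> i (succ_strand i) = - Q i * \<epsilon> i (pred_strand i)"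
      "\<Delta> i (pred_strand i) = Q i * \<epsilon> i (succ_strand i)" for i
  proof -
    let ?p = "pred_strand i" and ?s = "succ_strand i"
    note th = third_strand[of i]
    have spD: "strand_params D i = {x i ?p, x i ?s}"
    proof -
      have mem: "u \<in> {x i ?p, x i ?s}" if uv: "(u, v) \<in> double_points D" "u \<in> {a i<..<b i}" for u v
      proof -
        obtain j where "j \<noteq> i" "u = x i j" using crD(2)[OF uv(1), of i] uv(2) by auto
        then show ?thesis using third_strand(4)[of j i] by auto
      qed
      have "strand_params D i \<subseteq> {x i ?p, x i ?s}"
      proof
        fix u assume "u \<in> strand_params D i"
        then obtain v where "(u, v) \<in> double_points D" "u \<in> {a i<..<b i}"
          unfolding strand_params_def by force
        then show "u \<in> {x i ?p, x i ?s}" by (rule mem)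
      qed
      moreover have "x i ?p \<in> fst ` double_points D" "x i ?s \<in> fst ` double_points D"
        using crD(1)[OF th(1)] crD(1)[OF th(2)] by force+
      then have "{x i ?p, x i ?s} \<subseteq> strand_params D i"
        using x[OF th(1)] x[OF th(2)] unfolding strand_params_def by blast
      ultimately show ?thesis by (rule equalityI)
    qed
    have spE: "strand_params E i = {y i ?p, y i ?s}"
    proof -
      have mem: "u \<in> {y i ?p, y i ?s}" if uv: "(u, v) \<in> double_points E" "u \<in> {a i<..<b i}" for u v
      proof -
        obtain j where "j \<noteq> i" "u = y i j" using crE(2)[OF uv(1), of i] uv(2) by auto
        then show ?thesis using third_strand(4)[of j i] by auto
      qed
      have "strand_params E i \<subseteq> {y i ?p, y i ?s}"
      proof
        fix u assume "u \<in> strand_params E i"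
        then obtain v where "(u, v) \<in> double_points E" "u \<in> {a i<..<b i}"
          unfolding strand_params_def by force
        then show "u \<in> {y i ?p, y i ?s}" by (rule mem)
      qed
      moreover have "y i ?p \<in> fst ` double_points E" "y i ?s \<in> fst ` double_points E"
        using crE(1)[OF th(1)] crE(1)[OF th(2)] by force+
      then have "{y i ?p, y i ?s} \<subseteq> strand_params E i"
        using y[OF th(1)] y[OF th(2)] unfolding strand_params_def by blast
      ultimately show ?thesis by (rule equalityI)
    qed
    have nx: "x i ?p \<noteq> x i ?s" and ny: "y i ?p \<noteq> y i ?s"
      using crD(4)[OF th(2,1,3)] crE(4)[OF th(2,1,3)] .
    obtain w where w: "\<And>t. t \<in> {a i<..<b i} \<Longrightarrow> D.curve_index t = w + (\<Sum>u\<in>strand_params D i \<inter> {..<t}. jump D u) + jump D t / 2"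
      "\<And>t. t \<in> {a i<..<b i} \<Longrightarrow> E.curve_index t = w + (\<Sum>u\<in>strand_params E i \<inter> {..<t}. jump E u) + jump E t / 2"
      using curve_index_on_strand[of i] by metis
    have cut: "(\<Sum>u\<in>{p, q} \<inter> {..<p}. f u) = (if q < p then f q else 0)"
      "(\<Sum>u\<in>{p, q} \<inter> {..<q}. f u) = (if p < q then f p else 0)" if "p \<noteq> q" for p q :: real and f :: "real \<Rightarrow> real"
    proof -
      have "{p, q} \<inter> {..<p} = (if q < p then {q} else {})" "{p, q} \<inter> {..<q} = (if p < q then {p} else {})" by auto
      then show "(\<Sum>u\<in>{p, q} \<inter> {..<p}. f u) = (if q < p then f q else 0)"
        "(\<Sum>u\<in>{p, q} \<inter> {..<q}. f u) = (if p < q then f p else 0)" by auto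
    qed
    have D1: "D.curve_index (x i ?p) = w + (if x i ?s < x i ?p then \<epsilon> i ?s else 0) + \<epsilon> i ?p / 2"
      and D2: "D.curve_index (x i ?s) = w + (if x i ?p < x i ?s then \<epsilon> i ?p else 0) + \<epsilon> i ?s / 2"
      using w(1)[OF x[OF th(2)]] w(1)[OF x[OF th(1)]] unfolding spD cut[OF nx] \<epsilon>_def by auto
    have E1: "E.curve_index (y i ?p) = w + (if y i ?s < y i ?p then \<epsilon> i ?s else 0) + \<epsilon> i ?p / 2"
      and E2: "E.curve_index (y i ?s) = w + (if y i ?p < y i ?s then \<epsilon> i ?p else 0) + \<epsilon> i ?s / 2"
      using w(2)[OF y[OF th(2)]] w(2)[OF y[OF th(1)]] unfolding spE cut[OF ny] \<epsilon>E[OF th(1)] \<epsilon>E[OF th(2)] by auto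
    show "\<Delta> i ?s = - Q i * \<epsilon> i ?p" "\<Delta> i ?p = Q i * \<epsilon> i ?s"
      unfolding \<Delta>_def D1 D2 E1 E2 Q_def using flip[of i] nx ny by auto
  qed
  have sgE: "crossing_sign E (y i j) (y j i) = crossing_sign D (x i j) (x j i)" if "i \<noteq> j" for i j
    using E.crossing_sign_eq_jump[OF crE(1)[OF that]] D.crossing_sign_eq_jump[OF crD(1)[OF that]] \<epsilon>E[OF that]
      D.over_under[OF crD(1)[OF that]] E.over_under[OF crE(1)[OF that]] ovD ovE that
    by (cases i; cases j) (auto simp: \<epsilon>_def)
  define \<sigma> where "\<sigma> i j = crossing_sign D (x i j) (x j i)" for i j
  \<comment> \<open>the sign of a crossing is the jump of its lower strand\<close>
  have \<sigma>: "\<sigma> Bottom Middle = \<epsilon> Bottom Middle" "\<sigma> Middle Bottom = \<epsilon> Bottom Middle"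
     "\<sigma> Bottom Top = \<epsilon> Bottom Top" "\<sigma> Top Bottom = \<epsilon> Bottom Top"
     "\<sigma> Middle Top = \<epsilon> Middle Top" "\<sigma> Top Middle = \<epsilon> Middle Top"
  proof -
    have s: "\<sigma> i j = (if over D (x i j) then - \<epsilon> i j else \<epsilon> i j)" if "i \<noteq> j" for i j
      unfolding \<sigma>_def \<epsilon>_def by (rule D.crossing_sign_eq_jump[OF crD(1)[OF that]])
    have "\<not> over D (x Bottom Middle)" "\<not> over D (x Bottom Top)" "\<not> over D (x Middle Top)"
      using D.over_under[OF crD(1)[of Middle Bottom]] D.over_under[OF crD(1)[of Top Bottom]]
        D.over_under[OF crD(1)[of Top Middle]] ovD by simp_all
    then show "\<sigma> Bottom Middle = \<epsilon> Bottom Middle" "\<sigma> Middle Bottom = \<epsilon> Bottom Middle"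
      "\<sigma> Bottom Top = \<epsilon> Bottom Top" "\<sigma> Top Bottom = \<epsilon> Bottom Top"
      "\<sigma> Middle Top = \<epsilon> Middle Top" "\<sigma> Top Middle = \<epsilon> Middle Top"
      using ovD s[of Bottom Middle] s[of Middle Bottom] s[of Bottom Top] s[of Top Bottom] s[of Middle Top] s[of Top Middle]
        \<epsilon>_sym[of Bottom Middle] \<epsilon>_sym[of Bottom Top] \<epsilon>_sym[of Middle Top] by simp_all
  qed
  have "SCI E - SCI D = ((\<Sum>(i, j)\<in>{(i, j). i \<noteq> j}. crossing_sign E (y i j) (y j i) * E.curve_index (y i j))
     - (\<Sum>(i, j)\<in>{(i, j). i \<noteq> j}. crossing_sign D (x i j) (x j i) * D.curve_index (x i j))) / 2"
    unfolding SCI_change_in sum_triangle[OF x' dpD] ED.sum_triangle[OF y' dpE] ..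
  also have "\<dots> = (\<Sum>(i, j)\<in>{(i, j). i \<noteq> j}. \<sigma> i j * \<Delta> i j) / 2"
    unfolding sum_subtractf[symmetric]
    by (intro arg_cong[of _ _ "\<lambda>z. z / 2"] sum.cong refl) (auto simp: sgE \<sigma>_def \<Delta>_def right_diff_distrib)
  also have "{(i, j). i \<noteq> j} = {(Bottom, Middle), (Middle, Bottom), (Bottom, Top), (Top, Bottom), (Middle, Top), (Top, Middle)}"
    (is "?A = _") 
  proof -
    have "(i, j) \<in> ?A \<longleftrightarrow> (i, j) \<in> {(Bottom, Middle), (Middle, Bottom), (Bottom, Top), (Top, Bottom), (Middle, Top), (Top, Middle)}" for i j
      by (cases i; cases j) auto
    then show ?thesis by auto
  qed
  also have "(\<Sum>(i, j)\<in>\<dots>. \<sigma> i j * \<Delta> i j) / 2 =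
      \<epsilon> Bottom Middle * \<Delta> Bottom Middle + \<epsilon> Bottom Top * \<Delta> Bottom Top + \<epsilon> Middle Top * \<Delta> Middle Top"
    using \<Delta>_sym[of Bottom Middle] \<Delta>_sym[of Bottom Top] \<Delta>_sym[of Middle Top] by (simp add: \<sigma>)
  also have "\<dots> = Q Bottom * Q Middle * Q Top"
  proof -
    have \<Delta>1: "\<Delta> Bottom Middle = - Q Bottom * \<epsilon> Bottom Top" "\<Delta> Bottom Top = Q Bottom * \<epsilon> Bottom Middle"
      "\<Delta> Middle Top = Q Middle * \<epsilon> Bottom Middle"
      using \<Delta>[of Bottom] \<Delta>(1)[of Middle] \<epsilon>_sym[of Bottom Middle] by simp_all
    \<comment> \<open>the change of the index at the crossing of bottom and top, computed along either strand\<close>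
    have "Q Bottom * \<epsilon> Bottom Middle = Q Top * \<epsilon> Middle Top"
      using \<Delta>1(2) \<Delta>(1)[of Top] \<Delta>_sym[of Bottom Top] \<epsilon>_sym[of Middle Top] by simp
    moreover have "Q Top * Q Top = 1" "\<epsilon> Bottom Middle * \<epsilon> Bottom Middle = 1"
      using \<epsilon>_val[of Bottom Middle] by (auto simp: Q_def)
    ultimately have "\<epsilon> Middle Top * \<epsilon> Bottom Middle = Q Bottom * Q Top"
      by algebra
    then show ?thesis unfolding \<Delta>1 by algebra
  qed
  finally show ?thesis by simp
qed

lemma odd_agreeing_sides:
  assumes "odd (agreeing_sides x)"
  defines "Q \<equiv> \<lambda>i. if x i (pred_strand i) < x i (succ_strand i) then 1 else (-1 :: real)"
  shows "Q Bottom * Q Middle * Q Top = 1"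
proof -
  let ?q = "\<lambda>i. x i (pred_strand i) < x i (succ_strand i)"
  have "{i. ?q i} = (if ?q Bottom then {Bottom} else {}) \<union> (if ?q Middle then {Middle} else {}) \<union> (if ?q Top then {Top} else {})"
  proof -
    have "i \<in> {i. ?q i} \<longleftrightarrow> i \<in> (if ?q Bottom then {Bottom} else {}) \<union> (if ?q Middle then {Middle} else {}) \<union> (if ?q Top then {Top} else {})" for i
      by (cases i) auto
    then show ?thesis by blast
  qed
  then show ?thesis
    using assms(1) unfolding agreeing_sides_def Q_def
    by (cases "?q Bottom"; cases "?q Middle"; cases "?q Top") simp_all
qed

section \<open>The effect of the moves\<close>

lemma up_to_reparam_SCI:
  assumes "up_to_reparam M D E"
    and M: "\<And>D' E'. M D' E' \<Longrightarrow> knot_diagram D' \<and> knot_diagram E' \<and> SCI E' = SCI D' + c"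
  shows "SCI E = SCI D + c"
proof -
  obtain D' E' where "knot_diagram D" "knot_diagram E" "reparam D D'" "reparam E E'" "M D' E'"
    using assms(1) unfolding up_to_reparam_def by blast
  then show ?thesis using M SCI_reparam by metis
qed

theorem theorem1p2:
  fixes D E :: diagram
  shows "(forward_Omega3 D E \<longrightarrow> SCI E = SCI D + 1) \<and>
         (Omega1F D E \<longrightarrow> SCI E = SCI D) \<and>
         (Omega2 D E \<longrightarrow> SCI E = SCI D)"
proof (intro conjI impI)
  assume "forward_Omega3 D E"
  then show "SCI E = SCI D + 1"
    unfolding forward_Omega3_def
  proof (rule up_to_reparam_SCI)
    fix D' E'
    assume "\<exists>x y. Omega3_local x y D' E' \<and> odd (agreeing_sides x) \<and> even (agreeing_sides y)"
    then obtain x y where xy: "Omega3_local x y D' E'" "odd (agreeing_sides x)" by blast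
    have "knot_diagram D'" "knot_diagram E'"
      using xy(1) unfolding Omega3_local_def local_change_def by blast+
    then show "knot_diagram D' \<and> knot_diagram E' \<and> SCI E' = SCI D' + 1"
      using SCI_Omega3_local[OF xy(1)] odd_agreeing_sides[OF xy(2)] by simp
  qed
next
  assume "Omega1F D E"
  then have "SCI E = SCI D + 0"
    unfolding Omega1F_def
  proof (rule up_to_reparam_SCI)
    fix D' E' assume "Omega1F_create D' E' \<or> Omega1F_create E' D'"
    moreover have "knot_diagram D' \<and> knot_diagram E'"
      using calculation unfolding Omega1F_create_def local_change_def by blast
    ultimately show "knot_diagram D' \<and> knot_diagram E' \<and> SCI E' = SCI D' + 0"
      using SCI_Omega1F_create by auto
  qed
  then show "SCI E = SCI D" by simp
next
  assume "Omega2 D E"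
  then have "SCI E = SCI D + 0"
    unfolding Omega2_def
  proof (rule up_to_reparam_SCI)
    fix D' E' assume "Omega2_create D' E' \<or> Omega2_create E' D'"
    moreover have "knot_diagram D' \<and> knot_diagram E'"
      using calculation unfolding Omega2_create_def local_change_def by blast
    ultimately show "knot_diagram D' \<and> knot_diagram E' \<and> SCI E' = SCI D' + 0"
      using SCI_Omega2_create by auto
  qed
  then show "SCI E = SCI D" by simp
qed

end
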